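(* Let $L_s=-\partial^2+u_s$ be an algebro-geometric Schrödinger operator with rational spectral curve $\Gamma_s$. The Liouvillian extension $K(\tau)\langle\Upsilon_s\rangle$ of $K(\tau)$, by a nonzero solution $\Upsilon_s$ of $(\partial-\tilde\phi_s)\Upsilon=0$, is isomorphic (as a differential field) to a spectral Picard-Vessiot field over the curve $\Gamma_s$ of the equation $(L_s-\lambda)(\Psi)=0$.
   Context: $(\Sigma,\partial)$ is a differential field of characteristic zero whose field of constants $C$ is algebraically closed. An operator $L\in\Sigma[\partial]\setminus C[\partial]$ of order $n$ is algebro-geometric if some $P\in\Sigma[\partial]$ of order relatively prime to $n$ satisfies $[L,P]=0$. Let $L_s=-\partial^2+u_s$ with $u_s\in\Sigma\setminus C$ be algebro-geometric. Then there is a unique monic operator $A_{2s+1}$ of minimal order $2s+1$ (minimal among operators of the centralizer not in $C[L_s]$) such that the centralizer of $L_s$ in $\Sigma[\partial]$ is $C[L_s,A_{2s+1}]$ and $A_{2s+1}^2+R_{2s+1}(L_s)=0$ with $R_{2s+1}\in C[\lambda]$ of degree $2s+1$; $A_{2s+1}$ is the partner of $L_s$ and $s$ the level. $K=C\langle u_s\rangle$ is the differential subfield of $\Sigma$ generated by $C$ and $u_s$; $L_s,A_{2s+1}\in K[\partial]$. Let $\lambda,\mu$ be algebraic indeterminates over $K$ with $\partial\lambda=\partial\mu=0$. Put $f_s=\mu^2+R_{2s+1}(\lambda)$; the spectral curve $\Gamma_s\subset C^2$ is $f_s=0$. $C(\Gamma_s)$ and $K(\Gamma_s)$ are the fraction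 fields of the domains $C[\lambda,\mu]/(f_s)$ and $K[\lambda,\mu]/(f_s)$; the derivation of $K(\Gamma_s)$ is induced by $\partial$ on $K[\lambda,\mu]$ acting on coefficients. The monic greatest common right divisor of $L_s-\lambda$ and $A_{2s+1}-\mu$ in $K(\Gamma_s)[\partial]$ has order one and is written $\partial-\phi_s$. Assume $\Gamma_s$ is rational (its projective closure is birationally equivalent to $\mathbb{P}^1$), with a rational parametrization $(\chi_1(\tau),\chi_2(\tau))\in C(\tau)^2$ inducing an isomorphism $\rho_1:C(\Gamma_s)\to C(\tau)$, $\lambda\mapsto\chi_1(\tau)$, $\mu\mapsto\chi_2(\tau)$. Here $\tau$ is an indeterminate over $K$ and $K(\tau)$ has the derivation extending $\partial$ with $\partial\tau=0$. $\rho_1$ extends to an isomorphism of differential fields $\rho_1:K(\Gamma_s)\to K(\tau)$ which is the identity on $K$. Put $\tilde\phi_s=\rho_1(\phi_s)$, so that $L_s-\chi_1(\tau)=(-\partial-\tilde\phi_s)(\partial-\tilde\phi_s)$ in $K(\tau)[\partial]$. Solutions $\Upsilon_s$ are taken in the differential closure of $K(\tau)$; $\langle\,\cdot\,\rangle$ denotes the generated differential field extension. A differential field extension $\mathcal{E}$ of $K(\Gamma_s)$ is a spectral Picard-Vessiot field over the curve $\Gamma_s$ of the equation $(L_s-\lambda)(\Psi)=0$ if (1) $\mathcal{E}=K(\Gamma_s)\langle\Psi_1,\Psi_2\rangle$ where $\{\Psi_1,\Psi_2\}$ is a fundamental set of solutions of $(L_s-\lambda)(\Psi)=0$, and (2)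 $\mathcal{E}$ and $K(\Gamma_s)$ have the same field of constants $C(\Gamma_s)$. *)

theory Defs
  imports "HOL-Algebra.Algebra"
begin

section \<open>Differential rings and fields\<close>

record 'a diff_ring = "'a ring" +
  der :: "'a \<Rightarrow> 'a"

text \<open>The differential subring with underlying set \<open>S\<close> is the record \<open>R\<lparr>carrier := S\<rparr>\<close>.\<close>

locale differential_field = field R for R :: "('a, 'm) diff_ring_scheme" (structure) +
  assumes der_closed: "x \<in> carrier R \<Longrightarrow> der R x \<in> carrier R"
    and der_add: "\<lbrakk>x \<in> carrier R; y \<in> carrier R\<rbrakk> \<Longrightarrow> der R (x \<oplus> y) = der R x \<oplus> der R y"
    and der_mult: "\<lbrakk>x \<in> carrier R; y \<in> carrier R\<rbrakk>
      \<Longrightarrow> der R (x \<otimes> y) = (der R x \<otimes> y) \<oplus> (x \<otimes> der R y)"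

definition char_zero :: "('a, 'm) ring_scheme \<Rightarrow> bool" where
  "char_zero R \<longleftrightarrow> (\<forall>n::nat. n > 0 \<longrightarrow> add_pow R n \<one>\<^bsub>R\<^esub> \<noteq> \<zero>\<^bsub>R\<^esub>)"

definition constants :: "('a, 'm) diff_ring_scheme \<Rightarrow> 'a set" where
  "constants R = {x \<in> carrier R. der R x = \<zero>\<^bsub>R\<^esub>}"

definition diff_generate :: "('a, 'm) diff_ring_scheme \<Rightarrow> 'a set \<Rightarrow> 'a set" where
  "diff_generate R H = \<Inter>{S. subfield S R \<and> der R ` S \<subseteq> S \<and> H \<subseteq> S}"

definition diff_ring_hom ::
    "('a, 'm) diff_ring_scheme \<Rightarrow> ('b, 'n) diff_ring_scheme \<Rightarrow> ('a \<Rightarrow> 'b) set" where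
  "diff_ring_hom R S = {h \<in> ring_hom R S. \<forall>x\<in>carrier R. h (der R x) = der S (h x)}"

definition diff_ring_iso ::
    "('a, 'm) diff_ring_scheme \<Rightarrow> ('b, 'n) diff_ring_scheme \<Rightarrow> ('a \<Rightarrow> 'b) set" where
  "diff_ring_iso R S = {h \<in> ring_iso R S. \<forall>x\<in>carrier R. h (der R x) = der S (h x)}"

text \<open>An extension is given by its embedding, which is injective because the source is a field.\<close>

definition diff_field_extension ::
    "('a, 'm) diff_ring_scheme \<Rightarrow> ('b, 'n) diff_ring_scheme \<Rightarrow> ('a \<Rightarrow> 'b) \<Rightarrow> bool" where
  "diff_field_extension F E \<iota> \<longleftrightarrow>
     differential_field F \<and> differential_field E \<and> \<iota> \<in> diff_ring_hom F E"


section \<open>Differentially closed fields and differential closures\<close>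

text \<open>
  A differential polynomial in one indeterminate \<open>y\<close> is a polynomial in the indeterminates
  \<open>y\<^sub>0, y\<^sub>1, \<dots>\<close>, with \<open>y\<^sub>i\<close> standing for the \<open>i\<close>-th derivative of \<open>y\<close>;
  monomials are multisets of natural numbers.
\<close>

definition diff_poly_eval :: "('a, 'm) diff_ring_scheme \<Rightarrow> (nat multiset \<Rightarrow> 'a) \<Rightarrow> 'a \<Rightarrow> 'a" where
  "diff_poly_eval R f y =
     (\<Oplus>\<^bsub>R\<^esub>m\<in>{m. f m \<noteq> \<zero>\<^bsub>R\<^esub>}.
        f m \<otimes>\<^bsub>R\<^esub> (\<Otimes>\<^bsub>R\<^esub>i\<in>set_mset m. ((der R ^^ i) y) [^]\<^bsub>R\<^esub> count m i))"

text \<open>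
  Blum's axioms, in characteristic zero. The two conditions on \<open>n\<close> say that the order of \<open>f\<close> is at least \<open>n\<close> and that
  the order of \<open>g\<close> is less than \<open>n\<close> (elements of the field have order \<open>-1\<close>).
\<close>

definition differentially_closed :: "('a, 'm) diff_ring_scheme \<Rightarrow> bool" where
  "differentially_closed R \<longleftrightarrow> differential_field R \<and> char_zero R \<and>
     (\<forall>f \<in> ring.indexed_pset R (UNIV :: nat set) (carrier R).
      \<forall>g \<in> ring.indexed_pset R (UNIV :: nat set) (carrier R). \<forall>n.
        (\<exists>m. f m \<noteq> \<zero>\<^bsub>R\<^esub> \<and> n \<in># m) \<and>
        (\<exists>m. g m \<noteq> \<zero>\<^bsub>R\<^esub>) \<and> (\<forall>m. g m \<noteq> \<zero>\<^bsub>R\<^esub> \<longrightarrow> (\<forall>i\<in>#m. i < n)) \<longrightarrow>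
        (\<exists>y\<in>carrier R. diff_poly_eval R f y = \<zero>\<^bsub>R\<^esub> \<and> diff_poly_eval R g y \<noteq> \<zero>\<^bsub>R\<^esub>))"

text \<open>
  The differential closure of \<open>F\<close> is the prime differentially closed extension of \<open>F\<close>.
  Quantifying over extensions \<open>M\<close> with elements in the type \<open>'b\<close> of \<open>D\<close> is no restriction:
  by the downward Loewenheim-Skolem theorem every differentially closed extension of \<open>F\<close>
  contains one of the cardinality of \<open>F\<close>, which has a copy in \<open>'b\<close>.
\<close>

definition differential_closure ::
    "('a, 'm) diff_ring_scheme \<Rightarrow> 'b diff_ring \<Rightarrow> ('a \<Rightarrow> 'b) \<Rightarrow> bool" where
  "differential_closure F D j \<longleftrightarrow>
     diff_field_extension F D j \<and> differentially_closed D \<and>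
     (\<forall>(M :: 'b diff_ring) m. diff_field_extension F M m \<and> differentially_closed M \<longrightarrow>
        (\<exists>h \<in> diff_ring_hom D M. \<forall>x\<in>carrier F. h (j x) = m x))"


section \<open>Polynomials, quotients and fractions with their derivations\<close>

definition with_der :: "('a, 'm) ring_scheme \<Rightarrow> ('a \<Rightarrow> 'a) \<Rightarrow> 'a diff_ring" where
  "with_der R d = \<lparr>carrier = carrier R, monoid.mult = monoid.mult R, one = one R,
     ring.zero = ring.zero R, ring.add = ring.add R, der = d\<rparr>"

text \<open>\<open>R[x]\<close> with \<open>\<partial>x = 0\<close>.\<close>

definition diff_poly :: "('a, 'm) diff_ring_scheme \<Rightarrow> (nat \<Rightarrow> 'a) diff_ring" where
  "diff_poly R = with_der (UP R) (\<lambda>p i. der R (p i))"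

definition diff_quot :: "('a, 'm) diff_ring_scheme \<Rightarrow> 'a set \<Rightarrow> 'a set diff_ring" where
  "diff_quot R I = with_der (R Quot I) (\<lambda>S. \<Union>x\<in>S. I +>\<^bsub>R\<^esub> der R x)"

definition fraction :: "('a, 'm) ring_scheme \<Rightarrow> 'a \<Rightarrow> 'a \<Rightarrow> ('a \<times> 'a) set" where
  "fraction R a b = {(x, y). x \<in> carrier R \<and> y \<in> carrier R - {\<zero>\<^bsub>R\<^esub>} \<and> x \<otimes>\<^bsub>R\<^esub> b = a \<otimes>\<^bsub>R\<^esub> y}"

definition frac_field :: "('a, 'm) diff_ring_scheme \<Rightarrow> ('a \<times> 'a) set diff_ring" where
  "frac_field R = \<lparr>
     carrier = {fraction R a b | a b. a \<in> carrier R \<and> b \<in> carrier R - {\<zero>\<^bsub>R\<^esub>}},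
     monoid.mult = (\<lambda>S T. \<Union>(a, b)\<in>S. \<Union>(c, d)\<in>T. fraction R (a \<otimes>\<^bsub>R\<^esub> c) (b \<otimes>\<^bsub>R\<^esub> d)),
     one = fraction R \<one>\<^bsub>R\<^esub> \<one>\<^bsub>R\<^esub>,
     ring.zero = fraction R \<zero>\<^bsub>R\<^esub> \<one>\<^bsub>R\<^esub>,
     ring.add = (\<lambda>S T. \<Union>(a, b)\<in>S. \<Union>(c, d)\<in>T.
              fraction R ((a \<otimes>\<^bsub>R\<^esub> d) \<oplus>\<^bsub>R\<^esub> (c \<otimes>\<^bsub>R\<^esub> b)) (b \<otimes>\<^bsub>R\<^esub> d)),
     der = (\<lambda>S. \<Union>(a, b)\<in>S.
              fraction R ((der R a \<otimes>\<^bsub>R\<^esub> b) \<ominus>\<^bsub>R\<^esub> (a \<otimes>\<^bsub>R\<^esub> der R b)) (b \<otimes>\<^bsub>R\<^esub> b))\<rparr>"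


section \<open>Linear differential operators\<close>

text \<open>
  The operator \<open>\<Sum>i. P i \<partial>\<^sup>i\<close> is represented by its coefficient sequence \<open>P\<close>, so its order is
  \<open>deg R P\<close>. Left multiplication by \<open>\<partial>\<close> follows from \<open>\<partial> a = a \<partial> + \<partial>(a)\<close>.
\<close>

definition del_times :: "('a, 'm) diff_ring_scheme \<Rightarrow> (nat \<Rightarrow> 'a) \<Rightarrow> nat \<Rightarrow> 'a" where
  "del_times R Q = (\<lambda>k. (if k = 0 then \<zero>\<^bsub>R\<^esub> else Q (k - 1)) \<oplus>\<^bsub>R\<^esub> der R (Q k))"

definition diff_ops :: "('a, 'm) diff_ring_scheme \<Rightarrow> (nat \<Rightarrow> 'a) ring" where
  "diff_ops R = \<lparr>
     carrier = up R,
     monoid.mult = (\<lambda>P Q k. \<Oplus>\<^bsub>R\<^esub>i\<in>{i. P i \<noteq> \<zero>\<^bsub>R\<^esub>}. P i \<otimes>\<^bsub>R\<^esub> (del_times R ^^ i) Q k),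
     one = (\<lambda>k. if k = 0 then \<one>\<^bsub>R\<^esub> else \<zero>\<^bsub>R\<^esub>),
     ring.zero = (\<lambda>k. \<zero>\<^bsub>R\<^esub>),
     ring.add = (\<lambda>P Q k. P k \<oplus>\<^bsub>R\<^esub> Q k)\<rparr>"

definition op_const :: "('a, 'm) ring_scheme \<Rightarrow> 'a \<Rightarrow> nat \<Rightarrow> 'a" where
  "op_const R a = (\<lambda>k. if k = 0 then a else \<zero>\<^bsub>R\<^esub>)"

text \<open>\<open>-\<partial>\<^sup>2 + u\<close> and \<open>\<partial> - \<phi>\<close>\<close>

definition schroedinger_op :: "('a, 'm) ring_scheme \<Rightarrow> 'a \<Rightarrow> nat \<Rightarrow> 'a" where
  "schroedinger_op R u =
     (\<lambda>k. if k = 0 then u else if k = 2 then \<ominus>\<^bsub>R\<^esub> \<one>\<^bsub>R\<^esub> else \<zero>\<^bsub>R\<^esub>)"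

definition first_order_op :: "('a, 'm) ring_scheme \<Rightarrow> 'a \<Rightarrow> nat \<Rightarrow> 'a" where
  "first_order_op R \<phi> =
     (\<lambda>k. if k = 0 then \<ominus>\<^bsub>R\<^esub> \<phi> else if k = 1 then \<one>\<^bsub>R\<^esub> else \<zero>\<^bsub>R\<^esub>)"

definition op_apply :: "('a, 'm) diff_ring_scheme \<Rightarrow> (nat \<Rightarrow> 'a) \<Rightarrow> 'a \<Rightarrow> 'a" where
  "op_apply R P y = (\<Oplus>\<^bsub>R\<^esub>i\<in>{i. P i \<noteq> \<zero>\<^bsub>R\<^esub>}. P i \<otimes>\<^bsub>R\<^esub> (der R ^^ i) y)"

definition monic_op :: "('a, 'm) ring_scheme \<Rightarrow> (nat \<Rightarrow> 'a) \<Rightarrow> bool" where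
  "monic_op R P \<longleftrightarrow> P (deg R P) = \<one>\<^bsub>R\<^esub>"

definition right_divides ::
    "('a, 'm) diff_ring_scheme \<Rightarrow> (nat \<Rightarrow> 'a) \<Rightarrow> (nat \<Rightarrow> 'a) \<Rightarrow> bool" where
  "right_divides R G P \<longleftrightarrow> (\<exists>Q\<in>carrier (diff_ops R). P = Q \<otimes>\<^bsub>diff_ops R\<^esub> G)"

definition monic_gcrd ::
    "('a, 'm) diff_ring_scheme \<Rightarrow> (nat \<Rightarrow> 'a) \<Rightarrow> (nat \<Rightarrow> 'a) \<Rightarrow> (nat \<Rightarrow> 'a) \<Rightarrow> bool" where
  "monic_gcrd R P Q G \<longleftrightarrow> G \<in> carrier (diff_ops R) \<and> monic_op R G \<and>
     right_divides R G P \<and> right_divides R G Q \<and>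
     (\<forall>H\<in>carrier (diff_ops R). right_divides R H P \<and> right_divides R H Q \<longrightarrow> right_divides R H G)"

definition centralizer :: "('a, 'm) diff_ring_scheme \<Rightarrow> (nat \<Rightarrow> 'a) \<Rightarrow> (nat \<Rightarrow> 'a) set" where
  "centralizer R L =
     {P \<in> carrier (diff_ops R). L \<otimes>\<^bsub>diff_ops R\<^esub> P = P \<otimes>\<^bsub>diff_ops R\<^esub> L}"

definition algebro_geometric :: "('a, 'm) diff_ring_scheme \<Rightarrow> (nat \<Rightarrow> 'a) \<Rightarrow> bool" where
  "algebro_geometric R L \<longleftrightarrow>
     L \<in> carrier (diff_ops R) \<and> \<not> (\<forall>i. L i \<in> constants R) \<and>
     (\<exists>P\<in>centralizer R L. P \<noteq> \<zero>\<^bsub>diff_ops R\<^esub> \<and> coprime (deg R P) (deg R L))"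

text \<open>\<open>C[S]\<close>, for \<open>C\<close> the field of constants and \<open>S\<close> a set of operators\<close>

definition const_algebra ::
    "('a, 'm) diff_ring_scheme \<Rightarrow> (nat \<Rightarrow> 'a) set \<Rightarrow> (nat \<Rightarrow> 'a) set" where
  "const_algebra R S = generate_ring (diff_ops R) (op_const R ` constants R \<union> S)"

text \<open>\<open>r(L)\<close> for a polynomial \<open>r\<close>\<close>

definition op_subst ::
    "('a, 'm) diff_ring_scheme \<Rightarrow> (nat \<Rightarrow> 'a) \<Rightarrow> (nat \<Rightarrow> 'a) \<Rightarrow> (nat \<Rightarrow> 'a)" where
  "op_subst R r L = (\<Oplus>\<^bsub>diff_ops R\<^esub>i\<in>{..deg R r}.
     op_const R (r i) \<otimes>\<^bsub>diff_ops R\<^esub> (L [^]\<^bsub>diff_ops R\<^esub> i))"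

text \<open>\<open>A\<close> is the partner of \<open>L\<close>, of level \<open>s\<close>, with relation \<open>A\<^sup>2 + r(L) = 0\<close>.\<close>

definition partner ::
    "('a, 'm) diff_ring_scheme \<Rightarrow> (nat \<Rightarrow> 'a) \<Rightarrow> nat \<Rightarrow> (nat \<Rightarrow> 'a) \<Rightarrow> (nat \<Rightarrow> 'a) \<Rightarrow> bool" where
  "partner R L s A r \<longleftrightarrow>
     A \<in> centralizer R L - const_algebra R {L} \<and> monic_op R A \<and> deg R A = 2 * s + 1 \<and>
     (\<forall>P \<in> centralizer R L - const_algebra R {L}. 2 * s + 1 \<le> deg R P) \<and>
     centralizer R L = const_algebra R {L, A} \<and>
     r \<in> up R \<and> (\<forall>i. r i \<in> constants R) \<and> deg R r = 2 * s + 1 \<and>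
     (A \<otimes>\<^bsub>diff_ops R\<^esub> A) \<oplus>\<^bsub>diff_ops R\<^esub> op_subst R r L = \<zero>\<^bsub>diff_ops R\<^esub>"


section \<open>The spectral curve and its function fields\<close>

text \<open>\<open>K[\<lambda>, \<mu>]\<close> is \<open>K[\<lambda>][\<mu>]\<close>: \<open>p i j\<close> is the coefficient of \<open>\<lambda>\<^sup>j \<mu>\<^sup>i\<close> in \<open>p\<close>.\<close>

definition bivar :: "('a, 'm) diff_ring_scheme \<Rightarrow> (nat \<Rightarrow> nat \<Rightarrow> 'a) diff_ring" where
  "bivar K = diff_poly (diff_poly K)"

definition bivar_const :: "('a, 'm) diff_ring_scheme \<Rightarrow> 'a \<Rightarrow> (nat \<Rightarrow> nat \<Rightarrow> 'a)" where
  "bivar_const K a = monom (UP (diff_poly K)) (monom (UP K) a 0) 0"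

definition bivar_lambda :: "('a, 'm) diff_ring_scheme \<Rightarrow> (nat \<Rightarrow> nat \<Rightarrow> 'a)" where
  "bivar_lambda K = monom (UP (diff_poly K)) (monom (UP K) \<one>\<^bsub>K\<^esub> 1) 0"

definition bivar_mu :: "('a, 'm) diff_ring_scheme \<Rightarrow> (nat \<Rightarrow> nat \<Rightarrow> 'a)" where
  "bivar_mu K = monom (UP (diff_poly K)) (monom (UP K) \<one>\<^bsub>K\<^esub> 0) 1"

text \<open>\<open>f = \<mu>\<^sup>2 + r(\<lambda>)\<close>\<close>

definition curve_eq :: "('a, 'm) diff_ring_scheme \<Rightarrow> (nat \<Rightarrow> 'a) \<Rightarrow> (nat \<Rightarrow> nat \<Rightarrow> 'a)" where
  "curve_eq K r =
     (bivar_mu K \<otimes>\<^bsub>bivar K\<^esub> bivar_mu K) \<oplus>\<^bsub>bivar K\<^esub> monom (UP (diff_poly K)) r 0"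

definition curve_ideal ::
    "('a, 'm) diff_ring_scheme \<Rightarrow> (nat \<Rightarrow> 'a) \<Rightarrow> (nat \<Rightarrow> nat \<Rightarrow> 'a) set" where
  "curve_ideal K r = cgenideal (bivar K) (curve_eq K r)"

type_synonym 'a curve_fun = "((nat \<Rightarrow> nat \<Rightarrow> 'a) set \<times> (nat \<Rightarrow> nat \<Rightarrow> 'a) set) set"

definition curve_ring ::
    "('a, 'm) diff_ring_scheme \<Rightarrow> (nat \<Rightarrow> 'a) \<Rightarrow> (nat \<Rightarrow> nat \<Rightarrow> 'a) set diff_ring" where
  "curve_ring K r = diff_quot (bivar K) (curve_ideal K r)"

definition curve_field ::
    "('a, 'm) diff_ring_scheme \<Rightarrow> (nat \<Rightarrow> 'a) \<Rightarrow> 'a curve_fun diff_ring" where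
  "curve_field K r = frac_field (curve_ring K r)"

definition curve_frac :: "('a, 'm) diff_ring_scheme \<Rightarrow> (nat \<Rightarrow> 'a)
    \<Rightarrow> (nat \<Rightarrow> nat \<Rightarrow> 'a) \<Rightarrow> (nat \<Rightarrow> nat \<Rightarrow> 'a) \<Rightarrow> 'a curve_fun" where
  "curve_frac K r p q = fraction (curve_ring K r)
     (curve_ideal K r +>\<^bsub>bivar K\<^esub> p) (curve_ideal K r +>\<^bsub>bivar K\<^esub> q)"

definition curve_of_poly :: "('a, 'm) diff_ring_scheme \<Rightarrow> (nat \<Rightarrow> 'a)
    \<Rightarrow> (nat \<Rightarrow> nat \<Rightarrow> 'a) \<Rightarrow> 'a curve_fun" where
  "curve_of_poly K r p = curve_frac K r p \<one>\<^bsub>bivar K\<^esub>"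

text \<open>
  \<open>C(\<Gamma>)\<close>, for \<open>C\<close> the constants of \<open>K\<close>, as a subfield of \<open>K(\<Gamma>)\<close>: the quotients of classes of
  polynomials with coefficients in \<open>C\<close>. This is the image of the fraction field of
  \<open>C[\<lambda>, \<mu>]/(f)\<close>, since \<open>f\<close> is monic in \<open>\<mu>\<close> and so generates in \<open>K[\<lambda>, \<mu>]\<close> an ideal which meets
  \<open>C[\<lambda>, \<mu>]\<close> exactly in the ideal generated there.
\<close>

definition curve_const_field ::
    "('a, 'm) diff_ring_scheme \<Rightarrow> (nat \<Rightarrow> 'a) \<Rightarrow> 'a curve_fun set" where
  "curve_const_field K r = {curve_frac K r p q | p q.
     p \<in> carrier (bivar K) \<and> q \<in> carrier (bivar K) - curve_ideal K r \<and>
     (\<forall>i j. p i j \<in> constants K) \<and> (\<forall>i j. q i j \<in> constants K)}"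

definition rat_field :: "('a, 'm) diff_ring_scheme \<Rightarrow> ((nat \<Rightarrow> 'a) \<times> (nat \<Rightarrow> 'a)) set diff_ring" where
  "rat_field K = frac_field (diff_poly K)"

definition rat_const ::
    "('a, 'm) diff_ring_scheme \<Rightarrow> 'a \<Rightarrow> ((nat \<Rightarrow> 'a) \<times> (nat \<Rightarrow> 'a)) set" where
  "rat_const K a = fraction (diff_poly K) (monom (UP K) a 0) \<one>\<^bsub>UP K\<^esub>"

text \<open>\<open>C(\<tau>)\<close> as a subfield of \<open>K(\<tau>)\<close>\<close>

definition rat_const_field ::
    "('a, 'm) diff_ring_scheme \<Rightarrow> ((nat \<Rightarrow> 'a) \<times> (nat \<Rightarrow> 'a)) set set" where
  "rat_const_field K = {fraction (diff_poly K) p q | p q.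
     p \<in> carrier (UP K) \<and> q \<in> carrier (UP K) - {\<zero>\<^bsub>UP K\<^esub>} \<and>
     (\<forall>i. p i \<in> constants K) \<and> (\<forall>i. q i \<in> constants K)}"

text \<open>\<open>P - x\<close> in \<open>K(\<Gamma>)[\<partial>]\<close>, for \<open>P \<in> K[\<partial>]\<close> and \<open>x\<close> the class of a polynomial \<open>p\<close>\<close>

definition shifted_op :: "('a, 'm) diff_ring_scheme \<Rightarrow> (nat \<Rightarrow> 'a)
    \<Rightarrow> (nat \<Rightarrow> 'a) \<Rightarrow> (nat \<Rightarrow> nat \<Rightarrow> 'a) \<Rightarrow> (nat \<Rightarrow> 'a curve_fun)" where
  "shifted_op K r P p =
     (\<lambda>i. curve_of_poly K r (bivar_const K (P i)))
       \<ominus>\<^bsub>diff_ops (curve_field K r)\<^esub> op_const (curve_field K r) (curve_of_poly K r p)"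


section \<open>Spectral Picard-Vessiot fields\<close>

text \<open>
  \<open>{y1, y2}\<close> is a fundamental set of solutions in \<open>E\<close> of a second order equation \<open>P(y) = 0\<close>:
  two solutions which are linearly independent over the constants of \<open>E\<close>.
\<close>

definition fundamental_pair ::
    "('a, 'm) diff_ring_scheme \<Rightarrow> (nat \<Rightarrow> 'a) \<Rightarrow> 'a \<Rightarrow> 'a \<Rightarrow> bool" where
  "fundamental_pair E P y1 y2 \<longleftrightarrow>
     y1 \<in> carrier E \<and> y2 \<in> carrier E \<and>
     op_apply E P y1 = \<zero>\<^bsub>E\<^esub> \<and> op_apply E P y2 = \<zero>\<^bsub>E\<^esub> \<and>
     (\<forall>c1\<in>constants E. \<forall>c2\<in>constants E.
        (c1 \<otimes>\<^bsub>E\<^esub> y1) \<oplus>\<^bsub>E\<^esub> (c2 \<otimes>\<^bsub>E\<^esub> y2) = \<zero>\<^bsub>E\<^esub> \<longrightarrow> c1 = \<zero>\<^bsub>E\<^esub> \<and> c2 = \<zero>\<^bsub>E\<^esub>)"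

definition spectral_PV_field :: "('a, 'm) diff_ring_scheme \<Rightarrow> (nat \<Rightarrow> 'a) \<Rightarrow> (nat \<Rightarrow> 'a)
    \<Rightarrow> ('b, 'n) diff_ring_scheme \<Rightarrow> ('a curve_fun \<Rightarrow> 'b) \<Rightarrow> bool" where
  "spectral_PV_field K r L E \<iota> \<longleftrightarrow>
     diff_field_extension (curve_field K r) E \<iota> \<and>
     (\<exists>y1 y2. fundamental_pair E (\<lambda>i. \<iota> (shifted_op K r L (bivar_lambda K) i)) y1 y2 \<and>
        carrier E = diff_generate E (\<iota> ` carrier (curve_field K r) \<union> {y1, y2})) \<and>
     constants (curve_field K r) = curve_const_field K r \<and>
     constants E = \<iota> ` curve_const_field K r"

end

theory Submission
  imports Defs "HOL-Decision_Procs.Commutative_Ring" "HOL-Library.Reflection"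
begin

text \<open>
  Let \<open>\<iota> = j \<circ> \<rho>\<close> be the embedding of \<open>K(\<Gamma>)\<close> into \<open>D\<close>. The spectral Picard-Vessiot field is the subfield
  \<open>E = K(\<tau>)\<langle>\<Upsilon>\<rangle>\<close> of \<open>D\<close>, viewed as an extension of \<open>K(\<Gamma>)\<close> by \<open>\<iota>\<close>, and the isomorphism is the
  identity. It remains to find a second solution of \<open>L - \<lambda>\<close> in \<open>E\<close> and to show that \<open>E\<close> has no
  constants besides \<open>C(\<Gamma>)\<close>.

  The operator \<open>\<partial> - \<phi>\<close> is a right factor of \<open>L - \<lambda>\<close>, so \<open>\<Upsilon>'' = (u - \<lambda>)\<Upsilon>\<close>
  (\<open>op_apply_right_factor\<close>), and \<open>\<phi>\<close> satisfies the Riccati equation \<open>\<phi>' + \<phi>\<^sup>2 = u - \<lambda>\<close>. From there on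
  only the behaviour at infinity matters. Since \<open>r\<close> has odd degree \<open>2s + 1\<close>, the curve
  \<open>\<mu>\<^sup>2 + r(\<lambda>) = 0\<close> has one point at infinity; there \<open>\<lambda>\<close> has a pole of order \<open>2\<close> and \<open>\<mu>\<close> one of order
  \<open>2s + 1\<close>. In \<open>a + b\<mu>\<close> with \<open>a, b \<in> K[\<lambda>]\<close> the two terms have pole orders of different parity
  and do not cancel (\<open>odd_norm_degree\<close>), and the derivation, which acts on coefficients, does not
  raise pole orders. The parity also shows that the curve is irreducible (\<open>I_prime\<close>), so that
  \<open>K(\<Gamma>)\<close> is a differential field.

  Second solution. Write \<open>\<phi> = \<alpha> + \<beta>\<mu>\<close> with \<open>\<alpha>, \<beta> \<in> K(\<lambda>)\<close>. The \<open>\<mu>\<close>-part of the Riccati equation is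
  \<open>\<beta>' = -2\<alpha>\<beta>\<close>, and \<open>\<beta> \<noteq> 0\<close> because the Riccati equation has no solution in \<open>K(\<lambda>)\<close>
  (\<open>no_rational_riccati\<close>). Hence \<open>1/(\<beta>\<Upsilon>)\<close> has the logarithmic derivative \<open>\<alpha> - \<beta>\<mu>\<close>, the conjugate
  of \<open>\<phi>\<close>, which solves the same Riccati equation (\<open>conjugate_solution\<close>).

  Constants. By the Riccati equation \<open>\<phi>\<close> has a pole at infinity, whereas a logarithmic derivative
  \<open>w'/w\<close> with \<open>w \<in> K(\<Gamma>)\<close> has none; so \<open>n\<phi> = w'/w\<close> is impossible for \<open>n > 0\<close>
  (\<open>no_log_derivative\<close>). In this situation adjoining a solution of \<open>Y' = \<phi>Y\<close> creates no constants
  (\<open>no_new_constants\<close>). Finally the constants of \<open>K(\<tau>)\<close> are \<open>C(\<tau>)\<close> (\<open>constants_rat_field\<close>), which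
  \<open>\<rho>\<close> carries back to \<open>C(\<Gamma>)\<close>.
\<close>

section \<open>Identities in commutative rings\<close>

text \<open>A polynomial identity is reified as a pair of polynomial expressions, which are evaluated at a list
  of elements. It holds when both expressions have the same normal form.\<close>

primrec vars_below :: "nat \<Rightarrow> polex \<Rightarrow> bool" where
  "vars_below n (Var i) = (i < n)"
| "vars_below n (Const c) = True"
| "vars_below n (Add p q) = (vars_below n p \<and> vars_below n q)"
| "vars_below n (Sub p q) = (vars_below n p \<and> vars_below n q)"
| "vars_below n (Mul p q) = (vars_below n p \<and> vars_below n q)"
| "vars_below n (Pow p k) = vars_below n p"
| "vars_below n (Neg p) = vars_below n p"

context cring begin

text \<open>Unlike \<open>Ipolex\<close> this reads variables with \<open>(!)\<close>, the form in which reification supplies them. The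
  two agree as long as all variables lie within the list.\<close>

primrec polex_value :: "'a list \<Rightarrow> polex \<Rightarrow> 'a" where
  "polex_value l (Var n) = l ! n"
| "polex_value l (Const c) = \<guillemotleft>c\<guillemotright>"
| "polex_value l (Add p q) = polex_value l p \<oplus> polex_value l q"
| "polex_value l (Sub p q) = polex_value l p \<ominus> polex_value l q"
| "polex_value l (Mul p q) = polex_value l p \<otimes> polex_value l q"
| "polex_value l (Pow p n) = polex_value l p [^] n"
| "polex_value l (Neg p) = \<ominus> polex_value l p"

definition polex_identity :: "'a list \<Rightarrow> polex \<times> polex \<Rightarrow> bool" where
  "polex_identity l e \<longleftrightarrow> polex_value l (fst e) = polex_value l (snd e)"

lemma polex_identity_eq: "polex_identity l (p, q) \<longleftrightarrow> polex_value l p = polex_value l q"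
  by (simp add: polex_identity_def)

lemma polex_value_Ipolex: "vars_below (length l) p \<Longrightarrow> polex_value l p = Ipolex l p"
proof (induct p)
  case (Var n)
  hence drop: "drop n l = l ! n # drop (Suc n) l" using Cons_nth_drop_Suc[of n l] by simp
  show ?case unfolding polex_value.simps Ipolex.simps by (subst drop) (simp only: head.simps)
qed simp_all

lemma polex_value_0_1: "polex_value l (Const 0) = \<zero>" "polex_value l (Const 1) = \<one>"
  by simp_all

lemmas polex = polex_value.simps(1,3-7) polex_value_0_1 polex_identity_eq

lemma polex_identityI:
  assumes "in_carrier l" "vars_below (length l) p" "vars_below (length l) q" "norm p = norm q"
  shows "polex_identity l (p, q)"
  unfolding polex_identity_eq polex_value_Ipolex[OF assms(2)] polex_value_Ipolex[OF assms(3)]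
  by (rule norm_eq[OF assms(1,4)])

lemmas normal_form = polex_identityI in_carrier_def mkPX_def mkPinj_def sub_def

end

section \<open>Derivations on domains and fields\<close>

lemma (in ring) eq_by_difference:
  "\<lbrakk>a \<ominus> b = \<zero>; a \<in> carrier R; b \<in> carrier R\<rbrakk> \<Longrightarrow> a = b"
  by simp

locale differential_domain = domain R for R :: "('a, 'm) diff_ring_scheme" (structure) +
  assumes der_closed [simp, intro]: "x \<in> carrier R \<Longrightarrow> der R x \<in> carrier R"
    and der_add: "\<lbrakk>x \<in> carrier R; y \<in> carrier R\<rbrakk> \<Longrightarrow> der R (x \<oplus> y) = der R x \<oplus> der R y"
    and der_mult: "\<lbrakk>x \<in> carrier R; y \<in> carrier R\<rbrakk>
      \<Longrightarrow> der R (x \<otimes> y) = (der R x \<otimes> y) \<oplus> (x \<otimes> der R y)"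
begin

lemma der_zero [simp]: "der R \<zero> = \<zero>"
  using der_add[of \<zero> \<zero>] by (metis add.l_cancel_one der_closed l_zero zero_closed)

lemma der_one [simp]: "der R \<one> = \<zero>"
  using der_mult[of \<one> \<one>] by (metis add.l_cancel_one der_closed l_one one_closed r_one)

lemma der_a_inv: "x \<in> carrier R \<Longrightarrow> der R (\<ominus> x) = \<ominus> der R x"
  using der_add[of x "\<ominus> x"] by (simp add: r_neg minus_equality[symmetric] a_comm)

lemma der_minus:
  "\<lbrakk>x \<in> carrier R; y \<in> carrier R\<rbrakk> \<Longrightarrow> der R (x \<ominus> y) = der R x \<ominus> der R y"
  by (simp add: a_minus_def der_add der_a_inv)

lemma der_of_natural [simp]: "der R (of_natural R n) = \<zero>"
  by (induct n) (simp_all add: der_add)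

lemma der_finsum:
  assumes "finite A" "f \<in> A \<rightarrow> carrier R"
  shows "der R (\<Oplus>i\<in>A. f i) = (\<Oplus>i\<in>A. der R (f i))"
  using assms by (induct A rule: finite_induct) (simp_all add: der_add Pi_def)

lemma der_power_log:
  assumes "y \<in> carrier R" "\<phi> \<in> carrier R" "der R y = \<phi> \<otimes> y"
  shows "der R (y [^] (n::nat)) = of_natural R n \<otimes> \<phi> \<otimes> y [^] n"
proof (induct n)
  case (Suc n)
  have "\<And>p k. \<lbrakk>p \<in> carrier R; k \<in> carrier R\<rbrakk> \<Longrightarrow>
      (k \<otimes> \<phi> \<otimes> p) \<otimes> y \<oplus> p \<otimes> (\<phi> \<otimes> y) = (\<one> \<oplus> k) \<otimes> \<phi> \<otimes> (p \<otimes> y)"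
  proof -
    fix p k assume [simp]: "p \<in> carrier R" "k \<in> carrier R"
    note assms(1,2)[simp]
    show "(k \<otimes> \<phi> \<otimes> p) \<otimes> y \<oplus> p \<otimes> (\<phi> \<otimes> y) = (\<one> \<oplus> k) \<otimes> \<phi> \<otimes> (p \<otimes> y)" by (reify polex) (simp add: normal_form)
  qed
  with Suc assms show ?case by (simp add: der_mult)
qed (use assms in simp)

end

context differential_field begin

sublocale differential_domain
  by unfold_locales (auto simp: der_closed der_add der_mult)

lemma div_closed [simp, intro]: "\<lbrakk>x \<in> carrier R; y \<in> carrier R\<rbrakk> \<Longrightarrow> x \<oslash> y \<in> carrier R"
  by (auto simp: m_div_def field_Units)

lemma div_eq_iff:
  assumes "x \<in> carrier R" "y \<in> carrier R" "z \<in> carrier R" "y \<noteq> \<zero>"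
  shows "x \<oslash> y = z \<longleftrightarrow> x = z \<otimes> y"
proof -
  have "inv y \<in> carrier R" "y \<otimes> inv y = \<one>" "inv y \<otimes> y = \<one>" using assms by (auto simp: field_Units)
  with assms show ?thesis by (auto simp: m_div_def m_assoc)
qed

lemma mult_div_cancel [simp]:
  "\<lbrakk>x \<in> carrier R; y \<in> carrier R; y \<noteq> \<zero>\<rbrakk> \<Longrightarrow> (x \<otimes> y) \<oslash> y = x"
  by (subst div_eq_iff) simp_all

lemma div_self [simp]: "\<lbrakk>y \<in> carrier R; y \<noteq> \<zero>\<rbrakk> \<Longrightarrow> y \<oslash> y = \<one>"
  by (subst div_eq_iff) simp_all

lemma der_div:
  assumes c [simp]: "x \<in> carrier R" "y \<in> carrier R" and y: "y \<noteq> \<zero>"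
  shows "der R (x \<oslash> y) = (der R x \<otimes> y \<ominus> x \<otimes> der R y) \<oslash> (y \<otimes> y)"
proof -
  define z where "z = x \<oslash> y"
  have z [simp]: "z \<in> carrier R" and x: "x = z \<otimes> y" using y by (simp_all add: z_def)
  have "(z' \<otimes> y \<oplus> z \<otimes> y') \<otimes> y \<ominus> (z \<otimes> y) \<otimes> y' = z' \<otimes> (y \<otimes> y)"
    if [simp]: "z' \<in> carrier R" "y' \<in> carrier R" for z' y'
    by (reify polex) (simp add: normal_form)
  hence "der R x \<otimes> y \<ominus> x \<otimes> der R y = der R z \<otimes> (y \<otimes> y)" unfolding x by (simp add: der_mult)
  hence "(der R x \<otimes> y \<ominus> x \<otimes> der R y) \<oslash> (y \<otimes> y) = der R z"
    using y by (subst div_eq_iff) (simp_all add: integral_iff)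
  thus ?thesis by (simp add: z_def)
qed

lemma der_inverse_log:
  assumes [simp]: "l \<in> carrier R" "w \<in> carrier R" and w: "w \<noteq> \<zero>" "der R w = l \<otimes> w"
  shows "der R (\<one> \<oslash> w) = \<ominus> l \<otimes> (\<one> \<oslash> w)"
proof -
  define i where "i = \<one> \<oslash> w"
  have i [simp]: "i \<in> carrier R" "i \<otimes> w = \<one>" using w by (simp_all add: i_def)
  have "\<zero> \<otimes> w \<ominus> (i \<otimes> w) \<otimes> (l \<otimes> w) = \<ominus> l \<otimes> i \<otimes> (w \<otimes> w)"
    by (reify polex) (simp add: normal_form)
  hence "\<zero> \<otimes> w \<ominus> \<one> \<otimes> (l \<otimes> w) = \<ominus> l \<otimes> i \<otimes> (w \<otimes> w)" by (simp only: i)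
  thus ?thesis using w by (simp add: der_div div_eq_iff integral_iff i_def)
qed

lemma subfield_div:
  assumes "subfield T R" "a \<in> T" "b \<in> T"
  shows "a \<oslash> b \<in> T"
  using assms subfield_m_inv(1)[OF assms(1), of b] subringE(2,6)[OF subfieldE(1)[OF assms(1)]]
  by (auto simp: m_div_def)

lemma subfield_of_natural:
  assumes "subfield T R"
  shows "of_natural R n \<in> T"
  using subringE(2,3,7)[OF subfieldE(1)[OF assms]] by (induct n) auto

lemma subring_fractions_subfield:
  assumes "subring S R"
  shows "subfield {a \<oslash> b | a b. a \<in> S \<and> b \<in> S \<and> b \<noteq> \<zero>} R" (is "subfield ?X R")
proof (rule subfieldI')
  note S = subringE[OF assms]
  have sub[simp]: "x \<in> carrier R" if "x \<in> S" for x using S(1) that by blast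
  have nz: "b \<otimes> d \<noteq> \<zero>" if "b \<in> S" "d \<in> S" "b \<noteq> \<zero>" "d \<noteq> \<zero>" for b d
    using that sub by (simp add: integral_iff)
  have mem: "x \<in> ?X" if "x = a \<oslash> b" "a \<in> S" "b \<in> S" "b \<noteq> \<zero>" for x a b using that by blast
  show "subring ?X R"
  proof (rule subringI)
    show "?X \<subseteq> carrier R" by auto
    show "\<one> \<in> ?X" by (rule mem[of _ \<one> \<one>]) (use S in \<open>auto simp: div_eq_iff\<close>)
    show "\<ominus> h \<in> ?X" if "h \<in> ?X" for h
    proof -
      from that obtain a b where h: "h = a \<oslash> b" "a \<in> S" "b \<in> S" "b \<noteq> \<zero>" by blast
      have [simp]: "a \<in> carrier R" "b \<in> carrier R" using h by auto
      have "(\<ominus> a) \<oslash> b = \<ominus> (a \<oslash> b)" using h by (simp add: div_eq_iff l_minus)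
      hence "\<ominus> (a \<oslash> b) = (\<ominus> a) \<oslash> b" by simp
      thus ?thesis unfolding h(1) by (rule mem) (use h S(5) in auto)
    qed
    fix h1 h2 assume "h1 \<in> ?X" "h2 \<in> ?X"
    then obtain a b c d where h: "h1 = a \<oslash> b" "a \<in> S" "b \<in> S" "b \<noteq> \<zero>"
      "h2 = c \<oslash> d" "c \<in> S" "d \<in> S" "d \<noteq> \<zero>" by blast
    have [simp]: "a \<in> carrier R" "b \<in> carrier R" "c \<in> carrier R" "d \<in> carrier R" using h by auto
    define z where "z = a \<oslash> b"
    define w where "w = c \<oslash> d"
    have [simp]: "z \<in> carrier R" "w \<in> carrier R" and ac: "a = z \<otimes> b" "c = w \<otimes> d"
      using h by (simp_all add: z_def w_def)
    have bd: "b \<otimes> d \<noteq> \<zero>" "b \<otimes> d \<in> carrier R" using h nz by simp_all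
    have "a \<otimes> c = z \<otimes> w \<otimes> (b \<otimes> d)" "a \<otimes> d \<oplus> c \<otimes> b = (z \<oplus> w) \<otimes> (b \<otimes> d)"
      unfolding ac by (reify polex, simp add: normal_form)+
    hence "(a \<otimes> c) \<oslash> (b \<otimes> d) = z \<otimes> w" "(a \<otimes> d \<oplus> c \<otimes> b) \<oslash> (b \<otimes> d) = z \<oplus> w"
      using bd by (simp_all add: div_eq_iff)
    hence prod: "(a \<oslash> b) \<otimes> (c \<oslash> d) = (a \<otimes> c) \<oslash> (b \<otimes> d)"
      and sum: "(a \<oslash> b) \<oplus> (c \<oslash> d) = (a \<otimes> d \<oplus> c \<otimes> b) \<oslash> (b \<otimes> d)"
      unfolding z_def w_def by simp_all
    from prod show "h1 \<otimes> h2 \<in> ?X" unfolding h(1) h(5) by (rule mem) (use h S nz[of b d] in simp_all)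
    from sum show "h1 \<oplus> h2 \<in> ?X" unfolding h(1) h(5) by (rule mem) (use h S nz[of b d] in simp_all)
  qed
  fix k assume k: "k \<in> ?X - {\<zero>}"
  then obtain a b where h: "k = a \<oslash> b" "a \<in> S" "b \<in> S" "b \<noteq> \<zero>" by blast
  have [simp]: "a \<in> carrier R" "b \<in> carrier R" using h by auto
  have a: "a \<noteq> \<zero>" using k h by (auto simp: div_eq_iff)
  have "((a \<oslash> b) \<otimes> (b \<oslash> a)) \<otimes> a = \<one> \<otimes> a" using h a by (simp add: m_assoc)
  hence "(a \<oslash> b) \<otimes> (b \<oslash> a) = \<one>" using a by (subst (asm) m_rcancel) simp_all
  hence "inv k = b \<oslash> a" unfolding h(1) by (intro comm_inv_char) auto
  thus "inv k \<in> ?X" by (rule mem) (use h a in auto)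
qed

lemma diff_generate_least:
  assumes "subfield S R" "\<And>x. x \<in> S \<Longrightarrow> der R x \<in> S" "H \<subseteq> S"
  shows "diff_generate R H \<subseteq> S"
  using assms unfolding diff_generate_def by blast

lemma diff_generate_incl: "H \<subseteq> diff_generate R H"
  unfolding diff_generate_def by blast

lemma diff_generate_der: "x \<in> diff_generate R H \<Longrightarrow> der R x \<in> diff_generate R H"
  unfolding diff_generate_def by blast

lemma diff_generate_subfield:
  assumes "H \<subseteq> carrier R"
  shows "subfield (diff_generate R H) R"
proof -
  let ?F = "{S. subfield S R \<and> der R ` S \<subseteq> S \<and> H \<subseteq> S}"
  have ne: "carrier R \<in> ?F" using assms carrier_is_subfield by auto
  show ?thesis unfolding diff_generate_def
  proof (rule subfieldI')
    show "subring (\<Inter>?F) R" using ne by (intro subring_Inter) (auto intro: subfieldE(1))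
    fix k assume "k \<in> \<Inter>?F - {\<zero>}"
    thus "inv k \<in> \<Inter>?F" using subfield_m_inv(1)[of _ k] by blast
  qed
qed

lemma differential_subfield:
  assumes "subfield S R" "\<And>x. x \<in> S \<Longrightarrow> der R x \<in> S"
  shows "differential_field (R\<lparr>carrier := S\<rparr>)"
proof -
  interpret S: field "R\<lparr>carrier := S\<rparr>" using subfield_iff(2)[OF assms(1)] .
  have "S \<subseteq> carrier R" using subfieldE(3)[OF assms(1)] .
  thus ?thesis using assms(2) by unfold_locales (auto simp: der_add der_mult subset_iff)
qed

end

section \<open>Constants of exponential extensions\<close>

text \<open>The last assumption says that no \<open>w Y\<^sup>n\<close> with \<open>n > 0\<close> and \<open>w \<in> T\<close> nonzero is constant: such a
  \<open>w\<close> would make \<open>1/w\<close> a nonzero solution of \<open>w' = n\<phi>w\<close>.\<close>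

locale exponential_extension = differential_field +
  fixes T and \<phi> and Y
  assumes T_subfield: "subfield T R"
    and T_der: "x \<in> T \<Longrightarrow> der R x \<in> T"
    and phi_T: "\<phi> \<in> T"
    and Y_carrier [simp]: "Y \<in> carrier R" and Y_nonzero: "Y \<noteq> \<zero>"
    and Y_der: "der R Y = \<phi> \<otimes> Y"
    and not_log_derivative:
      "\<lbrakk>n > 0; w \<in> T; der R w = of_natural R n \<otimes> \<phi> \<otimes> w\<rbrakk> \<Longrightarrow> w = \<zero>"
begin

lemma T_carrier [simp]: "x \<in> T \<Longrightarrow> x \<in> carrier R"
  using subfieldE(3)[OF T_subfield] by blast

lemmas T_closed [simp] = subringE(2,3,5-7)[OF subfieldE(1)[OF T_subfield]]
  subfield_div[OF T_subfield] subfield_of_natural[OF T_subfield] T_der phi_T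

lemma T_minus [simp]: "\<lbrakk>x \<in> T; y \<in> T\<rbrakk> \<Longrightarrow> x \<ominus> y \<in> T"
  by (simp add: a_minus_def)

lemma Y_power [simp]: "Y [^] (n::nat) \<in> carrier R" "Y [^] (n::nat) \<noteq> \<zero>"
  using Y_carrier Y_nonzero by (auto simp: nat_pow_eq_0_iff)

text \<open>The same for negative \<open>n\<close>: the inverse of a solution for \<open>-n\<close> is a solution for \<open>n\<close>.\<close>

lemma not_log_derivative_diff:
  assumes "i \<noteq> n" "w \<in> T" and eq: "der R w \<oplus> of_natural R i \<otimes> \<phi> \<otimes> w \<ominus> of_natural R n \<otimes> \<phi> \<otimes> w = \<zero>"
  shows "w = \<zero>"
proof (rule ccontr)
  assume nz: "w \<noteq> \<zero>"
  have [simp]: "w \<in> carrier R" "\<phi> \<in> carrier R" using assms by auto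
  have D: "d = (k \<ominus> j) \<otimes> \<phi> \<otimes> w"
    if [simp]: "d \<in> carrier R" "j \<in> carrier R" "k \<in> carrier R"
      and e: "d \<oplus> j \<otimes> \<phi> \<otimes> w \<ominus> k \<otimes> \<phi> \<otimes> w = \<zero>" for d j k
  proof -
    have "d = (d \<oplus> j \<otimes> \<phi> \<otimes> w \<ominus> k \<otimes> \<phi> \<otimes> w) \<oplus> (k \<ominus> j) \<otimes> \<phi> \<otimes> w"
      by (reify polex) (simp add: normal_form)
    thus ?thesis unfolding e by simp
  qed
  have d: "der R w = (of_natural R n \<ominus> of_natural R i) \<otimes> \<phi> \<otimes> w" using eq by (intro D) auto
  show False
  proof (cases "i < n")
    case True
    hence "der R w = of_natural R (n - i) \<otimes> \<phi> \<otimes> w" using d by simp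
    thus False using not_log_derivative[of "n - i" w] True assms nz by simp
  next
    case False
    hence i: "i > n" using assms by simp
    have "\<ominus> (of_natural R n \<ominus> of_natural R i) = of_natural R (i - n)"
    proof -
      have "\<ominus> (n' \<ominus> i') = i' \<ominus> n'" if [simp]: "n' \<in> carrier R" "i' \<in> carrier R" for n' i'
        by (reify polex) (simp add: normal_form)
      thus ?thesis using i by simp
    qed
    hence "der R (\<one> \<oslash> w) = of_natural R (i - n) \<otimes> \<phi> \<otimes> (\<one> \<oslash> w)"
      using der_inverse_log[OF _ _ nz d] by (simp add: l_minus[symmetric])
    hence "\<one> \<oslash> w = \<zero>" using not_log_derivative[of "i - n" "\<one> \<oslash> w"] i assms by simp
    thus False using nz by (simp add: div_eq_iff)
  qed
qed

definition at_Y :: "(nat \<Rightarrow> 'a) \<Rightarrow> nat \<Rightarrow> 'a" where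
  "at_Y t n = (\<Oplus>i\<in>{..n}. t i \<otimes> Y [^] i)"

lemma at_Y_0 [simp]: "\<forall>i. t i \<in> T \<Longrightarrow> at_Y t 0 = t 0"
  by (simp add: at_Y_def)

lemma at_Y_Suc [simp]:
  "\<forall>i. t i \<in> T \<Longrightarrow> at_Y t (Suc n) = t (Suc n) \<otimes> Y [^] Suc n \<oplus> at_Y t n"
  using Y_carrier by (simp add: at_Y_def del: nat_pow_Suc)

lemma at_Y_closed [simp]: "\<forall>i. t i \<in> T \<Longrightarrow> at_Y t n \<in> carrier R"
  using Y_carrier by (simp add: at_Y_def)

lemma at_Y_scale:
  assumes "\<forall>i. t i \<in> T" "a \<in> T"
  shows "at_Y (\<lambda>i. a \<otimes> t i) n = a \<otimes> at_Y t n"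
  using assms Y_carrier by (induct n) (simp_all add: r_distr m_assoc del: nat_pow_Suc)

text \<open>The operator \<open>\<partial> - n\<phi>\<close> on polynomials in \<open>Y\<close>, coefficientwise. It kills \<open>Y\<^sup>n\<close>, and so the leading
  term of a monic polynomial of degree \<open>n\<close>.\<close>

definition lower :: "nat \<Rightarrow> (nat \<Rightarrow> 'a) \<Rightarrow> nat \<Rightarrow> 'a" where
  "lower n t = (\<lambda>i. der R (t i) \<oplus> of_natural R i \<otimes> \<phi> \<otimes> t i \<ominus> of_natural R n \<otimes> \<phi> \<otimes> t i)"

lemma lower_T [simp]: "\<forall>i. t i \<in> T \<Longrightarrow> lower n t i \<in> T"
  by (simp add: lower_def)

lemma at_Y_lower:
  assumes "\<forall>i. t i \<in> T"
  shows "at_Y (lower n t) m = der R (at_Y t m) \<ominus> of_natural R n \<otimes> \<phi> \<otimes> at_Y t m"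
proof (induct m)
  case 0
  show ?case using assms by (simp add: lower_def)
next
  case (Suc m)
  have *: "(d \<oplus> j \<otimes> \<phi> \<otimes> x \<ominus> k \<otimes> \<phi> \<otimes> x) \<otimes> p \<oplus> (a \<ominus> k \<otimes> \<phi> \<otimes> b)
      = d \<otimes> p \<oplus> x \<otimes> (j \<otimes> \<phi> \<otimes> p) \<oplus> a \<ominus> k \<otimes> \<phi> \<otimes> (x \<otimes> p \<oplus> b)"
    if [simp]: "d \<in> carrier R" "x \<in> carrier R" "k \<in> carrier R" "j \<in> carrier R"
      "p \<in> carrier R" "a \<in> carrier R" "b \<in> carrier R" for d x k j p a b
  proof -
    have [simp]: "\<phi> \<in> carrier R" by simp
    show ?thesis by (reify polex) (simp add: normal_form)
  qed
  have "at_Y (lower n t) (Suc m) = lower n t (Suc m) \<otimes> Y [^] Suc m \<oplus>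
      (der R (at_Y t m) \<ominus> of_natural R n \<otimes> \<phi> \<otimes> at_Y t m)"
    using assms Suc by (simp del: nat_pow_Suc)
  also have "\<dots> = der R (t (Suc m)) \<otimes> Y [^] Suc m
        \<oplus> t (Suc m) \<otimes> (of_natural R (Suc m) \<otimes> \<phi> \<otimes> Y [^] Suc m)
      \<oplus> der R (at_Y t m) \<ominus> of_natural R n \<otimes> \<phi> \<otimes> (t (Suc m) \<otimes> Y [^] Suc m \<oplus> at_Y t m)"
    unfolding lower_def by (rule *) (use assms in \<open>simp_all del: nat_pow_Suc of_nat_Suc\<close>)
  also have "of_natural R (Suc m) \<otimes> \<phi> \<otimes> Y [^] Suc m = der R (Y [^] Suc m)"
    using der_power_log[OF Y_carrier _ Y_der, of "Suc m"] by (simp del: nat_pow_Suc of_nat_Suc)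
  finally show ?case using assms by (simp add: der_add der_mult del: nat_pow_Suc)
qed

lemma at_Y_single:
  assumes "\<forall>i. t i \<in> T" "\<And>i. i \<le> n \<Longrightarrow> i \<noteq> k \<Longrightarrow> t i = \<zero>"
  shows "at_Y t n = (if k \<le> n then t k \<otimes> Y [^] k else \<zero>)"
  using assms(2)
proof (induct n)
  case 0 thus ?case using assms(1) by (cases "k = 0") auto
next
  case (Suc n)
  have IH: "at_Y t n = (if k \<le> n then t k \<otimes> Y [^] k else \<zero>)" using Suc by simp
  show ?case using assms(1) Suc(2)[of "Suc n"] IH Y_carrier
    by (cases "k = Suc n") (auto simp: le_Suc_eq simp del: nat_pow_Suc)
qed

text \<open>The powers of \<open>Y\<close> are linearly independent over \<open>T\<close>: a shortest relation, made monic,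
  is shortened by \<open>\<partial> - n\<phi>\<close>.\<close>

lemma powers_independent:
  assumes "\<forall>i. t i \<in> T" "at_Y t n = \<zero>" "i \<le> n"
  shows "t i = \<zero>"
  using assms
proof (induct n arbitrary: t i)
  case 0 thus ?case by simp
next
  case (Suc n)
  have lead: "t (Suc n) = \<zero>"
  proof (rule ccontr)
    assume nz: "t (Suc n) \<noteq> \<zero>"
    define s where "s = (\<lambda>i. (\<one> \<oslash> t (Suc n)) \<otimes> t i)"
    have sT: "\<forall>i. s i \<in> T" using Suc.prems(1) by (simp add: s_def)
    have s1: "s (Suc n) = \<one>"
      using Suc.prems(1) nz by (simp add: s_def)
    have s0: "at_Y s (Suc n) = \<zero>" unfolding s_def
      using at_Y_scale[of t "\<one> \<oslash> t (Suc n)" "Suc n"] Suc.prems by (simp del: at_Y_Suc)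
    have "at_Y (lower (Suc n) s) (Suc n) = \<zero>"
      by (subst at_Y_lower[OF sT]) (simp add: s0 a_minus_def del: at_Y_Suc of_nat_Suc)
    moreover have "lower (Suc n) s (Suc n) = \<zero>"
      by (simp add: lower_def s1 r_neg a_minus_def del: of_nat_Suc)
    ultimately have "at_Y (lower (Suc n) s) n = \<zero>" using sT by simp
    hence *: "lower (Suc n) s i = \<zero>" if "i \<le> n" for i using Suc.hyps[OF _ _ that] sT by simp
    have "s i = \<zero>" if "i \<le> n" for i
      by (rule not_log_derivative_diff[of i "Suc n"]) (use that sT *[OF that] in \<open>auto simp: lower_def\<close>)
    hence "at_Y s (Suc n) = s (Suc n) \<otimes> Y [^] Suc n"
      by (subst at_Y_single[of s "Suc n" "Suc n"]) (use sT in auto)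
    thus False using s0 s1 Y_power(2)[of "Suc n"] by (simp del: at_Y_Suc nat_pow_Suc)
  qed
  hence "at_Y t n = \<zero>" using Suc.prems by simp
  thus ?case using Suc lead by (cases "i = Suc n") auto
qed

text \<open>A constant quotient of two polynomials in \<open>Y\<close>: the denominator of least degree, made monic,
  is shortened by \<open>\<partial> - n\<phi>\<close> unless it is \<open>Y\<^sup>n\<close>.\<close>

lemma constant_quotient:
  assumes "c \<in> carrier R" "der R c = \<zero>" "\<forall>i. p i \<in> T" "\<forall>i. q i \<in> T"
    "c \<otimes> at_Y q n = at_Y p m" "at_Y q n \<noteq> \<zero>"
  shows "c \<in> T"
  using assms(3-)
proof (induct n arbitrary: p q rule: less_induct)
  case (less n)
  have shorter: "c \<in> T"
    if "\<forall>i. p i \<in> T" "\<forall>i. q i \<in> T" "c \<otimes> at_Y q n = at_Y p m" "at_Y q n \<noteq> \<zero>" "q n = \<zero>" for p q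
  proof (cases n)
    case 0 with that show ?thesis by simp
  next
    case (Suc k) with that less.hyps[of k p q] show ?thesis by simp
  qed
  show ?case
  proof (cases "q n = \<zero>")
    case True thus ?thesis using shorter less.prems by blast
  next
    case nz: False
    define v where "v = \<one> \<oslash> q n"
    define s where "s = (\<lambda>i. v \<otimes> q i)"
    define t where "t = (\<lambda>i. v \<otimes> p i)"
    have vT: "v \<in> T" using less.prems by (simp add: v_def)
    have sT: "\<forall>i. s i \<in> T" and tT: "\<forall>i. t i \<in> T" using less.prems vT by (simp_all add: s_def t_def)
    have s1: "s n = \<one>" and v0: "v \<noteq> \<zero>"
    proof -
      show "s n = \<one>" using less.prems nz by (simp add: s_def v_def)
      thus "v \<noteq> \<zero>" using less.prems by (auto simp: s_def)
    qed
    have sY: "at_Y s n = v \<otimes> at_Y q n" and tY: "at_Y t m = v \<otimes> at_Y p m"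
      using less.prems vT by (simp_all add: s_def t_def at_Y_scale)
    have rel: "c \<otimes> at_Y s n = at_Y t m"
      using less.prems vT assms(1) unfolding sY tY by (metis T_carrier at_Y_closed m_lcomm)
    have sne: "at_Y s n \<noteq> \<zero>" unfolding sY using less.prems v0 vT by (simp add: integral_iff)
    have rel': "c \<otimes> at_Y (lower n s) n = at_Y (lower n t) m"
    proof -
      have "c \<otimes> (d \<ominus> k \<otimes> f \<otimes> x) = c \<otimes> d \<ominus> k \<otimes> f \<otimes> (c \<otimes> x)"
        if [simp]: "d \<in> carrier R" "k \<in> carrier R" "f \<in> carrier R" "x \<in> carrier R" for d k f x
      proof -
        note assms(1)[simp]
        show ?thesis by (reify polex) (simp add: normal_form)
      qed
      moreover have "der R (at_Y t m) = c \<otimes> der R (at_Y s n)"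
        unfolding rel[symmetric] using assms(1,2) sT by (simp add: der_mult)
      ultimately show ?thesis unfolding at_Y_lower[OF sT] at_Y_lower[OF tT] using sT rel by simp
    qed
    have sn: "lower n s n = \<zero>" by (simp add: lower_def s1 r_neg a_minus_def)
    show ?thesis
    proof (cases "at_Y (lower n s) n = \<zero>")
      case False
      thus ?thesis using shorter[of "lower n t" "lower n s"] rel' sT tT sn by simp
    next
      case True
      hence "at_Y (lower n t) m = \<zero>" using rel' assms(1) by simp
      hence "lower n t i = \<zero>" if "i \<le> m" for i using powers_independent[OF _ _ that] tT by simp
      hence t0: "t i = \<zero>" if "i \<le> m" "i \<noteq> n" for i
        using not_log_derivative_diff[of i n "t i"] that tT by (auto simp: lower_def)
      have "lower n s i = \<zero>" if "i \<le> n" for i using powers_independent[OF _ True that] sT by simp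
      hence s0: "s i = \<zero>" if "i \<le> n" "i \<noteq> n" for i
        using not_log_derivative_diff[of i n "s i"] that sT by (auto simp: lower_def)
      have "at_Y s n = Y [^] n" using at_Y_single[OF sT s0, of n n] s1 by simp
      moreover have "at_Y t m = (if n \<le> m then t n \<otimes> Y [^] n else \<zero>)"
        using at_Y_single[OF tT t0] .
      ultimately have "c \<otimes> Y [^] n = (if n \<le> m then t n else \<zero>) \<otimes> Y [^] n" using rel by simp
      hence "c = (if n \<le> m then t n else \<zero>)"
        using assms(1) tT by (subst (asm) m_rcancel) auto
      thus ?thesis using tT by auto
    qed
  qed
qed

text \<open>Elements of \<open>T[Y]\<close>, built up by Horner's scheme, have coefficient sequences.\<close>

lemma simple_extension_at_Y:
  assumes "x \<in> simple_extension T Y"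
  shows "\<exists>t n. (\<forall>i. t i \<in> T) \<and> x = at_Y t n"
  using assms
proof (induct rule: simple_extension.induct)
  case zero
  show ?case by (intro exI[of _ "\<lambda>_. \<zero>"] exI[of _ 0]) simp
next
  case (lin k1 k2)
  then obtain t n where t: "\<forall>i. t i \<in> T" "k1 = at_Y t n" by blast
  define s where "s = (\<lambda>i. case i of 0 \<Rightarrow> k2 | Suc j \<Rightarrow> t j)"
  have sT: "\<forall>i. s i \<in> T" using t lin by (simp add: s_def split: nat.split)
  have "at_Y s (Suc n) = at_Y t n \<otimes> Y \<oplus> k2" for n
  proof (induct n)
    case 0 show ?case using sT t Y_carrier lin by (simp add: s_def)
  next
    case (Suc n)
    have "x \<otimes> (p \<otimes> Y) \<oplus> (a \<otimes> Y \<oplus> k2) = (x \<otimes> p \<oplus> a) \<otimes> Y \<oplus> k2"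
      if [simp]: "x \<in> carrier R" "p \<in> carrier R" "a \<in> carrier R" for x p a
    proof -
      have [simp]: "Y \<in> carrier R" "k2 \<in> carrier R" using Y_carrier lin by auto
      show ?thesis by (reify polex) (simp add: normal_form)
    qed
    moreover have "at_Y s (Suc (Suc n)) = t (Suc n) \<otimes> (Y [^] Suc n \<otimes> Y) \<oplus> at_Y s (Suc n)"
      by (subst at_Y_Suc[OF sT]) (simp add: s_def)
    ultimately show ?case using t by (simp add: Suc del: nat_pow_Suc at_Y_Suc) (simp del: nat_pow_Suc)
  qed
  thus ?case using sT t by metis
qed

lemma simple_extension_der:
  assumes "x \<in> simple_extension T Y"
  shows "der R x \<in> simple_extension T Y"
  using assms
proof (induct rule: simple_extension.induct)
  case (lin k1 k2)
  note T = subfieldE(1)[OF T_subfield]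
  have TC: "T \<subseteq> carrier R" using T_carrier by blast
  note S = subringE[OF simple_extension_is_subring[OF T Y_carrier]]
  note I = simple_extension_incl[OF TC Y_carrier] simple_extension_mem[OF T Y_carrier]
  have "k1 \<in> carrier R" using lin(1) S(1) by blast
  hence "der R (k1 \<otimes> Y \<oplus> k2) = der R k1 \<otimes> Y \<oplus> k1 \<otimes> (\<phi> \<otimes> Y) \<oplus> der R k2"
    using lin Y_carrier by (simp add: der_add der_mult Y_der)
  moreover have "\<phi> \<in> simple_extension T Y" "der R k2 \<in> simple_extension T Y" using I(1) lin by auto
  ultimately show ?case using lin I(2) S(6,7) by simp
qed (use simple_extension.zero in simp)

text \<open>The fractions of \<open>T[Y]\<close> form a differential field, so \<open>constant_quotient\<close> applies to every constant.\<close>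

theorem no_new_constants:
  assumes "c \<in> diff_generate R (T \<union> {Y})" "der R c = \<zero>"
  shows "c \<in> T"
proof -
  let ?S = "simple_extension T Y"
  note T = subfieldE(1)[OF T_subfield]
  have TC: "T \<subseteq> carrier R" using T_carrier by blast
  note sub = simple_extension_is_subring[OF T Y_carrier]
  note S = subringE[OF sub]
  let ?X = "{a \<oslash> b | a b. a \<in> ?S \<and> b \<in> ?S \<and> b \<noteq> \<zero>}"
  have SX: "x \<in> ?X" if "x \<in> ?S" for x
  proof -
    have "x = x \<oslash> \<one>" using that S(1) by (simp add: div_eq_iff subset_iff)
    thus ?thesis using that S(3) one_not_zero by blast
  qed
  have "diff_generate R (T \<union> {Y}) \<subseteq> ?X"
  proof (rule diff_generate_least)
    show "subfield ?X R" by (rule subring_fractions_subfield[OF sub])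
    show "T \<union> {Y} \<subseteq> ?X"
      using SX simple_extension_incl[OF TC Y_carrier] simple_extension_mem[OF T Y_carrier] by blast
    fix x assume "x \<in> ?X"
    then obtain a b where x: "x = a \<oslash> b" "a \<in> ?S" "b \<in> ?S" "b \<noteq> \<zero>" by blast
    have ab: "a \<in> carrier R" "b \<in> carrier R" using x S(1) by auto
    have "der R x = (der R a \<otimes> b \<ominus> a \<otimes> der R b) \<oslash> (b \<otimes> b)"
      unfolding x(1) using ab x by (simp add: der_div)
    moreover have "der R a \<otimes> b \<ominus> a \<otimes> der R b \<in> ?S" "b \<otimes> b \<in> ?S" "b \<otimes> b \<noteq> \<zero>"
      using x ab S(5-7) simple_extension_der by (auto simp: a_minus_def integral_iff)
    ultimately show "der R x \<in> ?X" by blast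
  qed
  with assms(1) obtain a b where x: "c = a \<oslash> b" "a \<in> ?S" "b \<in> ?S" "b \<noteq> \<zero>" by blast
  have ab: "a \<in> carrier R" "b \<in> carrier R" using x S(1) by auto
  obtain p m q n where "\<forall>i. p i \<in> T" "a = at_Y p m" "\<forall>i. q i \<in> T" "b = at_Y q n"
    using simple_extension_at_Y x(2,3) by metis
  moreover have "c \<in> carrier R" "c \<otimes> b = a" using x ab div_eq_iff[of a b c] by auto
  ultimately show ?thesis using constant_quotient[of c p q n m] assms(2) x(4) by simp
qed

end

section \<open>Fraction fields of differential domains\<close>

context differential_domain begin

abbreviation Frac where "Frac \<equiv> frac_field R"

abbreviation Nonzero where "Nonzero \<equiv> carrier R - {\<zero>}"

lemma mem_fraction:
  "(x, y) \<in> fraction R a b \<longleftrightarrow> x \<in> carrier R \<and> y \<in> Nonzero \<and> x \<otimes> b = a \<otimes> y"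
  by (simp add: fraction_def)

lemma fraction_eq:
  assumes "a \<in> carrier R" "b \<in> Nonzero" "c \<in> carrier R" "d \<in> Nonzero"
  shows "fraction R a b = fraction R c d \<longleftrightarrow> a \<otimes> d = c \<otimes> b"
proof
  assume "fraction R a b = fraction R c d"
  moreover have "(a, b) \<in> fraction R a b" using assms by (simp add: mem_fraction)
  ultimately show "a \<otimes> d = c \<otimes> b" by (simp add: mem_fraction)
next
  assume e: "a \<otimes> d = c \<otimes> b"
  have "x \<otimes> d' = c' \<otimes> y" if x: "x \<in> carrier R" "y \<in> carrier R" "x \<otimes> b' = a' \<otimes> y"
    and a: "a' \<in> carrier R" "b' \<in> Nonzero" "c' \<in> carrier R" "d' \<in> carrier R"
    and e: "a' \<otimes> d' = c' \<otimes> b'" for x y a' b' c' d'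
  proof -
    have "b' \<otimes> (x \<otimes> d') = (x \<otimes> b') \<otimes> d'" using x(1,2) a by (simp add: m_ac)
    also have "\<dots> = (a' \<otimes> d') \<otimes> y" unfolding x(3) using x(1,2) a by (simp add: m_ac)
    also have "\<dots> = b' \<otimes> (c' \<otimes> y)" unfolding e using x(1,2) a by (simp add: m_ac)
    finally show ?thesis using x a m_lcancel by simp
  qed
  note transfer = this
  have "(x, y) \<in> fraction R a b \<longleftrightarrow> (x, y) \<in> fraction R c d" for x y
    using transfer[of x y b a c d] transfer[of x y d c a b] assms e by (auto simp only: mem_fraction Diff_iff)
  thus "fraction R a b = fraction R c d" by auto
qed

text \<open>The operations on fractions are unions over all representatives of a class. When the result does
  not depend on the representative, the union collapses.\<close>

lemma UN_fraction:
  assumes "a \<in> carrier R" "b \<in> Nonzero"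
    "\<And>x y. \<lbrakk>x \<in> carrier R; y \<in> Nonzero; x \<otimes> b = a \<otimes> y\<rbrakk> \<Longrightarrow> g x y = g a b"
  shows "(\<Union>(x, y)\<in>fraction R a b. g x y) = g a b"
proof -
  have "(a, b) \<in> fraction R a b" using assms by (simp add: mem_fraction)
  moreover have "g x y = g a b" if "(x, y) \<in> fraction R a b" for x y
    using that assms(3) by (simp add: mem_fraction)
  ultimately show ?thesis by fast
qed

lemma UN_fraction2:
  assumes a: "a \<in> carrier R" "b \<in> Nonzero" and c: "c \<in> carrier R" "d \<in> Nonzero"
    and g: "\<And>x y z w. \<lbrakk>x \<in> carrier R; y \<in> Nonzero; x \<otimes> b = a \<otimes> y;
      z \<in> carrier R; w \<in> Nonzero; z \<otimes> d = c \<otimes> w\<rbrakk> \<Longrightarrow> g x y z w = g a b c d"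
  shows "(\<Union>(x, y)\<in>fraction R a b. \<Union>(z, w)\<in>fraction R c d. g x y z w) = g a b c d"
proof -
  have inner: "(\<Union>(z, w)\<in>fraction R c d. g x y z w) = g x y c d"
    if x: "x \<in> carrier R" "y \<in> Nonzero" "x \<otimes> b = a \<otimes> y" for x y
  proof (rule UN_fraction[OF c])
    fix z w assume z: "z \<in> carrier R" "w \<in> Nonzero" "z \<otimes> d = c \<otimes> w"
    show "g x y z w = g x y c d" using g[OF x z] g[OF x c refl] by simp
  qed
  have "(\<Union>(x, y)\<in>fraction R a b. \<Union>(z, w)\<in>fraction R c d. g x y z w) =
      (\<Union>(z, w)\<in>fraction R c d. g a b z w)"
  proof (rule UN_fraction[OF a])
    fix x y assume x: "x \<in> carrier R" "y \<in> Nonzero" "x \<otimes> b = a \<otimes> y"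
    show "(\<Union>(z, w)\<in>fraction R c d. g x y z w) = (\<Union>(z, w)\<in>fraction R c d. g a b z w)"
      unfolding inner[OF x] inner[OF a refl] by (rule g[OF x c refl])
  qed
  thus ?thesis unfolding inner[OF a refl] .
qed

lemma frac_field_simps:
  shows carrier_frac_field: "carrier (Frac) =
      {fraction R a b | a b. a \<in> carrier R \<and> b \<in> Nonzero}"
    and one_frac_field: "\<one>\<^bsub>Frac\<^esub> = fraction R \<one> \<one>"
    and zero_frac_field: "\<zero>\<^bsub>Frac\<^esub> = fraction R \<zero> \<one>"
  by (simp_all add: frac_field_def)

lemma fraction_closed [simp]:
  "\<lbrakk>a \<in> carrier R; b \<in> Nonzero\<rbrakk> \<Longrightarrow> fraction R a b \<in> carrier (Frac)"
  unfolding carrier_frac_field by blast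

lemma frac_fieldE:
  assumes "x \<in> carrier (Frac)"
  obtains a b where "x = fraction R a b" "a \<in> carrier R" "b \<in> Nonzero"
  using assms unfolding carrier_frac_field by blast

lemma mult_fraction:
  assumes a: "a \<in> carrier R" "b \<in> Nonzero" and c: "c \<in> carrier R" "d \<in> Nonzero"
  shows "fraction R a b \<otimes>\<^bsub>Frac\<^esub> fraction R c d = fraction R (a \<otimes> c) (b \<otimes> d)"
proof -
  have "fraction R (x \<otimes> z) (y \<otimes> w) = fraction R (a \<otimes> c) (b \<otimes> d)"
    if x: "x \<in> carrier R" "y \<in> Nonzero" "x \<otimes> b = a \<otimes> y"
      and z: "z \<in> carrier R" "w \<in> Nonzero" "z \<otimes> d = c \<otimes> w" for x y z w
  proof (subst fraction_eq)
    have "(x \<otimes> z) \<otimes> (b \<otimes> d) = (x \<otimes> b) \<otimes> (z \<otimes> d)" using a c x(1,2) z(1,2) by (simp add: m_ac)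
    also have "\<dots> = (a \<otimes> c) \<otimes> (y \<otimes> w)" using a c x(1,2) z(1,2) unfolding x(3) z(3) by (simp add: m_ac)
    finally show "(x \<otimes> z) \<otimes> (b \<otimes> d) = (a \<otimes> c) \<otimes> (y \<otimes> w)" .
  qed (use a c x z in \<open>auto simp: integral_iff\<close>)
  hence "(\<Union>(x, y)\<in>fraction R a b. \<Union>(z, w)\<in>fraction R c d. fraction R (x \<otimes> z) (y \<otimes> w)) =
      fraction R (a \<otimes> c) (b \<otimes> d)"
    by (rule UN_fraction2[OF a c])
  thus ?thesis by (simp add: frac_field_def)
qed

lemma add_fraction:
  assumes a: "a \<in> carrier R" "b \<in> Nonzero" and c: "c \<in> carrier R" "d \<in> Nonzero"
  shows "fraction R a b \<oplus>\<^bsub>Frac\<^esub> fraction R c d = fraction R (a \<otimes> d \<oplus> c \<otimes> b) (b \<otimes> d)"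
proof -
  have "fraction R (x \<otimes> w \<oplus> z \<otimes> y) (y \<otimes> w) = fraction R (a \<otimes> d \<oplus> c \<otimes> b) (b \<otimes> d)"
    if x: "x \<in> carrier R" "y \<in> Nonzero" "x \<otimes> b = a \<otimes> y"
      and z: "z \<in> carrier R" "w \<in> Nonzero" "z \<otimes> d = c \<otimes> w" for x y z w
  proof (subst fraction_eq)
    have "(x \<otimes> w \<oplus> z \<otimes> y) \<otimes> (b \<otimes> d) = (x \<otimes> b) \<otimes> (w \<otimes> d) \<oplus> (z \<otimes> d) \<otimes> (y \<otimes> b)"
      using a c x(1,2) z(1,2) by (simp add: m_ac l_distr r_distr)
    also have "\<dots> = (a \<otimes> d \<oplus> c \<otimes> b) \<otimes> (y \<otimes> w)" using a c x(1,2) z(1,2) unfolding x(3) z(3)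
      by (simp add: m_ac l_distr r_distr)
    finally show "(x \<otimes> w \<oplus> z \<otimes> y) \<otimes> (b \<otimes> d) = (a \<otimes> d \<oplus> c \<otimes> b) \<otimes> (y \<otimes> w)" .
  qed (use a c x z in \<open>auto simp: integral_iff\<close>)
  hence "(\<Union>(x, y)\<in>fraction R a b. \<Union>(z, w)\<in>fraction R c d. fraction R (x \<otimes> w \<oplus> z \<otimes> y) (y \<otimes> w)) =
      fraction R (a \<otimes> d \<oplus> c \<otimes> b) (b \<otimes> d)"
    by (rule UN_fraction2[OF a c])
  thus ?thesis by (simp add: frac_field_def)
qed

lemma der_fraction:
  assumes a: "a \<in> carrier R" "b \<in> Nonzero"
  shows "der (Frac) (fraction R a b) =
    fraction R (der R a \<otimes> b \<ominus> a \<otimes> der R b) (b \<otimes> b)"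
proof -
  have "fraction R (der R x \<otimes> y \<ominus> x \<otimes> der R y) (y \<otimes> y) =
      fraction R (der R a \<otimes> b \<ominus> a \<otimes> der R b) (b \<otimes> b)"
    if x: "x \<in> carrier R" "y \<in> Nonzero" "x \<otimes> b = a \<otimes> y" for x y
  proof (subst fraction_eq)
    have [simp]: "a \<in> carrier R" "b \<in> carrier R" "x \<in> carrier R" "y \<in> carrier R" using a x by auto
    have e: "der R x \<otimes> b \<oplus> x \<otimes> der R b = der R a \<otimes> y \<oplus> a \<otimes> der R y"
      using arg_cong[OF x(3), of "der R"] by (simp add: der_mult)
    have "(x' \<otimes> y \<ominus> x \<otimes> y') \<otimes> (b \<otimes> b) \<ominus> (a' \<otimes> b \<ominus> a \<otimes> b') \<otimes> (y \<otimes> y) =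
        ((x' \<otimes> b \<oplus> x \<otimes> b') \<ominus> (a' \<otimes> y \<oplus> a \<otimes> y')) \<otimes> (b \<otimes> y)
        \<ominus> (x \<otimes> b \<ominus> a \<otimes> y) \<otimes> (b' \<otimes> y \<oplus> b \<otimes> y')"
      if [simp]: "x' \<in> carrier R" "y' \<in> carrier R" "a' \<in> carrier R" "b' \<in> carrier R" for x' y' a' b'
      by (reify polex) (simp add: normal_form)
    note id = this[of "der R x" "der R y" "der R a" "der R b"]
    have self: "v \<ominus> v = \<zero>" if "v \<in> carrier R" for v using that by simp
    have "(der R x \<otimes> y \<ominus> x \<otimes> der R y) \<otimes> (b \<otimes> b) \<ominus> (der R a \<otimes> b \<ominus> a \<otimes> der R b) \<otimes> (y \<otimes> y) = \<zero>"
      by (subst id) (simp_all add: e x(3) self)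
    thus "(der R x \<otimes> y \<ominus> x \<otimes> der R y) \<otimes> (b \<otimes> b) =
        (der R a \<otimes> b \<ominus> a \<otimes> der R b) \<otimes> (y \<otimes> y)"
      by (rule eq_by_difference) simp_all
  qed (use a x in \<open>auto simp: integral_iff\<close>)
  note * = this
  have "der (Frac) (fraction R a b) = (\<Union>(x, y)\<in>fraction R a b.
      fraction R (der R x \<otimes> y \<ominus> x \<otimes> der R y) (y \<otimes> y))"
    by (simp add: frac_field_def)
  also have "\<dots> = fraction R (der R a \<otimes> b \<ominus> a \<otimes> der R b) (b \<otimes> b)"
    by (rule UN_fraction[OF a]) (rule *)
  finally show ?thesis .
qed

lemma fraction_eq_zero:
  assumes "a \<in> carrier R" "b \<in> Nonzero"
  shows "fraction R a b = \<zero>\<^bsub>Frac\<^esub> \<longleftrightarrow> a = \<zero>"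
  using assms by (simp add: zero_frac_field fraction_eq)

lemma frac_field_cring: "cring (Frac)"
proof (rule cringI)
  have nz[simp]: "b \<otimes> d \<in> Nonzero"
    if "b \<in> Nonzero" "d \<in> Nonzero" for b d
    using that by (simp add: integral_iff)
  note S = add_fraction mult_fraction one_frac_field zero_frac_field fraction_eq
  show "abelian_group (Frac)"
  proof (rule abelian_groupI)
    fix x y assume x: "x \<in> carrier (Frac)" and y: "y \<in> carrier (Frac)"
    obtain a b where ab: "x = fraction R a b" "a \<in> carrier R" "b \<in> Nonzero"
      using x by (rule frac_fieldE)
    obtain c d where cd: "y = fraction R c d" "c \<in> carrier R" "d \<in> Nonzero"
      using y by (rule frac_fieldE)
    show "x \<oplus>\<^bsub>Frac\<^esub> y \<in> carrier (Frac)"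
      using ab cd by (simp add: add_fraction del: Diff_iff) (simp add: integral_iff)
    show "x \<oplus>\<^bsub>Frac\<^esub> y = y \<oplus>\<^bsub>Frac\<^esub> x"
      using ab cd by (simp add: add_fraction a_comm m_comm)
    fix z assume z: "z \<in> carrier (Frac)"
    obtain e f where ef: "z = fraction R e f" "e \<in> carrier R" "f \<in> Nonzero"
      using z by (rule frac_fieldE)
    have [simp]: "a \<in> carrier R" "b \<in> carrier R" "c \<in> carrier R" "d \<in> carrier R"
      "e \<in> carrier R" "f \<in> carrier R" using ab cd ef by auto
    have "(a \<otimes> d \<oplus> c \<otimes> b) \<otimes> f \<oplus> e \<otimes> (b \<otimes> d) = a \<otimes> (d \<otimes> f) \<oplus> (c \<otimes> f \<oplus> e \<otimes> d) \<otimes> b"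
      "(b \<otimes> d) \<otimes> f = b \<otimes> (d \<otimes> f)"
      by (reify polex, simp add: normal_form)+
    thus "x \<oplus>\<^bsub>Frac\<^esub> y \<oplus>\<^bsub>Frac\<^esub> z = x \<oplus>\<^bsub>Frac\<^esub> (y \<oplus>\<^bsub>Frac\<^esub> z)"
      using ab(3) cd(3) ef(3) unfolding ab(1) cd(1) ef(1) by (simp add: add_fraction integral_iff)
  next
    fix x assume x: "x \<in> carrier (Frac)"
    obtain a b where ab: "x = fraction R a b" "a \<in> carrier R" "b \<in> Nonzero"
      using x by (rule frac_fieldE)
    show "\<zero>\<^bsub>Frac\<^esub> \<oplus>\<^bsub>Frac\<^esub> x = x" using ab by (simp add: zero_frac_field add_fraction)
    have "fraction R (\<ominus> a) b \<oplus>\<^bsub>Frac\<^esub> x = \<zero>\<^bsub>Frac\<^esub>"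
      using ab by (simp add: add_fraction fraction_eq_zero integral_iff l_minus l_neg)
    moreover have "fraction R (\<ominus> a) b \<in> carrier (Frac)" using ab by simp
    ultimately show "\<exists>y\<in>carrier (Frac). y \<oplus>\<^bsub>Frac\<^esub> x = \<zero>\<^bsub>Frac\<^esub>" by blast
  qed (simp add: zero_frac_field)
  show "comm_monoid (Frac)"
  proof (rule comm_monoidI)
    fix x y assume x: "x \<in> carrier (Frac)" and y: "y \<in> carrier (Frac)"
    obtain a b where ab: "x = fraction R a b" "a \<in> carrier R" "b \<in> Nonzero"
      using x by (rule frac_fieldE)
    obtain c d where cd: "y = fraction R c d" "c \<in> carrier R" "d \<in> Nonzero"
      using y by (rule frac_fieldE)
    show "x \<otimes>\<^bsub>Frac\<^esub> y \<in> carrier (Frac)"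
      using ab cd by (simp add: mult_fraction integral_iff)
    show "x \<otimes>\<^bsub>Frac\<^esub> y = y \<otimes>\<^bsub>Frac\<^esub> x" using ab cd by (simp add: mult_fraction m_comm)
    fix z assume z: "z \<in> carrier (Frac)"
    obtain e f where ef: "z = fraction R e f" "e \<in> carrier R" "f \<in> Nonzero"
      using z by (rule frac_fieldE)
    show "x \<otimes>\<^bsub>Frac\<^esub> y \<otimes>\<^bsub>Frac\<^esub> z = x \<otimes>\<^bsub>Frac\<^esub> (y \<otimes>\<^bsub>Frac\<^esub> z)"
      using ab cd ef by (simp add: mult_fraction integral_iff m_assoc)
  next
    fix x assume x: "x \<in> carrier (Frac)"
    obtain a b where ab: "x = fraction R a b" "a \<in> carrier R" "b \<in> Nonzero"
      using x by (rule frac_fieldE)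
    show "\<one>\<^bsub>Frac\<^esub> \<otimes>\<^bsub>Frac\<^esub> x = x" using ab by (simp add: one_frac_field mult_fraction)
  qed (simp add: one_frac_field)
  fix x y z assume x: "x \<in> carrier (Frac)" and y: "y \<in> carrier (Frac)"
    and z: "z \<in> carrier (Frac)"
  obtain a b where ab: "x = fraction R a b" "a \<in> carrier R" "b \<in> Nonzero"
    using x by (rule frac_fieldE)
  obtain c d where cd: "y = fraction R c d" "c \<in> carrier R" "d \<in> Nonzero"
    using y by (rule frac_fieldE)
  obtain e f where ef: "z = fraction R e f" "e \<in> carrier R" "f \<in> Nonzero"
    using z by (rule frac_fieldE)
  have [simp]: "a \<in> carrier R" "b \<in> carrier R" "c \<in> carrier R" "d \<in> carrier R"
    "e \<in> carrier R" "f \<in> carrier R" using ab cd ef by auto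
  have "(a \<otimes> d \<oplus> c \<otimes> b) \<otimes> e \<otimes> (b \<otimes> f \<otimes> (d \<otimes> f)) =
      (a \<otimes> e \<otimes> (d \<otimes> f) \<oplus> c \<otimes> e \<otimes> (b \<otimes> f)) \<otimes> (b \<otimes> d \<otimes> f)"
    by (reify polex) (simp add: normal_form)
  thus "(x \<oplus>\<^bsub>Frac\<^esub> y) \<otimes>\<^bsub>Frac\<^esub> z =
      x \<otimes>\<^bsub>Frac\<^esub> z \<oplus>\<^bsub>Frac\<^esub> y \<otimes>\<^bsub>Frac\<^esub> z"
    using ab(3) cd(3) ef(3) unfolding ab(1) cd(1) ef(1)
    by (simp add: add_fraction mult_fraction fraction_eq integral_iff)
qed

lemma frac_field_differential: "differential_field (Frac)"
proof -
  interpret F: cring "Frac" by (rule frac_field_cring)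
  have "field (Frac)"
  proof (rule F.cring_fieldI2)
    show "\<zero>\<^bsub>Frac\<^esub> \<noteq> \<one>\<^bsub>Frac\<^esub>"
      by (simp add: one_frac_field zero_frac_field fraction_eq)
    fix x assume x: "x \<in> carrier (Frac)" "x \<noteq> \<zero>\<^bsub>Frac\<^esub>"
    obtain a b where ab: "x = fraction R a b" "a \<in> carrier R" "b \<in> Nonzero"
      using x(1) by (rule frac_fieldE)
    have a: "a \<noteq> \<zero>" using x(2) ab fraction_eq_zero by simp
    have "x \<otimes>\<^bsub>Frac\<^esub> fraction R b a = \<one>\<^bsub>Frac\<^esub>"
      using ab a by (simp add: mult_fraction one_frac_field fraction_eq integral_iff m_comm)
    moreover have "fraction R b a \<in> carrier (Frac)" using ab a by simp
    ultimately show "\<exists>y\<in>carrier (Frac). x \<otimes>\<^bsub>Frac\<^esub> y = \<one>\<^bsub>Frac\<^esub>" by blast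
  qed
  then interpret F: field "Frac" .
  show ?thesis
  proof
    fix x assume x: "x \<in> carrier (Frac)"
    obtain a b where ab: "x = fraction R a b" "a \<in> carrier R" "b \<in> Nonzero"
      using x by (rule frac_fieldE)
    show "der (Frac) x \<in> carrier (Frac)"
      using ab by (simp add: der_fraction integral_iff)
    fix y assume y: "y \<in> carrier (Frac)"
    obtain c d where cd: "y = fraction R c d" "c \<in> carrier R" "d \<in> Nonzero"
      using y by (rule frac_fieldE)
    have [simp]: "a \<in> carrier R" "b \<in> carrier R" "c \<in> carrier R" "d \<in> carrier R"
      using ab cd by auto
    note D = der_add der_mult add_fraction mult_fraction der_fraction fraction_eq integral_iff
    have "((a' \<otimes> d \<oplus> a \<otimes> d' \<oplus> (c' \<otimes> b \<oplus> c \<otimes> b')) \<otimes> (b \<otimes> d) \<ominus>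
          (a \<otimes> d \<oplus> c \<otimes> b) \<otimes> (b' \<otimes> d \<oplus> b \<otimes> d')) \<otimes> (b \<otimes> b \<otimes> (d \<otimes> d)) =
        ((a' \<otimes> b \<ominus> a \<otimes> b') \<otimes> (d \<otimes> d) \<oplus> (c' \<otimes> d \<ominus> c \<otimes> d') \<otimes> (b \<otimes> b)) \<otimes> (b \<otimes> d \<otimes> (b \<otimes> d))"
      "((a' \<otimes> c \<oplus> a \<otimes> c') \<otimes> (b \<otimes> d) \<ominus> a \<otimes> c \<otimes> (b' \<otimes> d \<oplus> b \<otimes> d')) \<otimes> (b \<otimes> b \<otimes> d \<otimes> (b \<otimes> (d \<otimes> d))) =
        ((a' \<otimes> b \<ominus> a \<otimes> b') \<otimes> c \<otimes> (b \<otimes> (d \<otimes> d)) \<oplus> a \<otimes> (c' \<otimes> d \<ominus> c \<otimes> d') \<otimes> (b \<otimes> b \<otimes> d)) \<otimes> (b \<otimes> d \<otimes> (b \<otimes> d))"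
      if [simp]: "a' \<in> carrier R" "b' \<in> carrier R" "c' \<in> carrier R" "d' \<in> carrier R" for a' b' c' d'
      by (reify polex, simp add: normal_form)+
    note id = this[of "der R a" "der R b" "der R c" "der R d"]
    show "der (Frac) (x \<oplus>\<^bsub>Frac\<^esub> y) =
        der (Frac) x \<oplus>\<^bsub>Frac\<^esub> der (Frac) y"
      unfolding ab(1) cd(1) using ab(3) cd(3) id(1) by (simp add: D)
    show "der (Frac) (x \<otimes>\<^bsub>Frac\<^esub> y) =
        der (Frac) x \<otimes>\<^bsub>Frac\<^esub> y \<oplus>\<^bsub>Frac\<^esub> x \<otimes>\<^bsub>Frac\<^esub> der (Frac) y"
      unfolding ab(1) cd(1) using ab(3) cd(3) id(2) by (simp add: D)
  qed
qed

lemma fraction_denominator: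
  assumes "a \<in> carrier R" "b \<in> Nonzero"
  shows "fraction R a b \<otimes>\<^bsub>Frac\<^esub> fraction R b \<one> = fraction R a \<one>"
  using assms by (simp add: mult_fraction fraction_eq integral_iff)

lemma fraction_one_hom: "(\<lambda>a. fraction R a \<one>) \<in> diff_ring_hom R (Frac)"
  unfolding diff_ring_hom_def
  by (auto intro!: ring_hom_memI simp: mult_fraction add_fraction one_frac_field der_fraction a_minus_def)

end

section \<open>Polynomials with coefficientwise derivation\<close>

lemma with_der_simps [simp]:
  "carrier (with_der R d) = carrier R" "monoid.mult (with_der R d) = monoid.mult R"
  "one (with_der R d) = one R" "ring.zero (with_der R d) = ring.zero R"
  "ring.add (with_der R d) = ring.add R" "der (with_der R d) = d"
  by (simp_all add: with_der_def)

lemma with_der_a_inv [simp]: "a_inv (with_der R d) = a_inv R"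
  by (simp add: a_inv_def m_inv_def fun_eq_iff)

lemma with_der_a_minus [simp]: "a_minus (with_der R d) = a_minus R"
  by (simp add: a_minus_def fun_eq_iff)

lemma with_der_domain:
  assumes "domain R"
  shows "domain (with_der R d)"
proof -
  interpret domain R by fact
  have "cring (with_der R d)"
  proof (rule cringI)
    show "abelian_group (with_der R d)"
    proof (rule abelian_groupI)
      fix x assume x: "x \<in> carrier (with_der R d)"
      show "\<exists>y\<in>carrier (with_der R d). y \<oplus>\<^bsub>with_der R d\<^esub> x = \<zero>\<^bsub>with_der R d\<^esub>"
        using x by (intro bexI[of _ "\<ominus>\<^bsub>R\<^esub> x"]) (simp_all add: l_neg)
    qed (simp_all add: a_ac)
    show "comm_monoid (with_der R d)" by (rule comm_monoidI) (simp_all add: m_ac)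
  qed (simp add: l_distr)
  thus ?thesis by (intro domain.intro domain_axioms.intro) (simp_all add: integral)
qed

context ring begin

lemma UP_carrier: "carrier (UP R) = up R"
  by (simp add: UP_def)

lemma UP_add_apply: "\<lbrakk>p \<in> up R; q \<in> up R\<rbrakk> \<Longrightarrow> (p \<oplus>\<^bsub>UP R\<^esub> q) i = p i \<oplus> q i"
  by (simp add: UP_def)

lemma UP_mult_apply:
  "\<lbrakk>p \<in> up R; q \<in> up R\<rbrakk> \<Longrightarrow> (p \<otimes>\<^bsub>UP R\<^esub> q) n = (\<Oplus>i\<in>{..n}. p i \<otimes> q (n - i))"
  by (simp add: UP_def)

lemma UP_zero_apply: "\<zero>\<^bsub>UP R\<^esub> i = \<zero>"
  by (simp add: UP_def)

lemma UP_one_apply: "\<one>\<^bsub>UP R\<^esub> i = (if i = 0 then \<one> else \<zero>)"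
  by (simp add: UP_def)

lemma UP_coeff: "p \<in> up R \<Longrightarrow> up_ring.coeff (UP R) p i = p i"
  by (simp add: UP_def)

lemma UP_monom_apply: "a \<in> carrier R \<Longrightarrow> up_ring.monom (UP R) a n i = (if i = n then a else \<zero>)"
  by (simp add: UP_def)

lemma UP_smult_apply: "\<lbrakk>a \<in> carrier R; p \<in> up R\<rbrakk> \<Longrightarrow> (a \<odot>\<^bsub>UP R\<^esub> p) i = a \<otimes> p i"
  by (simp add: UP_def)

lemma UP_a_inv_apply:
  assumes "p \<in> up R"
  shows "(\<ominus>\<^bsub>UP R\<^esub> p) i = \<ominus> p i"
proof -
  interpret P: UP_ring R "UP R" by unfold_locales simp
  have "\<ominus>\<^bsub>UP R\<^esub> p \<in> up R" using assms P.a_inv_closed by (simp add: UP_carrier)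
  thus ?thesis using P.coeff_a_inv[of p i] assms by (simp add: UP_carrier UP_coeff)
qed

lemma UP_minus_apply:
  assumes "p \<in> up R" "q \<in> up R"
  shows "(p \<ominus>\<^bsub>UP R\<^esub> q) i = p i \<ominus> q i"
proof -
  interpret P: UP_ring R "UP R" by unfold_locales simp
  have "\<ominus>\<^bsub>UP R\<^esub> q \<in> up R" using assms P.a_inv_closed by (simp add: UP_carrier)
  thus ?thesis using assms by (simp add: a_minus_def UP_add_apply UP_a_inv_apply)
qed

end

lemma diff_poly_simps [simp]:
  "carrier (diff_poly R) = carrier (UP R)" "monoid.mult (diff_poly R) = monoid.mult (UP R)"
  "one (diff_poly R) = one (UP R)" "ring.zero (diff_poly R) = ring.zero (UP R)"
  "ring.add (diff_poly R) = ring.add (UP R)" "a_inv (diff_poly R) = a_inv (UP R)"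
  "a_minus (diff_poly R) = a_minus (UP R)"
  by (simp_all add: diff_poly_def)

lemma der_diff_poly: "der (diff_poly R) p i = der R (p i)"
  by (simp add: diff_poly_def)

context differential_domain begin

lemma up_der:
  assumes "p \<in> up R"
  shows "der (diff_poly R) p \<in> up R"
proof (rule mem_upI)
  show "der (diff_poly R) p n \<in> carrier R" for n
    using mem_upD[OF assms, of n] by (simp add: der_diff_poly)
  obtain n where "bound \<zero> n p" using bound_upD[OF assms] ..
  hence "bound \<zero> n (der (diff_poly R) p)" by (simp add: bound_def der_diff_poly)
  thus "\<exists>n. bound \<zero> n (der (diff_poly R) p)" ..
qed

lemma diff_poly_differential_domain: "differential_domain (diff_poly R)"
proof -
  interpret P: UP_domain R "UP R" by unfold_locales simp
  have "domain (diff_poly R)" unfolding diff_poly_def by (rule with_der_domain[OF P.domain_axioms])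
  then interpret D: domain "diff_poly R" .
  show ?thesis
  proof
    fix p assume "p \<in> carrier (diff_poly R)"
    hence p: "p \<in> up R" by (simp add: UP_carrier)
    show "der (diff_poly R) p \<in> carrier (diff_poly R)" using up_der[OF p] by (simp add: UP_carrier)
    fix q assume "q \<in> carrier (diff_poly R)"
    hence q: "q \<in> up R" by (simp add: UP_carrier)
    show "der (diff_poly R) (p \<oplus>\<^bsub>diff_poly R\<^esub> q) =
        der (diff_poly R) p \<oplus>\<^bsub>diff_poly R\<^esub> der (diff_poly R) q"
      using p q up_der
      by (intro ext) (simp add: UP_add_apply der_diff_poly der_add mem_upD)
    have pq: "p \<otimes>\<^bsub>UP R\<^esub> q \<in> up R" "der (diff_poly R) p \<otimes>\<^bsub>UP R\<^esub> q \<in> up R"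
        "p \<otimes>\<^bsub>UP R\<^esub> der (diff_poly R) q \<in> up R"
      using p q up_der P.m_closed by (simp_all add: UP_carrier)
    show "der (diff_poly R) (p \<otimes>\<^bsub>diff_poly R\<^esub> q) =
        der (diff_poly R) p \<otimes>\<^bsub>diff_poly R\<^esub> q \<oplus>\<^bsub>diff_poly R\<^esub> p \<otimes>\<^bsub>diff_poly R\<^esub> der (diff_poly R) q"
    proof
      fix n
      have c: "p i \<in> carrier R" "q i \<in> carrier R" for i using p q by (auto intro: mem_upD)
      have "der R (\<Oplus>i\<in>{..n}. p i \<otimes> q (n - i)) =
          (\<Oplus>i\<in>{..n}. der R (p i) \<otimes> q (n - i) \<oplus> p i \<otimes> der R (q (n - i)))"
        using c by (subst der_finsum) (auto intro!: finsum_cong' simp: der_mult)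
      also have "\<dots> = (\<Oplus>i\<in>{..n}. der R (p i) \<otimes> q (n - i)) \<oplus> (\<Oplus>i\<in>{..n}. p i \<otimes> der R (q (n - i)))"
        using c by (intro finsum_addf) auto
      finally show "der (diff_poly R) (p \<otimes>\<^bsub>diff_poly R\<^esub> q) n =
          (der (diff_poly R) p \<otimes>\<^bsub>diff_poly R\<^esub> q \<oplus>\<^bsub>diff_poly R\<^esub> p \<otimes>\<^bsub>diff_poly R\<^esub> der (diff_poly R) q) n"
        using p q pq up_der[OF p] up_der[OF q]
        by (simp add: UP_add_apply UP_mult_apply der_diff_poly)
    qed
  qed
qed

end

context differential_field begin

text \<open>A constant fraction whose denominator has least degree and leading coefficient \<open>\<one>\<close> has
  constant coefficients: otherwise \<open>p/q = p'/q'\<close> would lower the degree.\<close>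

lemma constant_fraction:
  assumes "p \<in> carrier (UP R)" "q \<in> carrier (UP R) - {\<zero>\<^bsub>UP R\<^esub>}"
    "der (rat_field R) (fraction (diff_poly R) p q) = \<zero>\<^bsub>rat_field R\<^esub>"
  shows "fraction (diff_poly R) p q \<in> rat_const_field R"
  using assms
proof (induct "deg R q" arbitrary: p q rule: less_induct)
  case less
  interpret P: UP_domain R "UP R" by unfold_locales simp
  interpret D: differential_domain "diff_poly R" by (rule diff_poly_differential_domain)
  define n where "n = deg R q"
  define c where "c = \<one> \<oslash> q n"
  define p1 where "p1 = c \<odot>\<^bsub>UP R\<^esub> p"
  define q1 where "q1 = c \<odot>\<^bsub>UP R\<^esub> q"
  have q: "q \<in> carrier (UP R)" "q \<noteq> \<zero>\<^bsub>UP R\<^esub>" and p: "p \<in> carrier (UP R)" using less.prems by auto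
  have qn: "q n \<noteq> \<zero>" "q n \<in> carrier R"
    using P.lcoeff_nonzero[OF q(2,1)] q(1) by (auto simp: n_def UP_coeff UP_carrier mem_upD)
  have c: "c \<in> carrier R" "c \<noteq> \<zero>" using qn by (auto simp: c_def div_eq_iff)
  have one: "c \<otimes> q n = \<one>" using qn c unfolding c_def by (metis div_closed div_eq_iff one_closed)
  have p1: "p1 \<in> carrier (UP R)" and q1: "q1 \<in> carrier (UP R)" using p q c by (simp_all add: p1_def q1_def)
  have q1i: "q1 i = c \<otimes> q i" for i using c q by (simp add: q1_def UP_smult_apply UP_carrier)
  have q1n: "q1 n = \<one>" using q1i one by simp
  hence q10: "q1 \<noteq> \<zero>\<^bsub>UP R\<^esub>" by (auto simp: UP_zero_apply)
  have eq: "fraction (diff_poly R) p q = fraction (diff_poly R) p1 q1"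
  proof (subst D.fraction_eq)
    have "p \<otimes>\<^bsub>UP R\<^esub> q1 = q1 \<otimes>\<^bsub>UP R\<^esub> p" using p q1 by (rule P.m_comm)
    also have "\<dots> = p1 \<otimes>\<^bsub>UP R\<^esub> q"
      using c p q by (simp add: p1_def q1_def P.UP_smult_assoc2 P.m_comm[of q p])
    finally show "p \<otimes>\<^bsub>diff_poly R\<^esub> q1 = p1 \<otimes>\<^bsub>diff_poly R\<^esub> q" by simp
  qed (use p q p1 q1 q10 in simp_all)
  let ?p' = "der (diff_poly R) p1" and ?q' = "der (diff_poly R) q1"
  have p': "?p' \<in> carrier (UP R)" "?q' \<in> carrier (UP R)" using D.der_closed p1 q1 by simp_all
  have "?p' \<otimes>\<^bsub>UP R\<^esub> q1 \<ominus>\<^bsub>UP R\<^esub> p1 \<otimes>\<^bsub>UP R\<^esub> ?q' = \<zero>\<^bsub>UP R\<^esub>"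
    using less.prems(3) p1 q1 q10 p' unfolding eq
    by (simp add: rat_field_def D.der_fraction D.fraction_eq_zero D.integral_iff P.integral_iff)
  hence rel: "?p' \<otimes>\<^bsub>UP R\<^esub> q1 = p1 \<otimes>\<^bsub>UP R\<^esub> ?q'" using p1 q1 p' by simp
  show ?case
  proof (cases "?q' = \<zero>\<^bsub>UP R\<^esub>")
    case True
    hence "?p' = \<zero>\<^bsub>UP R\<^esub>" using rel p1 q1 q10 p' by (simp add: P.integral_iff)
    hence "\<forall>i. der R (p1 i) = \<zero>" using der_diff_poly[of R p1] by (metis UP_zero_apply)
    moreover have "\<forall>i. der R (q1 i) = \<zero>" using True der_diff_poly[of R q1] by (metis UP_zero_apply)
    moreover have "\<forall>i. p1 i \<in> carrier R" "\<forall>i. q1 i \<in> carrier R"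
      using p1 q1 by (auto simp: UP_carrier intro: mem_upD)
    ultimately show ?thesis using p1 q1 q10 unfolding eq rat_const_field_def constants_def by blast
  next
    case False
    have z: "?q' i = \<zero>" if "i \<ge> n" for i
    proof (cases "i = n")
      case True thus ?thesis by (simp add: der_diff_poly q1n)
    next
      case False
      hence "q i = \<zero>" using P.deg_aboveD[of q i] that q by (simp add: n_def UP_coeff UP_carrier)
      thus ?thesis using c by (simp add: der_diff_poly q1i)
    qed
    have n: "n > 0"
    proof (rule ccontr)
      assume "\<not> n > 0"
      hence "?q' = \<zero>\<^bsub>UP R\<^esub>" using z by (intro ext) (simp add: UP_zero_apply)
      thus False using False by simp
    qed
    have "deg R ?q' \<le> n - 1"
      by (rule P.deg_aboveI) (use z p' n in \<open>auto simp: UP_coeff UP_carrier\<close>)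
    hence "deg R ?q' < deg R q" using n by (simp add: n_def)
    moreover have "fraction (diff_poly R) p q = fraction (diff_poly R) ?p' ?q'"
      unfolding eq using p1 q1 q10 p' False rel by (subst D.fraction_eq) auto
    ultimately show ?thesis using less.hyps[of ?q' ?p'] less.prems(3) p' False by simp
  qed
qed

theorem constants_rat_field: "constants (rat_field R) = rat_const_field R"
proof -
  interpret P: UP_domain R "UP R" by unfold_locales simp
  interpret D: differential_domain "diff_poly R" by (rule diff_poly_differential_domain)
  show ?thesis
  proof (intro equalityI subsetI)
    fix x assume x: "x \<in> constants (rat_field R)"
    then obtain p q where "x = fraction (diff_poly R) p q" "p \<in> carrier (UP R)"
        "q \<in> carrier (UP R) - {\<zero>\<^bsub>UP R\<^esub>}"
      unfolding constants_def rat_field_def using D.frac_fieldE by (auto simp: D.carrier_frac_field)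
    thus "x \<in> rat_const_field R" using constant_fraction x by (simp add: constants_def)
  next
    fix x assume "x \<in> rat_const_field R"
    then obtain p q where pq: "x = fraction (diff_poly R) p q" "p \<in> carrier (UP R)"
        "q \<in> carrier (UP R)" "q \<noteq> \<zero>\<^bsub>UP R\<^esub>" "\<forall>i. p i \<in> constants R" "\<forall>i. q i \<in> constants R"
      unfolding rat_const_field_def by auto
    have "der (diff_poly R) p = \<zero>\<^bsub>UP R\<^esub>" "der (diff_poly R) q = \<zero>\<^bsub>UP R\<^esub>"
      using pq(5,6) by (intro ext; simp add: der_diff_poly constants_def UP_zero_apply)+
    thus "x \<in> constants (rat_field R)" using pq(1-4)
      by (simp add: constants_def rat_field_def D.der_fraction D.fraction_eq_zero P.integral_iff a_minus_def)
  qed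
qed

end

section \<open>Operators acting on an extension\<close>

lemma diff_ops_simps [simp]:
  "carrier (diff_ops R) = up R" "\<zero>\<^bsub>diff_ops R\<^esub> = (\<lambda>k. \<zero>\<^bsub>R\<^esub>)"
  "(P \<oplus>\<^bsub>diff_ops R\<^esub> Q) = (\<lambda>k. P k \<oplus>\<^bsub>R\<^esub> Q k)"
  by (simp_all add: diff_ops_def)

context differential_domain begin

lemma diff_ops_a_inv:
  assumes Q: "Q \<in> up R"
  shows "\<ominus>\<^bsub>diff_ops R\<^esub> Q = (\<lambda>k. \<ominus> Q k)"
  unfolding a_inv_def[of "diff_ops R"] m_inv_def
proof (rule the_equality, goal_cases)
  case 1
  have c: "Q k \<in> carrier R" for k using Q by (auto intro: mem_upD)
  show ?case using up_a_inv_closed[OF Q] c by (auto simp: r_neg l_neg)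
next
  case (2 y)
  hence "Q k \<oplus> y k = \<zero>" "y k \<in> carrier R" "Q k \<in> carrier R" for k
    using Q by (auto intro: mem_upD dest: fun_cong[of _ _ k])
  thus ?case by (intro ext) (metis a_comm minus_equality)
qed

lemma diff_ops_minus:
  "Q \<in> up R \<Longrightarrow> (P \<ominus>\<^bsub>diff_ops R\<^esub> Q) = (\<lambda>k. P k \<ominus> Q k)"
  by (simp add: a_minus_def diff_ops_a_inv)

lemma der_iter_closed [simp]: "y \<in> carrier R \<Longrightarrow> (der R ^^ i) y \<in> carrier R"
  by (induct i) auto

lemma op_apply_upto:
  assumes "\<And>i. P i \<in> carrier R" "\<And>i. i > n \<Longrightarrow> P i = \<zero>" "y \<in> carrier R"
  shows "op_apply R P y = (\<Oplus>i\<in>{..n}. P i \<otimes> (der R ^^ i) y)"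
  unfolding op_apply_def
proof (rule add.finprod_mono_neutral_cong_left)
  show "{i. P i \<noteq> \<zero>} \<subseteq> {..n}" using assms(2) by (auto simp: not_le[symmetric])
qed (use assms in auto)

end

locale differential_embedding =
  F: differential_domain F + D: differential_field D
  for F :: "('a, 'm) diff_ring_scheme" and D :: "('b, 'n) diff_ring_scheme" (structure) +
  fixes h assumes hom: "h \<in> diff_ring_hom F D"
begin

lemma ring_hom: "h \<in> ring_hom F D" and der: "x \<in> carrier F \<Longrightarrow> h (der F x) = der D (h x)"
  using hom by (auto simp: diff_ring_hom_def)

sublocale H: ring_hom_cring F D h
  by unfold_locales (rule ring_hom)

lemma hom_minus: "\<lbrakk>x \<in> carrier F; y \<in> carrier F\<rbrakk> \<Longrightarrow> h (x \<ominus>\<^bsub>F\<^esub> y) = h x \<ominus> h y"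
  by (simp add: a_minus_def)

lemma del_times_closed:
  assumes "P \<in> up F" "bound \<zero>\<^bsub>F\<^esub> n P"
  shows "del_times F P \<in> up F" "bound \<zero>\<^bsub>F\<^esub> (Suc n) (del_times F P)"
proof -
  show b: "bound \<zero>\<^bsub>F\<^esub> (Suc n) (del_times F P)"
    using assms by (auto simp: bound_def del_times_def)
  show "del_times F P \<in> up F"
    by (rule mem_upI) (use assms b in \<open>auto simp: del_times_def mem_upD\<close>)
qed

lemma del_iter_closed:
  assumes "P \<in> up F" "bound \<zero>\<^bsub>F\<^esub> n P"
  shows "(del_times F ^^ i) P \<in> up F" "bound \<zero>\<^bsub>F\<^esub> (n + i) ((del_times F ^^ i) P)"
  using del_times_closed assms by (induct i) auto

text \<open>On truncated sums this holds up to one boundary term, which vanishes beyond the order of \<open>P\<close>.\<close>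

lemma op_apply_del:
  assumes P: "P \<in> up F" and y: "y \<in> carrier D"
  shows "op_apply D (\<lambda>i. h (del_times F P i)) y = der D (op_apply D (\<lambda>i. h (P i)) y)"
proof -
  obtain n where b: "bound \<zero>\<^bsub>F\<^esub> n P" using P by blast
  have c[simp]: "P i \<in> carrier F" for i using P by (auto intro: mem_upD)
  have c'[simp]: "del_times F P i \<in> carrier F" for i
    using del_times_closed(1)[OF P b] by (auto intro: mem_upD)
  have step: "(\<Oplus>i\<in>{..m}. h (del_times F P i) \<otimes> (der D ^^ i) y) =
     der D (\<Oplus>i\<in>{..m}. h (P i) \<otimes> (der D ^^ i) y) \<ominus> h (P m) \<otimes> (der D ^^ Suc m) y" for m
  proof (induct m)
    case 0
    have "a \<otimes> b = a \<otimes> b \<oplus> c \<otimes> d \<ominus> c \<otimes> d"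
      if [simp]: "a \<in> carrier D" "b \<in> carrier D" "c \<in> carrier D" "d \<in> carrier D" for a b c d
      by (reify D.polex) (simp add: D.normal_form)
    thus ?case using y by (simp add: del_times_def D.der_mult der)
  next
    case (Suc m)
    have "(q \<oplus> a) \<otimes> b \<oplus> (e \<ominus> q \<otimes> b) = (a \<otimes> b \<oplus> c \<otimes> d) \<oplus> e \<ominus> c \<otimes> d"
      if [simp]: "a \<in> carrier D" "b \<in> carrier D" "c \<in> carrier D" "d \<in> carrier D"
         "e \<in> carrier D" "q \<in> carrier D" for a b c d e q
      by (reify D.polex) (simp add: D.normal_form)
    note id = this[of "der D (h (P (Suc m)))" "(der D ^^ Suc m) y" "h (P (Suc m))" "(der D ^^ Suc (Suc m)) y"
        "der D (\<Oplus>i\<in>{..m}. h (P i) \<otimes> (der D ^^ i) y)" "h (P m)"]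
    show ?case using Suc y id by (simp add: del_times_def D.der_mult der D.der_add Pi_def)
  qed
  have z: "P (Suc n) = \<zero>\<^bsub>F\<^esub>" using b by (auto simp: bound_def)
  have "op_apply D (\<lambda>i. h (del_times F P i)) y =
      (\<Oplus>i\<in>{..Suc n}. h (del_times F P i) \<otimes> (der D ^^ i) y)"
    using del_times_closed(2)[OF P b] y by (intro D.op_apply_upto) (auto simp: bound_def)
  also have "\<dots> = der D (\<Oplus>i\<in>{..Suc n}. h (P i) \<otimes> (der D ^^ i) y)"
    unfolding step using y by (simp add: z a_minus_def Pi_def)
  also have "(\<Oplus>i\<in>{..Suc n}. h (P i) \<otimes> (der D ^^ i) y) = op_apply D (\<lambda>i. h (P i)) y"
    using b y by (intro D.op_apply_upto[symmetric]) (auto simp: bound_def)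
  finally show ?thesis .
qed

text \<open>Left multiplication by \<open>\<partial>\<close> differentiates the value at \<open>y\<close>, so every \<open>\<partial>\<^sup>i G\<close> kills \<open>y\<close> along with
  \<open>G\<close>, and so does their combination \<open>Q G\<close>.\<close>

lemma op_apply_right_factor:
  assumes Q: "Q \<in> up F" and G: "G \<in> up F" and y: "y \<in> carrier D"
    and zero: "op_apply D (\<lambda>i. h (G i)) y = \<zero>"
  shows "op_apply D (\<lambda>i. h ((Q \<otimes>\<^bsub>diff_ops F\<^esub> G) i)) y = \<zero>"
proof -
  obtain n where n: "bound \<zero>\<^bsub>F\<^esub> n Q" using Q by blast
  obtain b where b: "bound \<zero>\<^bsub>F\<^esub> b G" using G by blast
  let ?G = "\<lambda>i. (del_times F ^^ i) G"
  have G0: "op_apply D (\<lambda>k. h (?G i k)) y = \<zero>" for i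
    using zero op_apply_del[OF del_iter_closed(1)[OF G b] y] by (induct i) simp_all
  have Gc[simp]: "?G i k \<in> carrier F" for i k
    using del_iter_closed(1)[OF G b, of i] by (auto intro: mem_upD)
  have Qc[simp]: "Q i \<in> carrier F" for i using Q by (auto intro: mem_upD)
  have Gsum: "(\<Oplus>k\<in>{..n + b}. h (?G i k) \<otimes> (der D ^^ k) y) = \<zero>" if "i \<le> n" for i
    unfolding G0[of i, symmetric] using del_iter_closed(2)[OF G b, of i] y that
    by (intro D.op_apply_upto[symmetric]) (auto simp: bound_def)
  have sum: "(\<Oplus>k\<in>{..n + b}. h (\<Oplus>\<^bsub>F\<^esub>i\<in>S. Q i \<otimes>\<^bsub>F\<^esub> ?G i k) \<otimes> (der D ^^ k) y) = \<zero>"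
    if "S \<subseteq> {..n}" "finite S" for S
    using that(2,1)
  proof (induct S rule: finite_induct)
    case empty thus ?case using y by simp
  next
    case (insert i S)
    have "(\<Oplus>k\<in>{..n + b}. h (\<Oplus>\<^bsub>F\<^esub>i\<in>insert i S. Q i \<otimes>\<^bsub>F\<^esub> ?G i k) \<otimes> (der D ^^ k) y) =
      (\<Oplus>k\<in>{..n + b}. h (Q i) \<otimes> (h (?G i k) \<otimes> (der D ^^ k) y) \<oplus>
         h (\<Oplus>\<^bsub>F\<^esub>i\<in>S. Q i \<otimes>\<^bsub>F\<^esub> ?G i k) \<otimes> (der D ^^ k) y)"
      using insert y by (intro D.finsum_cong') (auto simp: D.l_distr D.m_assoc Pi_def)
    also have "\<dots> = h (Q i) \<otimes> (\<Oplus>k\<in>{..n + b}. h (?G i k) \<otimes> (der D ^^ k) y) \<oplus>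
         (\<Oplus>k\<in>{..n + b}. h (\<Oplus>\<^bsub>F\<^esub>i\<in>S. Q i \<otimes>\<^bsub>F\<^esub> ?G i k) \<otimes> (der D ^^ k) y)"
      using insert y by (simp add: D.finsum_addf D.finsum_rdistr Pi_def)
    finally show ?case using insert Gsum[of i] by simp
  qed
  have supp: "{i. Q i \<noteq> \<zero>\<^bsub>F\<^esub>} \<subseteq> {..n}" using n by (auto simp: bound_def not_le[symmetric])
  have QG: "(Q \<otimes>\<^bsub>diff_ops F\<^esub> G) k = (\<Oplus>\<^bsub>F\<^esub>i\<in>{i. Q i \<noteq> \<zero>\<^bsub>F\<^esub>}. Q i \<otimes>\<^bsub>F\<^esub> ?G i k)" for k
    by (simp add: diff_ops_def)
  have "op_apply D (\<lambda>i. h ((Q \<otimes>\<^bsub>diff_ops F\<^esub> G) i)) y =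
     (\<Oplus>k\<in>{..n + b}. h ((Q \<otimes>\<^bsub>diff_ops F\<^esub> G) k) \<otimes> (der D ^^ k) y)"
  proof (rule D.op_apply_upto)
    show "h ((Q \<otimes>\<^bsub>diff_ops F\<^esub> G) i) \<in> carrier D" for i by (simp add: QG Pi_def)
    fix k assume k: "n + b < k"
    have "Q i \<otimes>\<^bsub>F\<^esub> ?G i k = \<zero>\<^bsub>F\<^esub>" if "i \<in> {i. Q i \<noteq> \<zero>\<^bsub>F\<^esub>}" for i
    proof -
      have "i \<le> n" using supp that by blast
      hence "?G i k = \<zero>\<^bsub>F\<^esub>" using del_iter_closed(2)[OF G b, of i] k by (auto simp: bound_def)
      thus ?thesis by simp
    qed
    hence "(\<Oplus>\<^bsub>F\<^esub>i\<in>{i. Q i \<noteq> \<zero>\<^bsub>F\<^esub>}. Q i \<otimes>\<^bsub>F\<^esub> ?G i k) = (\<Oplus>\<^bsub>F\<^esub>i\<in>{i. Q i \<noteq> \<zero>\<^bsub>F\<^esub>}. \<zero>\<^bsub>F\<^esub>)"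
      by (intro F.finsum_cong') auto
    thus "h ((Q \<otimes>\<^bsub>diff_ops F\<^esub> G) k) = \<zero>" by (simp add: QG)
  qed (rule y)
  also have "\<dots> = \<zero>"
    unfolding QG using supp by (intro sum) (auto intro: finite_subset)
  finally show ?thesis .
qed

end

section \<open>Degrees and the parity argument\<close>

context ring begin

lemma minus_zero [simp]: "x \<in> carrier R \<Longrightarrow> x \<ominus> \<zero> = x"
  by (simp add: a_minus_def)

text \<open>The bound is an integer: a negative bound forces \<open>p = 0\<close>, so that pole orders can be split between
  coordinates without treating the zero polynomial separately.\<close>

definition deg_le :: "(nat \<Rightarrow> 'a) \<Rightarrow> int \<Rightarrow> bool" where
  "deg_le p d \<longleftrightarrow> (\<forall>i. int i > d \<longrightarrow> p i = \<zero>)"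

lemma deg_leD: "\<lbrakk>deg_le p d; int i > d\<rbrakk> \<Longrightarrow> p i = \<zero>"
  by (simp add: deg_le_def)

lemma deg_le_mono: "\<lbrakk>deg_le p d; d \<le> e\<rbrakk> \<Longrightarrow> deg_le p e"
  by (simp add: deg_le_def)

lemma deg_le_zero: "deg_le \<zero>\<^bsub>UP R\<^esub> d"
  by (simp add: deg_le_def UP_zero_apply)

lemma deg_le_minus:
  "\<lbrakk>p \<in> up R; q \<in> up R; deg_le p d; deg_le q d\<rbrakk> \<Longrightarrow> deg_le (p \<ominus>\<^bsub>UP R\<^esub> q) d"
  by (simp add: deg_le_def UP_minus_apply)

lemma deg_le_add:
  "\<lbrakk>p \<in> up R; q \<in> up R; deg_le p d; deg_le q d\<rbrakk> \<Longrightarrow> deg_le (p \<oplus>\<^bsub>UP R\<^esub> q) d"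
  by (simp add: deg_le_def UP_add_apply)

lemma deg_le_mult:
  assumes p: "p \<in> up R" "deg_le p d" and q: "q \<in> up R" "deg_le q e"
  shows "deg_le (p \<otimes>\<^bsub>UP R\<^esub> q) (d + e)"
  unfolding deg_le_def
proof (intro allI impI)
  fix n assume n: "int n > d + e"
  have "p i \<otimes> q (n - i) = \<zero>" if "i \<in> {..n}" for i
  proof (cases "int i > d")
    case True thus ?thesis using deg_leD[OF p(2)] mem_upD[OF q(1)] by simp
  next
    case False
    hence "int (n - i) > e" using n that by (simp add: of_nat_diff)
    thus ?thesis using deg_leD[OF q(2)] mem_upD[OF p(1)] by simp
  qed
  hence "(\<Oplus>i\<in>{..n}. p i \<otimes> q (n - i)) = (\<Oplus>i\<in>{..n}. \<zero>)" by (intro finsum_cong') auto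
  thus "(p \<otimes>\<^bsub>UP R\<^esub> q) n = \<zero>" using p q by (simp add: UP_mult_apply)
qed

lemma top_coeff:
  assumes p: "p \<in> up R" "deg_le p (int d)" and q: "q \<in> up R" "deg_le q (int e)"
  shows "(p \<otimes>\<^bsub>UP R\<^esub> q) (d + e) = p d \<otimes> q e"
proof -
  have c: "p i \<in> carrier R" "q i \<in> carrier R" for i using p q by (auto intro: mem_upD)
  have "p i \<otimes> q (d + e - i) = (if d = i then p i \<otimes> q (d + e - i) else \<zero>)" if "i \<in> {..d + e}" for i
  proof (cases "i = d")
    case False
    hence "int i > int d \<or> int (d + e - i) > int e" using that by auto
    thus ?thesis using deg_leD[OF p(2)] deg_leD[OF q(2)] c False by auto
  qed simp
  hence "(\<Oplus>i\<in>{..d + e}. p i \<otimes> q (d + e - i)) =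
      (\<Oplus>i\<in>{..d + e}. if d = i then p i \<otimes> q (d + e - i) else \<zero>)"
    using c by (intro finsum_cong') auto
  also have "\<dots> = p d \<otimes> q (d + e - d)"
    using add.finprod_singleton[of d "{..d + e}" "\<lambda>i. p i \<otimes> q (d + e - i)"] c by auto
  finally show ?thesis using p q by (simp add: UP_mult_apply)
qed

lemma deg_le_deg:
  assumes "p \<in> up R"
  shows "deg_le p (int (deg R p))"
proof -
  interpret P: UP_ring R "UP R" by unfold_locales simp
  show ?thesis using P.deg_aboveD[of p] assms by (simp add: deg_le_def UP_coeff UP_carrier)
qed

lemma lead_coeff_nonzero:
  assumes "p \<in> up R" "p \<noteq> \<zero>\<^bsub>UP R\<^esub>"
  shows "p (deg R p) \<noteq> \<zero>"
proof -
  interpret P: UP_ring R "UP R" by unfold_locales simp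
  show ?thesis using P.lcoeff_nonzero[of p] assms by (simp add: UP_coeff UP_carrier)
qed

end

text \<open>For \<open>r\<close> of odd degree the leading terms of \<open>a\<^sup>2\<close> and of \<open>r b\<^sup>2\<close> cannot cancel: their degrees
  have different parity. So \<open>a\<^sup>2 - r b\<^sup>2\<close> has exactly the degree \<open>k\<close> that its terms allow. The
  number \<open>k\<close> is the pole order of \<open>a + b\<mu>\<close> at the point at infinity, where \<open>\<lambda>\<close> has a double pole.\<close>

lemma (in domain) odd_norm_degree:
  assumes a: "a \<in> up R" and b: "b \<in> up R" and ab: "a \<noteq> \<zero>\<^bsub>UP R\<^esub> \<or> b \<noteq> \<zero>\<^bsub>UP R\<^esub>"
    and r: "r \<in> up R" "deg_le r (2 * int s + 1)" "r (2 * s + 1) \<noteq> \<zero>"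
  shows "\<exists>k::nat. deg_le a (int k div 2) \<and> deg_le b ((int k - 2 * int s - 1) div 2) \<and>
           (a \<otimes>\<^bsub>UP R\<^esub> a \<ominus>\<^bsub>UP R\<^esub> r \<otimes>\<^bsub>UP R\<^esub> (b \<otimes>\<^bsub>UP R\<^esub> b)) k \<noteq> \<zero>"
proof -
  interpret P: UP_domain R "UP R" by unfold_locales simp
  let ?da = "deg R a" and ?db = "deg R b"
  have cl: "p \<otimes>\<^bsub>UP R\<^esub> q \<in> up R" if "p \<in> up R" "q \<in> up R" for p q
    using that P.m_closed by (simp add: UP_carrier)
  have co: "a i \<in> carrier R" "b i \<in> carrier R" "r i \<in> carrier R" for i using a b r by (auto intro: mem_upD)
  have aa: "deg_le (a \<otimes>\<^bsub>UP R\<^esub> a) (2 * ?da)"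
    using deg_le_mult[OF a deg_le_deg[OF a] a deg_le_deg[OF a]] by simp
  have bb: "deg_le (b \<otimes>\<^bsub>UP R\<^esub> b) (2 * ?db)"
    using deg_le_mult[OF b deg_le_deg[OF b] b deg_le_deg[OF b]] by simp
  have rbb: "deg_le (r \<otimes>\<^bsub>UP R\<^esub> (b \<otimes>\<^bsub>UP R\<^esub> b)) (2 * int ?db + 2 * int s + 1)"
    using deg_le_mult[OF r(1,2) cl[OF b b] bb] by (simp add: algebra_simps)
  have aat: "(a \<otimes>\<^bsub>UP R\<^esub> a) (2 * ?da) = a ?da \<otimes> a ?da"
    using top_coeff[OF a deg_le_deg[OF a] a deg_le_deg[OF a]] by (simp add: mult_2)
  have bbt: "(b \<otimes>\<^bsub>UP R\<^esub> b) (2 * ?db) = b ?db \<otimes> b ?db"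
    using top_coeff[OF b deg_le_deg[OF b] b deg_le_deg[OF b]] by (simp add: mult_2)
  have rbbt: "(r \<otimes>\<^bsub>UP R\<^esub> (b \<otimes>\<^bsub>UP R\<^esub> b)) (2 * s + 1 + 2 * ?db) = r (2 * s + 1) \<otimes> (b ?db \<otimes> b ?db)"
    using top_coeff[OF r(1) _ cl[OF b b], of "2 * s + 1" "2 * ?db"] r(2) bb bbt by (simp add: algebra_simps)
  show ?thesis
  proof (cases "a \<noteq> \<zero>\<^bsub>UP R\<^esub> \<and> (b = \<zero>\<^bsub>UP R\<^esub> \<or> 2 * ?db + 2 * s + 1 < 2 * ?da)")
    case True
    have z: "(r \<otimes>\<^bsub>UP R\<^esub> (b \<otimes>\<^bsub>UP R\<^esub> b)) (2 * ?da) = \<zero>"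
    proof (cases "b = \<zero>\<^bsub>UP R\<^esub>")
      case True
      hence "r \<otimes>\<^bsub>UP R\<^esub> (b \<otimes>\<^bsub>UP R\<^esub> b) = \<zero>\<^bsub>UP R\<^esub>" using r by (simp add: UP_carrier[symmetric])
      thus ?thesis by (simp add: UP_zero_apply)
    next
      case False
      with True show ?thesis using deg_leD[OF rbb, of "2 * ?da"] by simp
    qed
    have "a ?da \<otimes> a ?da \<noteq> \<zero>" using lead_coeff_nonzero[OF a] True co by (simp add: integral_iff)
    hence "(a \<otimes>\<^bsub>UP R\<^esub> a \<ominus>\<^bsub>UP R\<^esub> r \<otimes>\<^bsub>UP R\<^esub> (b \<otimes>\<^bsub>UP R\<^esub> b)) (2 * ?da) \<noteq> \<zero>"
      using a b r cl z aat co by (simp add: UP_minus_apply)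
    moreover have "deg_le a (int (2 * ?da) div 2)" using deg_le_deg[OF a] by simp
    moreover have "deg_le b ((int (2 * ?da) - 2 * int s - 1) div 2)"
    proof (cases "b = \<zero>\<^bsub>UP R\<^esub>")
      case False
      hence "int ?db \<le> (int (2 * ?da) - 2 * int s - 1) div 2" using True by linarith
      thus ?thesis using deg_le_mono[OF deg_le_deg[OF b]] by blast
    qed (simp add: deg_le_zero)
    ultimately show ?thesis by blast
  next
    case False
    hence b0: "b \<noteq> \<zero>\<^bsub>UP R\<^esub>" using ab by blast
    have "2 * ?da \<noteq> 2 * s + 1 + 2 * ?db" by presburger
    moreover have "\<not> 2 * ?db + 2 * s + 1 < 2 * ?da" if "a \<noteq> \<zero>\<^bsub>UP R\<^esub>" using False that by blast
    ultimately have d: "a = \<zero>\<^bsub>UP R\<^esub> \<or> 2 * ?da < 2 * s + 1 + 2 * ?db" by linarith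
    define k where "k = 2 * s + 1 + 2 * ?db"
    have z: "(a \<otimes>\<^bsub>UP R\<^esub> a) k = \<zero>"
    proof (cases "a = \<zero>\<^bsub>UP R\<^esub>")
      case True thus ?thesis by (simp add: UP_zero_apply)
    next
      case False
      with d show ?thesis using deg_leD[OF aa, of k] by (simp add: k_def)
    qed
    have "r (2 * s + 1) \<otimes> (b ?db \<otimes> b ?db) \<noteq> \<zero>"
      using lead_coeff_nonzero[OF b b0] r(3) co by (simp add: integral_iff)
    hence "(a \<otimes>\<^bsub>UP R\<^esub> a \<ominus>\<^bsub>UP R\<^esub> r \<otimes>\<^bsub>UP R\<^esub> (b \<otimes>\<^bsub>UP R\<^esub> b)) k \<noteq> \<zero>"
      using a b r cl z rbbt co unfolding k_def by (simp add: UP_minus_apply)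
    moreover have "deg_le a (int k div 2)"
    proof (cases "a = \<zero>\<^bsub>UP R\<^esub>")
      case False
      hence "int ?da \<le> int k div 2" using d by (simp add: k_def)
      thus ?thesis using deg_le_mono[OF deg_le_deg[OF a]] by blast
    qed (simp add: deg_le_zero)
    moreover have "deg_le b ((int k - 2 * int s - 1) div 2)"
      using deg_le_deg[OF b] by (simp add: k_def)
    ultimately show ?thesis by blast
  qed
qed

lemma (in differential_domain) deg_le_der: "deg_le p d \<Longrightarrow> deg_le (der (diff_poly R) p) d"
  by (simp add: deg_le_def der_diff_poly)

text \<open>With the sign changed, since \<open>-r\<close> has odd degree as well.\<close>

lemma (in domain) odd_norm_nonzero:
  assumes a: "a \<in> up R" and b: "b \<in> up R"
    and r: "r \<in> up R" "deg_le r (2 * int s + 1)" "r (2 * s + 1) \<noteq> \<zero>"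
    and zero: "a \<otimes>\<^bsub>UP R\<^esub> a \<oplus>\<^bsub>UP R\<^esub> r \<otimes>\<^bsub>UP R\<^esub> (b \<otimes>\<^bsub>UP R\<^esub> b) = \<zero>\<^bsub>UP R\<^esub>"
  shows "a = \<zero>\<^bsub>UP R\<^esub>" "b = \<zero>\<^bsub>UP R\<^esub>"
proof -
  interpret P: UP_domain R "UP R" by unfold_locales simp
  let ?r = "\<ominus>\<^bsub>UP R\<^esub> r"
  have r': "?r \<in> up R" using r P.a_inv_closed by (simp add: UP_carrier)
  have i: "?r i = \<ominus> r i" "r i \<in> carrier R" for i using r by (auto simp: UP_a_inv_apply intro: mem_upD)
  have "a \<otimes>\<^bsub>UP R\<^esub> a \<ominus>\<^bsub>UP R\<^esub> ?r \<otimes>\<^bsub>UP R\<^esub> (b \<otimes>\<^bsub>UP R\<^esub> b) = \<zero>\<^bsub>UP R\<^esub>"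
    using a b r zero by (simp add: a_minus_def UP_carrier[symmetric] P.l_minus)
  moreover have "deg_le ?r (2 * int s + 1)" "?r (2 * s + 1) \<noteq> \<zero>" using r i by (auto simp: deg_le_def)
  ultimately have "\<not> (a \<noteq> \<zero>\<^bsub>UP R\<^esub> \<or> b \<noteq> \<zero>\<^bsub>UP R\<^esub>)"
    using odd_norm_degree[OF a b _ r'] by (metis UP_zero_apply)
  thus "a = \<zero>\<^bsub>UP R\<^esub>" "b = \<zero>\<^bsub>UP R\<^esub>" by blast+
qed

section \<open>The Riccati equation on a curve of odd degree\<close>

text \<open>The coordinates with respect to \<open>1, m\<close> of the relation in \<open>log_derivative_riccati\<close> below, where
  \<open>z = z\<^sub>0 + z\<^sub>1 m\<close> and \<open>g = g\<^sub>0 + g\<^sub>1 m\<close> have derivatives \<open>y\<^sub>0 + y\<^sub>1 m\<close> and \<open>h\<^sub>0 + h\<^sub>1 m\<close>.\<close>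

lemma (in cring) riccati_coordinates:
  assumes [simp]: "n \<in> carrier R" "U \<in> carrier R" "m \<in> carrier R" "r \<in> carrier R"
    "z0 \<in> carrier R" "z1 \<in> carrier R" "g0 \<in> carrier R" "g1 \<in> carrier R"
    "y0 \<in> carrier R" "y1 \<in> carrier R" "h0 \<in> carrier R" "h1 \<in> carrier R"
    and m: "m \<otimes> m = \<ominus> r"
  shows "n \<otimes> n \<otimes> U \<otimes> ((z0 \<oplus> z1 \<otimes> m) \<otimes> (z0 \<oplus> z1 \<otimes> m)) \<ominus>
     (n \<otimes> ((z0 \<oplus> z1 \<otimes> m) \<otimes> (h0 \<oplus> h1 \<otimes> m) \<ominus> (g0 \<oplus> g1 \<otimes> m) \<otimes> (y0 \<oplus> y1 \<otimes> m))
      \<oplus> (g0 \<oplus> g1 \<otimes> m) \<otimes> (g0 \<oplus> g1 \<otimes> m)) =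
    (n \<otimes> n \<otimes> U \<otimes> (z0 \<otimes> z0 \<ominus> r \<otimes> (z1 \<otimes> z1)) \<ominus>
      (n \<otimes> ((z0 \<otimes> h0 \<ominus> r \<otimes> (z1 \<otimes> h1)) \<ominus> (g0 \<otimes> y0 \<ominus> r \<otimes> (g1 \<otimes> y1)))
      \<oplus> (g0 \<otimes> g0 \<ominus> r \<otimes> (g1 \<otimes> g1)))) \<oplus>
    (n \<otimes> n \<otimes> U \<otimes> (z0 \<otimes> z1 \<oplus> z1 \<otimes> z0) \<ominus>
      (n \<otimes> ((z0 \<otimes> h1 \<oplus> z1 \<otimes> h0) \<ominus> (g0 \<otimes> y1 \<oplus> g1 \<otimes> y0)) \<oplus> (g0 \<otimes> g1 \<oplus> g1 \<otimes> g0))) \<otimes> m"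
proof -
  have r: "r = \<ominus> (m \<otimes> m)" using m by simp
  show ?thesis unfolding r by (reify polex) (simp add: normal_form)
qed

text \<open>The curve \<open>\<mu>\<^sup>2 + r(\<lambda>) = 0\<close> realised inside \<open>D\<close>: \<open>e\<close> evaluates polynomials in \<open>\<lambda>\<close> at an element of \<open>D\<close>
  that is transcendental over \<open>K\<close>, and \<open>m\<close> is the value of \<open>\<mu>\<close>.\<close>

locale odd_curve_embedding =
  K: differential_field K + D: differential_field D
  for K :: "('a, 'm) diff_ring_scheme" and D :: "('b, 'n) diff_ring_scheme" (structure) +
  fixes e :: "(nat \<Rightarrow> 'a) \<Rightarrow> 'b" and r :: "nat \<Rightarrow> 'a" and m :: 'b and s :: nat
  assumes e_hom: "e \<in> diff_ring_hom (diff_poly K) D"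
    and e_inj: "\<lbrakk>p \<in> up K; e p = \<zero>\<rbrakk> \<Longrightarrow> p = \<zero>\<^bsub>UP K\<^esub>"
    and r_up: "r \<in> up K" and r_deg: "K.deg_le r (2 * int s + 1)"
    and r_lead: "r (2 * s + 1) \<noteq> \<zero>\<^bsub>K\<^esub>"
    and m_carrier [simp]: "m \<in> carrier D" and m_der: "der D m = \<zero>"
    and m_square: "m \<otimes> m = \<ominus> e r"
    and char_K: "n > 0 \<Longrightarrow> of_natural K n \<noteq> \<zero>\<^bsub>K\<^esub>"
    and char_D: "n > 0 \<Longrightarrow> of_natural D n \<noteq> \<zero>"
begin

sublocale P: UP_domain K "UP K" by unfold_locales simp
sublocale DP: differential_domain "diff_poly K" by (rule K.diff_poly_differential_domain)
sublocale E: differential_embedding "diff_poly K" D e by unfold_locales (rule e_hom)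

abbreviation P_K where "P_K \<equiv> UP K"
abbreviation poly_mult (infixl "*." 70) where "p *. q \<equiv> p \<otimes>\<^bsub>UP K\<^esub> q"
abbreviation poly_add (infixl "+." 65) where "p +. q \<equiv> p \<oplus>\<^bsub>UP K\<^esub> q"
abbreviation poly_minus (infixl "-." 65) where "p -. q \<equiv> p \<ominus>\<^bsub>UP K\<^esub> q"

text \<open>The first coordinate of \<open>(a + b\<mu>)(c + d\<mu>)\<close>\<close>

abbreviation coord where "coord a b c d \<equiv> a *. c -. r *. (b *. d)"

lemma up_closed [simp]:
  "\<lbrakk>p \<in> up K; q \<in> up K\<rbrakk> \<Longrightarrow> p *. q \<in> up K"
  "\<lbrakk>p \<in> up K; q \<in> up K\<rbrakk> \<Longrightarrow> p +. q \<in> up K"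
  "\<lbrakk>p \<in> up K; q \<in> up K\<rbrakk> \<Longrightarrow> p -. q \<in> up K"
  "p \<in> up K \<Longrightarrow> der (diff_poly K) p \<in> up K"
  "\<zero>\<^bsub>UP K\<^esub> \<in> up K" "\<one>\<^bsub>UP K\<^esub> \<in> up K"
  using P.m_closed P.a_closed P.minus_closed DP.der_closed P.zero_closed P.one_closed
  by (simp_all add: K.UP_carrier)

lemma e_closed [simp]: "p \<in> up K \<Longrightarrow> e p \<in> carrier D"
  using E.H.hom_closed by (simp add: K.UP_carrier)

lemma e_simps [simp]:
  "\<lbrakk>p \<in> up K; q \<in> up K\<rbrakk> \<Longrightarrow> e (p *. q) = e p \<otimes> e q"
  "\<lbrakk>p \<in> up K; q \<in> up K\<rbrakk> \<Longrightarrow> e (p +. q) = e p \<oplus> e q"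
  "\<lbrakk>p \<in> up K; q \<in> up K\<rbrakk> \<Longrightarrow> e (p -. q) = e p \<ominus> e q"
  "p \<in> up K \<Longrightarrow> e (der (diff_poly K) p) = der D (e p)"
  "e \<zero>\<^bsub>UP K\<^esub> = \<zero>" "e \<one>\<^bsub>UP K\<^esub> = \<one>"
  using E.H.hom_mult[of p q] E.H.hom_add[of p q] E.hom_minus[of p q] E.der[of p] E.H.hom_zero E.H.hom_one
  by (simp_all add: K.UP_carrier)

lemma e_zero_iff: "p \<in> up K \<Longrightarrow> e p = \<zero> \<longleftrightarrow> p = \<zero>\<^bsub>UP K\<^esub>"
  using e_inj by auto

lemma r_carrier [simp]: "e r \<in> carrier D" using r_up by simp

lemma coordinates_zero:
  assumes a: "a \<in> up K" and b: "b \<in> up K" and zero: "e a \<oplus> e b \<otimes> m = \<zero>"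
  shows "a = \<zero>\<^bsub>UP K\<^esub>" "b = \<zero>\<^bsub>UP K\<^esub>"
proof -
  have id: "x \<otimes> x \<oplus> \<rho> \<otimes> (y \<otimes> y) = (x \<oplus> y \<otimes> m) \<otimes> (x \<ominus> y \<otimes> m)"
    if [simp]: "x \<in> carrier D" "y \<in> carrier D" "\<rho> \<in> carrier D" and m: "m \<otimes> m = \<ominus> \<rho>" for x y \<rho>
  proof -
    have \<rho>: "\<rho> = \<ominus> (m \<otimes> m)" using m by simp
    show ?thesis unfolding \<rho> by (reify D.polex) (simp add: D.normal_form)
  qed
  have "e (a *. a +. r *. (b *. b)) = \<zero>"
    using a b r_up zero id[OF _ _ _ m_square, of "e a" "e b"] by simp
  hence "a *. a +. r *. (b *. b) = \<zero>\<^bsub>UP K\<^esub>"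
    using a b r_up by (intro e_inj) simp_all
  from K.odd_norm_nonzero[OF a b r_up r_deg r_lead this]
  show "a = \<zero>\<^bsub>UP K\<^esub>" "b = \<zero>\<^bsub>UP K\<^esub>" by blast+
qed

text \<open>\<open>u - \<lambda>\<close> as a polynomial in \<open>\<lambda>\<close>\<close>

definition potential :: "'a \<Rightarrow> nat \<Rightarrow> 'a" where
  "potential u = up_ring.monom (UP K) u 0 -. up_ring.monom (UP K) \<one>\<^bsub>K\<^esub> 1"

lemma potential_up [simp]: "u \<in> carrier K \<Longrightarrow> potential u \<in> up K"
  unfolding potential_def using P.monom_closed by (simp add: K.UP_carrier)

lemma potential_apply:
  "u \<in> carrier K \<Longrightarrow> potential u i = (if i = 0 then u else if i = 1 then \<ominus>\<^bsub>K\<^esub> \<one>\<^bsub>K\<^esub> else \<zero>\<^bsub>K\<^esub>)"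
  using P.monom_closed[of u 0] P.monom_closed[of "\<one>\<^bsub>K\<^esub>" 1]
  by (simp add: potential_def K.UP_carrier K.UP_minus_apply K.UP_monom_apply)

lemma potential_deg: "u \<in> carrier K \<Longrightarrow> K.deg_le (potential u) 1"
  by (auto simp: K.deg_le_def potential_apply)

lemma of_natural_hom: "e (of_natural (diff_poly K) n) = of_natural D n"
  using DP.of_nat_closed by (induct n) (simp_all add: K.UP_carrier)

lemma of_natural_poly:
  "of_natural (diff_poly K) n \<in> up K" "(of_natural (diff_poly K) n) i = (if i = 0 then of_natural K n else \<zero>\<^bsub>K\<^esub>)"
proof -
  show 1: "of_natural (diff_poly K) n \<in> up K" for n using DP.of_nat_closed[of n] by (simp add: K.UP_carrier)
  show "(of_natural (diff_poly K) n) i = (if i = 0 then of_natural K n else \<zero>\<^bsub>K\<^esub>)"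
  proof (induct n)
    case 0 show ?case by (simp add: K.UP_zero_apply)
  next
    case (Suc n) thus ?case using 1[of n] by (simp add: K.UP_add_apply K.UP_one_apply)
  qed
qed

text \<open>If \<open>x\<close> and \<open>y m\<close> have pole order at most \<open>k\<close> at infinity, their products have pole order
  at most \<open>2k\<close>, and so has the first coordinate of the square of \<open>x + y m\<close>. A pole order \<open>2k\<close> means
  degree \<open>k\<close> in \<open>\<lambda>\<close>.\<close>

lemma even_part:
  assumes "x \<in> up K" "y \<in> up K" "K.deg_le x (int k div 2)" "K.deg_le y (int k div 2)"
  shows "K.deg_le (x *. y) (int k)"
  using K.deg_le_mult[OF assms(1,3,2,4)] by (rule K.deg_le_mono) simp

lemma odd_part:
  assumes "x \<in> up K" "y \<in> up K" "K.deg_le x ((int k - 2 * int s - 1) div 2)"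
    "K.deg_le y ((int k - 2 * int s - 1) div 2)"
  shows "K.deg_le (r *. (x *. y)) (int k)"
proof (rule K.deg_le_mono)
  show "K.deg_le (r *. (x *. y))
      (2 * int s + 1 + ((int k - 2 * int s - 1) div 2 + (int k - 2 * int s - 1) div 2))"
    using K.deg_le_mult[OF r_up r_deg _ K.deg_le_mult[OF assms(1,3,2,4)]] assms by simp
qed linarith

lemma square_deg:
  assumes "x \<in> up K" "y \<in> up K" "K.deg_le x (int k div 2)" "K.deg_le y ((int k - 2 * int s - 1) div 2)"
  shows "K.deg_le (coord x y x y) (int k)"
  using even_part[OF assms(1,1,3,3)] odd_part[OF assms(2,2,4,4)] assms r_up
  by (intro K.deg_le_minus) simp_all

text \<open>The first coordinate of \<open>n\<^sup>2 (u - \<lambda>) z\<^sup>2 = n (z g' - g z') + g\<^sup>2\<close>. If \<open>z\<close> has pole order exactly \<open>k\<close>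
  and \<open>g\<close> at most \<open>k\<close>, the right side has degree at most \<open>k\<close> in \<open>\<lambda>\<close>, and the left side \<open>k + 1\<close>.\<close>

lemma riccati_degree_contradiction:
  assumes up: "z0 \<in> up K" "z1 \<in> up K" "g0 \<in> up K" "g1 \<in> up K" and u: "u \<in> carrier K" and n: "n > 0"
    and z: "K.deg_le z0 (int k div 2)" "K.deg_le z1 ((int k - 2 * int s - 1) div 2)"
    and g: "K.deg_le g0 (int k div 2)" "K.deg_le g1 ((int k - 2 * int s - 1) div 2)"
    and k: "(coord z0 z1 z0 z1) k \<noteq> \<zero>\<^bsub>K\<^esub>"
    and N: "N = of_natural (diff_poly K) n"
    and eq: "N *. N *. potential u *. (coord z0 z1 z0 z1) =
      N *. ((coord z0 z1 (der (diff_poly K) g0) (der (diff_poly K) g1)) -.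
        (coord g0 g1 (der (diff_poly K) z0) (der (diff_poly K) z1)))
      +. coord g0 g1 g0 g1"
  shows False
proof -
  note d = K.deg_le_der[OF z(1)] K.deg_le_der[OF z(2)] K.deg_le_der[OF g(1)] K.deg_le_der[OF g(2)]
  have Nup: "N \<in> up K" "K.deg_le N 0" using of_natural_poly by (auto simp: N K.deg_le_def)
  note norm = square_deg[OF up(1,2) z]
  let ?R1 = "(coord z0 z1 (der (diff_poly K) g0) (der (diff_poly K) g1)) -.
        (coord g0 g1 (der (diff_poly K) z0) (der (diff_poly K) z1))"
  have "K.deg_le ?R1 (int k)"
    using even_part[OF up(1) _ z(1) d(3)] odd_part[OF up(2) _ z(2) d(4)]
      even_part[OF up(3) _ g(1) d(1)] odd_part[OF up(4) _ g(2) d(2)] up r_up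
    by (intro K.deg_le_minus) simp_all
  hence "K.deg_le (N *. ?R1) (int k)"
    using K.deg_le_mult[OF Nup, of ?R1 "int k"] up r_up by simp
  moreover note square_deg[OF up(3,4) g]
  ultimately have "K.deg_le (N *. N *. potential u *.
      coord z0 z1 z0 z1) (int k)"
    unfolding eq using up r_up Nup by (intro K.deg_le_add) simp_all
  hence "(N *. N *. potential u *.
      coord z0 z1 z0 z1) (1 + k) = \<zero>\<^bsub>K\<^esub>"
    by (rule K.deg_leD) simp
  note top_zero = this
  have NN: "K.deg_le (N *. N) 0" "(N *. N) 0 = N 0 \<otimes>\<^bsub>K\<^esub> N 0"
    using K.deg_le_mult[OF Nup Nup] K.top_coeff[of N 0 N 0] Nup by simp_all
  have NNU: "K.deg_le (N *. N *. potential u) (int 1)"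
    "(N *. N *. potential u) 1 = (N 0 \<otimes>\<^bsub>K\<^esub> N 0) \<otimes>\<^bsub>K\<^esub> potential u 1"
    using K.deg_le_mult[of "N *. N" 0 "potential u" 1] K.top_coeff[of "N *. N" 0 "potential u" 1]
      Nup u NN potential_deg[OF u] by simp_all
  have top: "(N *. N *. potential u *.
      coord z0 z1 z0 z1) (1 + k) =
      (N 0 \<otimes>\<^bsub>K\<^esub> N 0) \<otimes>\<^bsub>K\<^esub> potential u 1 \<otimes>\<^bsub>K\<^esub> (coord z0 z1 z0 z1) k"
    unfolding NNU(2)[symmetric] using NNU(1) norm Nup u up r_up by (intro K.top_coeff) simp_all
  have "N 0 \<noteq> \<zero>\<^bsub>K\<^esub>" "N 0 \<in> carrier K" "potential u 1 \<noteq> \<zero>\<^bsub>K\<^esub>" "potential u 1 \<in> carrier K"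
    using char_K[OF n] u by (auto simp: N of_natural_poly potential_apply)
  moreover have "(coord z0 z1 z0 z1) k \<in> carrier K"
    using up r_up by (intro mem_upD) simp
  ultimately have "(N 0 \<otimes>\<^bsub>K\<^esub> N 0) \<otimes>\<^bsub>K\<^esub> potential u 1 \<otimes>\<^bsub>K\<^esub>
      (coord z0 z1 z0 z1) k \<noteq> \<zero>\<^bsub>K\<^esub>"
    using k by (simp add: K.integral_iff)
  thus False using top top_zero by simp
qed

end

text \<open>With \<open>\<phi> = \<alpha> + \<beta>m\<close>, the hypothesis on \<open>\<beta>'\<close> gives \<open>\<beta>Y\<close> the logarithmic derivative \<open>-(\<alpha> - \<beta>m)\<close>, and it
  makes the Riccati expressions of \<open>\<alpha> + \<beta>m\<close> and \<open>\<alpha> - \<beta>m\<close> equal. A linear relation between \<open>Y\<close> and \<open>y\<close>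
  would make \<open>\<beta>Y\<^sup>2\<close> constant, but its logarithmic derivative is \<open>2\<beta>m\<close>.\<close>

lemma (in differential_field) conjugate_solution:
  assumes c [simp]: "\<alpha> \<in> carrier R" "\<beta> \<in> carrier R" "m \<in> carrier R" "Y \<in> carrier R"
    and nz: "\<beta> \<noteq> \<zero>" "Y \<noteq> \<zero>" and m: "der R m = \<zero>"
    and Y: "der R Y = (\<alpha> \<oplus> \<beta> \<otimes> m) \<otimes> Y"
    and \<beta>: "der R \<beta> = \<ominus> (\<alpha> \<otimes> \<beta> \<oplus> \<alpha> \<otimes> \<beta>)"
  defines "y \<equiv> \<one> \<oslash> (\<beta> \<otimes> Y)"
  shows "der R y = (\<alpha> \<ominus> \<beta> \<otimes> m) \<otimes> y"
    and "der R (der R y) = (der R (\<alpha> \<oplus> \<beta> \<otimes> m) \<oplus> (\<alpha> \<oplus> \<beta> \<otimes> m) \<otimes> (\<alpha> \<oplus> \<beta> \<otimes> m)) \<otimes> y"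
    and "\<lbrakk>m \<noteq> \<zero>; \<one> \<oplus> \<one> \<noteq> \<zero>; k1 \<in> constants R; k2 \<in> constants R; k1 \<otimes> Y \<oplus> k2 \<otimes> y = \<zero>\<rbrakk>
      \<Longrightarrow> k1 = \<zero> \<and> k2 = \<zero>"
proof -
  define v where "v = \<beta> \<otimes> Y"
  define q where "q = \<alpha> \<ominus> \<beta> \<otimes> m"
  have [simp]: "v \<in> carrier R" "q \<in> carrier R" "y \<in> carrier R" and v0: "v \<noteq> \<zero>"
    using nz by (auto simp: v_def q_def y_def integral_iff)
  have y: "y = \<one> \<oslash> v" by (simp add: y_def v_def)
  have "(\<ominus> (\<alpha> \<otimes> \<beta> \<oplus> \<alpha> \<otimes> \<beta>)) \<otimes> Y \<oplus> \<beta> \<otimes> ((\<alpha> \<oplus> \<beta> \<otimes> m) \<otimes> Y) = \<ominus> ((\<alpha> \<ominus> \<beta> \<otimes> m) \<otimes> (\<beta> \<otimes> Y))"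
    by (reify polex) (simp add: normal_form)
  hence v': "der R v = \<ominus> (q \<otimes> v)" by (simp add: v_def q_def der_mult \<beta> Y)
  have "der R y = \<ominus> (\<ominus> q) \<otimes> y" unfolding y
    by (rule der_inverse_log) (use v0 v' in \<open>simp_all add: l_minus\<close>)
  hence y': "der R y = q \<otimes> y" by simp
  thus "der R y = (\<alpha> \<ominus> \<beta> \<otimes> m) \<otimes> y" by (simp add: q_def)
  have q': "der R q = der R \<alpha> \<oplus> (\<alpha> \<otimes> \<beta> \<oplus> \<alpha> \<otimes> \<beta>) \<otimes> m"
    by (simp add: q_def der_minus der_mult m \<beta>) (simp add: l_minus a_minus_def)
  have "(a \<oplus> (\<alpha> \<otimes> \<beta> \<oplus> \<alpha> \<otimes> \<beta>) \<otimes> m) \<otimes> y \<oplus> (\<alpha> \<ominus> \<beta> \<otimes> m) \<otimes> ((\<alpha> \<ominus> \<beta> \<otimes> m) \<otimes> y) =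
      (a \<oplus> (\<ominus> (\<alpha> \<otimes> \<beta> \<oplus> \<alpha> \<otimes> \<beta>)) \<otimes> m \<oplus> (\<alpha> \<oplus> \<beta> \<otimes> m) \<otimes> (\<alpha> \<oplus> \<beta> \<otimes> m)) \<otimes> y"
    if [simp]: "a \<in> carrier R" for a
    by (reify polex) (simp add: normal_form)
  from this[of "der R \<alpha>"] have "der R q \<otimes> y \<oplus> q \<otimes> (q \<otimes> y) =
      (der R \<alpha> \<oplus> der R \<beta> \<otimes> m \<oplus> (\<alpha> \<oplus> \<beta> \<otimes> m) \<otimes> (\<alpha> \<oplus> \<beta> \<otimes> m)) \<otimes> y"
    unfolding q' by (simp add: q_def \<beta>)
  thus "der R (der R y) = (der R (\<alpha> \<oplus> \<beta> \<otimes> m) \<oplus> (\<alpha> \<oplus> \<beta> \<otimes> m) \<otimes> (\<alpha> \<oplus> \<beta> \<otimes> m)) \<otimes> y"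
    by (simp add: y' der_mult der_add m)
  assume m0: "m \<noteq> \<zero>" and two: "\<one> \<oplus> \<one> \<noteq> \<zero>" and k: "k1 \<in> constants R" "k2 \<in> constants R"
    and rel: "k1 \<otimes> Y \<oplus> k2 \<otimes> y = \<zero>"
  have kc[simp]: "k1 \<in> carrier R" "k2 \<in> carrier R" and k': "der R k1 = \<zero>" "der R k2 = \<zero>"
    using k by (auto simp: constants_def)
  have yv: "y \<otimes> v = \<one>" using div_eq_iff[of \<one> v y] v0 y by (metis \<open>v \<in> carrier R\<close> \<open>y \<in> carrier R\<close> one_closed)
  have "(k1 \<otimes> Y \<oplus> k2 \<otimes> y) \<otimes> v = k1 \<otimes> (Y \<otimes> v) \<oplus> k2 \<otimes> (y \<otimes> v)"
    by (simp add: l_distr m_assoc)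
  hence rel': "k1 \<otimes> (Y \<otimes> v) \<oplus> k2 = \<zero>" using rel yv by simp
  hence "der R (k1 \<otimes> (Y \<otimes> v) \<oplus> k2) = \<zero>" by simp
  hence "k1 \<otimes> (((\<alpha> \<oplus> \<beta> \<otimes> m) \<otimes> Y) \<otimes> v \<oplus> Y \<otimes> (\<ominus> (q \<otimes> v))) = \<zero>"
    by (simp add: der_add der_mult k' v' Y)
  moreover have "((\<alpha> \<oplus> \<beta> \<otimes> m) \<otimes> Y) \<otimes> v \<oplus> Y \<otimes> (\<ominus> ((\<alpha> \<ominus> \<beta> \<otimes> m) \<otimes> v)) = (\<one> \<oplus> \<one>) \<otimes> \<beta> \<otimes> m \<otimes> Y \<otimes> v"
    by (reify polex) (simp add: normal_form)
  ultimately have "k1 \<otimes> ((\<one> \<oplus> \<one>) \<otimes> \<beta> \<otimes> m \<otimes> Y \<otimes> v) = \<zero>" by (simp add: q_def)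
  hence "k1 = \<zero>" using two nz m0 v0 by (simp add: integral_iff)
  with rel' show "k1 = \<zero> \<and> k2 = \<zero>" by simp
qed

text \<open>If \<open>g = n f z\<close>, then \<open>g' = n (f' z + f z')\<close>, and the Riccati expression \<open>f' + f\<^sup>2\<close> multiplied by
  \<open>n\<^sup>2 z\<^sup>2\<close> becomes a differential polynomial in \<open>z\<close> and \<open>g\<close>.\<close>

lemma (in cring) log_derivative_riccati:
  assumes [simp]: "N \<in> carrier R" "f \<in> carrier R" "f' \<in> carrier R" "z \<in> carrier R" "z' \<in> carrier R"
  shows "N \<otimes> N \<otimes> (f' \<oplus> f \<otimes> f) \<otimes> (z \<otimes> z) \<ominus>
     (N \<otimes> (z \<otimes> (N \<otimes> (f' \<otimes> z \<oplus> f \<otimes> z')) \<ominus> (N \<otimes> f \<otimes> z) \<otimes> z') \<oplus> (N \<otimes> f \<otimes> z) \<otimes> (N \<otimes> f \<otimes> z)) = \<zero>"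
  by (reify polex) (simp add: normal_form)

lemma (in cring) norm_scale:
  assumes [simp]: "a \<in> carrier R" "b \<in> carrier R" "c \<in> carrier R" "r \<in> carrier R"
  shows "(a \<otimes> c) \<otimes> (a \<otimes> c) \<ominus> r \<otimes> ((b \<otimes> c) \<otimes> (b \<otimes> c)) = (c \<otimes> c) \<otimes> (a \<otimes> a \<ominus> r \<otimes> (b \<otimes> b))"
  by (reify polex) (simp add: normal_form)

lemma (in cring) quotient_coordinates:
  assumes [simp]: "a \<in> carrier R" "b \<in> carrier R" "c \<in> carrier R" "m \<in> carrier R"
    "a' \<in> carrier R" "b' \<in> carrier R" "c' \<in> carrier R"
  shows "(a' \<oplus> b' \<otimes> m) \<otimes> c \<ominus> (a \<oplus> b \<otimes> m) \<otimes> c' = (a' \<otimes> c \<ominus> a \<otimes> c') \<oplus> (b' \<otimes> c \<ominus> b \<otimes> c') \<otimes> m"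
    and "(a \<oplus> b \<otimes> m) \<otimes> c = a \<otimes> c \<oplus> (b \<otimes> c) \<otimes> m"
  by (reify polex, simp add: normal_form)+

context odd_curve_embedding begin

text \<open>The image of \<open>K(\<Gamma>)\<close> in \<open>D\<close>: every function is \<open>(a + b\<mu>)/c\<close> with \<open>a, b, c \<in> K[\<lambda>]\<close>.\<close>

definition curve_functions where
  "curve_functions = {(e a \<oplus> e b \<otimes> m) \<oslash> e c | a b c.
     a \<in> up K \<and> b \<in> up K \<and> c \<in> up K \<and> c \<noteq> \<zero>\<^bsub>UP K\<^esub>}"

lemma der_coordinates:
  "\<lbrakk>a \<in> up K; b \<in> up K\<rbrakk> \<Longrightarrow> der D (e a \<oplus> e b \<otimes> m) =
     e (der (diff_poly K) a) \<oplus> e (der (diff_poly K) b) \<otimes> m"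
  by (simp add: D.der_add D.der_mult m_der)

text \<open>The logarithmic derivative of \<open>w = (a + bm)/c\<close> is \<open>g/z\<close> with \<open>z = (a + bm)c\<close> and
  \<open>g = (a + bm)'c - (a + bm)c'\<close>. The pole order of \<open>g\<close> at infinity is at most that of \<open>z\<close>. If \<open>g/z = n\<phi>\<close>,
  the Riccati equation says that \<open>n\<^sup>2(u - \<lambda>)z\<^sup>2\<close> has no larger pole than \<open>z\<^sup>2\<close>, which is absurd.\<close>

lemma no_log_derivative:
  assumes \<phi> [simp]: "\<phi> \<in> carrier D" and u: "u \<in> carrier K" and n: "n > 0"
    and ric: "der D \<phi> \<oplus> \<phi> \<otimes> \<phi> = e (potential u)"
    and w: "w \<in> curve_functions" and w': "der D w = of_natural D n \<otimes> \<phi> \<otimes> w"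
  shows "w = \<zero>"
proof (rule ccontr)
  assume w0: "w \<noteq> \<zero>"
  from w obtain a b c where abc: "a \<in> up K" "b \<in> up K" "c \<in> up K" "c \<noteq> \<zero>\<^bsub>UP K\<^esub>"
    and w_eq: "w = (e a \<oplus> e b \<otimes> m) \<oslash> e c" unfolding curve_functions_def by blast
  note up = abc(1-3)
  define x where "x = e a \<oplus> e b \<otimes> m"
  define N where "N = of_natural D n"
  let ?d = "der (diff_poly K)"
  have [simp]: "x \<in> carrier D" "N \<in> carrier D" using abc by (simp_all add: x_def N_def)
  have c0: "e c \<noteq> \<zero>" using abc e_zero_iff by simp
  have ab0: "a \<noteq> \<zero>\<^bsub>UP K\<^esub> \<or> b \<noteq> \<zero>\<^bsub>UP K\<^esub>"
    using w0 c0 abc unfolding w_eq by (auto simp: D.div_eq_iff)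
  define z where "z = x \<otimes> e c"
  define g where "g = der D x \<otimes> e c \<ominus> x \<otimes> der D (e c)"
  have [simp]: "z \<in> carrier D" "g \<in> carrier D" using abc by (simp_all add: z_def g_def)
  have "g \<oslash> (e c \<otimes> e c) = N \<otimes> \<phi> \<otimes> (x \<oslash> e c)"
    using w' c0 abc unfolding w_eq x_def[symmetric] N_def[symmetric] g_def by (simp add: D.der_div)
  hence "g = N \<otimes> \<phi> \<otimes> (x \<oslash> e c) \<otimes> (e c \<otimes> e c)"
    using c0 abc by (subst (asm) D.div_eq_iff) (auto simp: D.integral_iff)
  also have "\<dots> = N \<otimes> \<phi> \<otimes> z"
  proof -
    have "(x \<oslash> e c) \<otimes> (e c \<otimes> e c) = z" using c0 abc by (simp add: z_def D.m_assoc[symmetric])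
    thus ?thesis using abc by (simp add: D.m_assoc)
  qed
  finally have g: "g = N \<otimes> \<phi> \<otimes> z" .
  have g': "der D g = N \<otimes> (der D \<phi> \<otimes> z \<oplus> \<phi> \<otimes> der D z)"
    unfolding g by (simp add: D.der_mult N_def D.r_distr D.m_assoc)
  define z0 where "z0 = a *. c"
  define z1 where "z1 = b *. c"
  define g0 where "g0 = ?d a *. c -. a *. ?d c"
  define g1 where "g1 = ?d b *. c -. b *. ?d c"
  have zg [simp]: "z0 \<in> up K" "z1 \<in> up K" "g0 \<in> up K" "g1 \<in> up K"
    using abc by (simp_all add: z0_def z1_def g0_def g1_def)
  have zc: "z = e z0 \<oplus> e z1 \<otimes> m"
    unfolding z_def x_def using abc D.quotient_coordinates(2)[of "e a" "e b" "e c" m \<phi> \<phi> \<phi>]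
    by (simp add: z0_def z1_def)
  have gc: "g = e g0 \<oplus> e g1 \<otimes> m"
    unfolding g_def x_def der_coordinates[OF up(1,2)]
    using abc D.quotient_coordinates(1)[of "e a" "e b" "e c" m "e (?d a)" "e (?d b)" "e (?d c)"]
    by (simp add: g0_def g1_def)
  define NP where "NP = of_natural (diff_poly K) n"
  have NP [simp]: "NP \<in> up K" "e NP = N" using of_natural_poly of_natural_hom by (simp_all add: NP_def N_def)
  define V where "V = NP *. NP *. potential u *. coord z0 z1 z0 z1"
  define V' where "V' = NP *. (coord z0 z1 (?d g0) (?d g1) -.
        coord g0 g1 (?d z0) (?d z1))
      +. coord g0 g1 g0 g1"
  define Z where "Z = NP *. NP *. potential u *. (z0 *. z1 +. z1 *. z0) -.
      (NP *. ((z0 *. ?d g1 +. z1 *. ?d g0) -. (g0 *. ?d z1 +. g1 *. ?d z0))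
      +. (g0 *. g1 +. g1 *. g0))"
  have VZ [simp]: "V \<in> up K" "V' \<in> up K" "Z \<in> up K" using u r_up by (simp_all add: V_def V'_def Z_def)
  have "e (V -. V') \<oplus> e Z \<otimes> m =
    N \<otimes> N \<otimes> e (potential u) \<otimes> (z \<otimes> z) \<ominus>
     (N \<otimes> (z \<otimes> der D g \<ominus> g \<otimes> der D z) \<oplus> g \<otimes> g)"
    unfolding zc gc der_coordinates[OF zg(1,2)] der_coordinates[OF zg(3,4)]
    using D.riccati_coordinates[of N "e (potential u)" m "e r" "e z0" "e z1" "e g0" "e g1"
        "e (?d z0)" "e (?d z1)" "e (?d g0)" "e (?d g1)", OF _ _ _ _ _ _ _ _ _ _ _ _ m_square] u r_up
    unfolding V_def V'_def Z_def by simp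
  also have "\<dots> = \<zero>"
    unfolding g' ric[symmetric] unfolding g by (rule D.log_derivative_riccati) simp_all
  finally have "V -. V' = \<zero>\<^bsub>P_K\<^esub>" by (intro coordinates_zero(1)) simp_all
  hence VV': "V = V'" using VZ by (simp add: K.UP_carrier[symmetric])
  obtain k where k: "K.deg_le a (int k div 2)" "K.deg_le b ((int k - 2 * int s - 1) div 2)"
    "(coord a b a b) k \<noteq> \<zero>\<^bsub>K\<^esub>"
    using K.odd_norm_degree[OF up(1,2) ab0 r_up r_deg r_lead] by blast
  define d where "d = deg K c"
  note cd = K.deg_le_deg[OF up(3), folded d_def]
  have deg_k: "int k div 2 + int d = int (2 * d + k) div 2"
    "(int k - 2 * int s - 1) div 2 + int d = (int (2 * d + k) - 2 * int s - 1) div 2" by simp_all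
  have deg: "K.deg_le z0 (int (2 * d + k) div 2)" "K.deg_le z1 ((int (2 * d + k) - 2 * int s - 1) div 2)"
    "K.deg_le g0 (int (2 * d + k) div 2)" "K.deg_le g1 ((int (2 * d + k) - 2 * int s - 1) div 2)"
    unfolding z0_def z1_def g0_def g1_def deg_k[symmetric]
    using abc by (auto intro!: K.deg_le_minus K.deg_le_mult K.deg_le_der k cd)
  have "coord z0 z1 z0 z1 =
      (c *. c) *. coord a b a b"
    unfolding z0_def z1_def using abc r_up by (intro P.norm_scale) (simp_all add: K.UP_carrier)
  moreover have cc: "K.deg_le (c *. c) (int (2 * d))" "(c *. c) (2 * d) = c d \<otimes>\<^bsub>K\<^esub> c d"
    using K.deg_le_mult[OF up(3) cd up(3) cd] K.top_coeff[OF up(3) cd up(3) cd] by (simp_all only: mult_2 of_nat_add)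
  ultimately have "(coord z0 z1 z0 z1) (2 * d + k) =
      (c d \<otimes>\<^bsub>K\<^esub> c d) \<otimes>\<^bsub>K\<^esub> (coord a b a b) k"
    using K.top_coeff[OF _ cc(1) _ square_deg[OF up(1,2) k(1,2)]] abc r_up by simp
  moreover have "c d \<noteq> \<zero>\<^bsub>K\<^esub>" using K.lead_coeff_nonzero abc by (simp add: d_def)
  moreover have "c d \<in> carrier K" "(coord a b a b) k \<in> carrier K"
    using abc r_up by (auto intro!: mem_upD)
  ultimately have top: "(coord z0 z1 z0 z1) (2 * d + k) \<noteq> \<zero>\<^bsub>K\<^esub>"
    using k(3) by (simp add: K.integral_iff)
  show False
    by (rule riccati_degree_contradiction[OF zg u n deg top NP_def VV'[unfolded V_def V'_def]])
qed

text \<open>The Riccati equation for \<open>a/c\<close> with denominators cleared. The right side has degree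
  \<open>1 + 2 deg c\<close>. If \<open>deg a \<le> deg c\<close>, the left side has smaller degree; otherwise it has the even degree
  \<open>2 deg a\<close>, which is larger.\<close>

lemma no_rational_riccati:
  assumes a: "a \<in> up K" and c: "c \<in> up K" and c0: "c \<noteq> \<zero>\<^bsub>UP K\<^esub>" and u: "u \<in> carrier K"
  shows "der (diff_poly K) a *. c -. a *. der (diff_poly K) c +. a *. a
      \<noteq> potential u *. (c *. c)" (is "?L \<noteq> ?R")
proof
  assume eq: "?L = ?R"
  let ?W = "der (diff_poly K) a *. c -. a *. der (diff_poly K) c"
  define d where "d = deg K c"
  note cd = K.deg_le_deg[OF c, folded d_def]
  have cc: "K.deg_le (c *. c) (int (2 * d))" "(c *. c) (2 * d) = c d \<otimes>\<^bsub>K\<^esub> c d"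
    using K.deg_le_mult[OF c cd c cd] K.top_coeff[OF c cd c cd] by (simp_all only: mult_2 of_nat_add)
  have R: "K.deg_le ?R (int (1 + 2 * d))" "?R (1 + 2 * d) = potential u 1 \<otimes>\<^bsub>K\<^esub> (c d \<otimes>\<^bsub>K\<^esub> c d)"
    using K.deg_le_mult[OF potential_up[OF u] potential_deg[OF u] _ cc(1)]
      K.top_coeff[OF potential_up[OF u] _ _ cc(1), of 1] potential_deg[OF u] c cc(2) by simp_all
  have W: "K.deg_le ?W (int n + int d)" if "K.deg_le a (int n)" for n
    using a c that by (auto intro!: K.deg_le_minus K.deg_le_mult K.deg_le_der cd)
  have cdc: "c d \<noteq> \<zero>\<^bsub>K\<^esub>" "c d \<in> carrier K" using K.lead_coeff_nonzero c c0 by (auto simp: d_def intro: mem_upD)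
  show False
  proof (cases "deg K a \<le> d")
    case True
    hence ad: "K.deg_le a (int d)" using K.deg_le_deg[OF a] K.deg_le_mono by simp
    have "K.deg_le ?L (int d + int d)"
      using W[OF ad] K.deg_le_mult[OF a ad a ad] a c by (intro K.deg_le_add) simp_all
    hence "?L (1 + 2 * d) = \<zero>\<^bsub>K\<^esub>" by (rule K.deg_leD) simp
    thus False using cdc u unfolding eq R(2) by (simp add: potential_apply K.integral_iff)
  next
    case False
    define k where "k = deg K a"
    note ak = K.deg_le_deg[OF a, folded k_def]
    have kd: "k > d" using False by (simp add: k_def)
    hence "a \<noteq> \<zero>\<^bsub>UP K\<^esub>" by (auto simp: k_def)
    hence acx: "a k \<noteq> \<zero>\<^bsub>K\<^esub>" "a k \<in> carrier K" using K.lead_coeff_nonzero a by (auto simp: k_def intro: mem_upD)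
    have "?W (2 * k) = \<zero>\<^bsub>K\<^esub>" by (rule K.deg_leD[OF W[OF ak]]) (use kd in simp)
    moreover have "(a *. a) (2 * k) = a k \<otimes>\<^bsub>K\<^esub> a k"
      using K.top_coeff[OF a ak a ak] by (simp only: mult_2)
    ultimately have "?L (2 * k) = a k \<otimes>\<^bsub>K\<^esub> a k" using a c acx by (simp add: K.UP_add_apply)
    moreover have "?R (2 * k) = \<zero>\<^bsub>K\<^esub>" by (rule K.deg_leD[OF R(1)]) (use kd in simp)
    moreover have "a k \<otimes>\<^bsub>K\<^esub> a k \<noteq> \<zero>\<^bsub>K\<^esub>" using acx by (simp add: K.integral_iff)
    ultimately show False unfolding eq by simp
  qed
qed

text \<open>The \<open>m\<close>-coordinate of the Riccati equation is the equation for \<open>\<beta>'\<close>.\<close>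

lemma riccati_split:
  assumes \<phi>: "\<phi> \<in> curve_functions" and u: "u \<in> carrier K"
    and ric: "der D \<phi> \<oplus> \<phi> \<otimes> \<phi> = e (potential u)"
  obtains \<alpha> \<beta> where "\<alpha> \<in> carrier D" "\<beta> \<in> curve_functions" "\<beta> \<in> carrier D" "\<beta> \<noteq> \<zero>"
    "\<phi> = \<alpha> \<oplus> \<beta> \<otimes> m" "der D \<beta> = \<ominus> (\<alpha> \<otimes> \<beta> \<oplus> \<alpha> \<otimes> \<beta>)"
proof -
  from \<phi> obtain a b c where abc: "a \<in> up K" "b \<in> up K" "c \<in> up K" "c \<noteq> \<zero>\<^bsub>UP K\<^esub>"
    and \<phi>_eq: "\<phi> = (e a \<oplus> e b \<otimes> m) \<oslash> e c" unfolding curve_functions_def by blast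
  let ?d = "der (diff_poly K)"
  have c0: "e c \<noteq> \<zero>" using abc e_zero_iff by simp
  have ec [simp]: "e a \<in> carrier D" "e b \<in> carrier D" "e c \<in> carrier D" using abc by simp_all
  define x where "x = e a \<oplus> e b \<otimes> m"
  have [simp]: "x \<in> carrier D" by (simp add: x_def)
  define V where "V = (?d a *. c -. a *. ?d c) +. coord a b a b"
  define U where "U = potential u *. (c *. c)"
  define W where "W = ?d b *. c -. b *. ?d c"
  define Z where "Z = W +. (a *. b +. a *. b)"
  have VZ: "V \<in> up K" "U \<in> up K" "Z \<in> up K" "W \<in> up K"
    using abc r_up u by (simp_all add: V_def U_def Z_def W_def)
  have clear: "(g \<oslash> (y \<otimes> y) \<oplus> (x \<oslash> y) \<otimes> (x \<oslash> y)) \<otimes> (y \<otimes> y) = g \<oplus> x \<otimes> x"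
    if [simp]: "g \<in> carrier D" "y \<in> carrier D" and y0: "y \<noteq> \<zero>" for g y
  proof -
    have "(p \<oplus> z \<otimes> z) \<otimes> (y \<otimes> y) = p \<otimes> (y \<otimes> y) \<oplus> (z \<otimes> y) \<otimes> (z \<otimes> y)"
      if [simp]: "p \<in> carrier D" "z \<in> carrier D" for p z
      by (reify D.polex) (simp add: D.normal_form)
    note id = this[of "g \<oslash> (y \<otimes> y)" "x \<oslash> y", OF D.div_closed D.div_closed]
    have "(g \<oslash> (y \<otimes> y)) \<otimes> (y \<otimes> y) = g" "(x \<oslash> y) \<otimes> y = x" using y0 by (simp_all add: D.integral_iff)
    with id show ?thesis by (simp only: that D.m_closed \<open>x \<in> carrier D\<close>)
  qed
  let ?g = "der D x \<otimes> e c \<ominus> x \<otimes> der D (e c)"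
  have d\<phi>: "der D \<phi> = ?g \<oslash> (e c \<otimes> e c)"
    unfolding \<phi>_eq x_def[symmetric] using c0 by (simp add: D.der_div)
  have "?g \<oplus> x \<otimes> x = e U"
    using clear[of ?g "e c"] c0 ric[unfolded d\<phi>] u abc
    unfolding \<phi>_eq x_def[symmetric] by (simp add: U_def)
  moreover have "?g \<oplus> x \<otimes> x = e V \<oplus> e Z \<otimes> m"
  proof -
    have id: "((a' \<oplus> b' \<otimes> m) \<otimes> c1 \<ominus> (a1 \<oplus> b1 \<otimes> m) \<otimes> c') \<oplus>
        (a1 \<oplus> b1 \<otimes> m) \<otimes> (a1 \<oplus> b1 \<otimes> m) =
        (a' \<otimes> c1 \<ominus> a1 \<otimes> c' \<oplus> (a1 \<otimes> a1 \<ominus> r' \<otimes> (b1 \<otimes> b1))) \<oplus>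
        (b' \<otimes> c1 \<ominus> b1 \<otimes> c' \<oplus> (a1 \<otimes> b1 \<oplus> a1 \<otimes> b1)) \<otimes> m"
      if [simp]: "a1 \<in> carrier D" "b1 \<in> carrier D" "c1 \<in> carrier D" "a' \<in> carrier D"
        "b' \<in> carrier D" "c' \<in> carrier D" "r' \<in> carrier D" and m: "m \<otimes> m = \<ominus> r'"
      for a1 b1 c1 a' b' c' r'
    proof -
      have r': "r' = \<ominus> (m \<otimes> m)" using m by simp
      show ?thesis unfolding r' by (reify D.polex) (simp add: D.normal_form)
    qed
    show ?thesis unfolding x_def der_coordinates[OF abc(1,2)]
      using id[of "e a" "e b" "e c" "e (?d a)" "e (?d b)" "e (?d c)" "e r", OF _ _ _ _ _ _ _ m_square]
        abc r_up by (simp add: V_def Z_def W_def)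
  qed
  ultimately have "e V \<oplus> e Z \<otimes> m = e U" by simp
  hence "e (V -. U) \<oplus> e Z \<otimes> m = \<zero>"
  proof -
    assume eq: "e V \<oplus> e Z \<otimes> m = e U"
    have "(p \<ominus> q) \<oplus> t = (p \<oplus> t) \<ominus> q"
      if [simp]: "p \<in> carrier D" "q \<in> carrier D" "t \<in> carrier D" for p q t
      by (reify D.polex) (simp add: D.normal_form)
    thus ?thesis using VZ eq by simp
  qed
  note coordinates_zero[OF up_closed(3)[OF VZ(1,2)] VZ(3) this]
  hence "V -. U = \<zero>\<^bsub>P_K\<^esub>" and Z0: "Z = \<zero>\<^bsub>P_K\<^esub>" by simp_all
  hence VU: "V = U" using VZ by (simp add: K.UP_carrier[symmetric])
  have b0: "b \<noteq> \<zero>\<^bsub>P_K\<^esub>"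
  proof
    assume b: "b = \<zero>\<^bsub>P_K\<^esub>"
    have "r *. (b *. b) = \<zero>\<^bsub>P_K\<^esub>" using r_up b by (simp add: K.UP_carrier[symmetric])
    hence "coord a b a b = a *. a"
      using P.minus_zero[of "a *. a"] abc(1) by (simp only: K.UP_carrier up_closed)
    thus False using no_rational_riccati[OF abc(1,3,4) u] VU by (simp add: V_def U_def)
  qed
  define \<alpha> where "\<alpha> = e a \<oslash> e c"
  define \<beta> where "\<beta> = e b \<oslash> e c"
  show thesis
  proof (rule that[of \<alpha> \<beta>])
    show "\<alpha> \<in> carrier D" "\<beta> \<in> carrier D" by (simp_all add: \<alpha>_def \<beta>_def)
    have "\<beta> = (e b \<oplus> e \<zero>\<^bsub>P_K\<^esub> \<otimes> m) \<oslash> e c" by (simp add: \<beta>_def)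
    thus "\<beta> \<in> curve_functions" unfolding curve_functions_def using abc up_closed(5) by blast
    show "\<beta> \<noteq> \<zero>" using b0 abc c0 e_zero_iff[of b] by (auto simp: \<beta>_def D.div_eq_iff)
    have "(a1 \<oplus> b1 \<otimes> m) \<oslash> c1 = (a1 \<oslash> c1) \<oplus> (b1 \<oslash> c1) \<otimes> m"
      if [simp]: "a1 \<in> carrier D" "b1 \<in> carrier D" "c1 \<in> carrier D" and c1: "c1 \<noteq> \<zero>" for a1 b1 c1
    proof -
      have "(z \<oplus> w \<otimes> m) \<otimes> c1 = z \<otimes> c1 \<oplus> (w \<otimes> c1) \<otimes> m"
        if [simp]: "z \<in> carrier D" "w \<in> carrier D" for z w
        by (reify D.polex) (simp add: D.normal_form)
      note id = this[of "a1 \<oslash> c1" "b1 \<oslash> c1", OF D.div_closed D.div_closed]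
      have "(a1 \<oslash> c1) \<otimes> c1 = a1" "(b1 \<oslash> c1) \<otimes> c1 = b1" using c1 by simp_all
      with id have "((a1 \<oslash> c1) \<oplus> (b1 \<oslash> c1) \<otimes> m) \<otimes> c1 = a1 \<oplus> b1 \<otimes> m" by (simp only: that)
      from this[symmetric] show ?thesis by (subst D.div_eq_iff) (simp_all only: that D.div_closed D.m_closed D.a_closed m_carrier not_False_eq_True)
    qed
    thus "\<phi> = \<alpha> \<oplus> \<beta> \<otimes> m" unfolding \<phi>_eq \<alpha>_def \<beta>_def using c0 by simp
    have "e W \<oplus> (e a \<otimes> e b \<oplus> e a \<otimes> e b) = \<zero>"
      using arg_cong[OF Z0, of e] abc VZ by (simp add: Z_def)
    hence eW: "e W = \<ominus> (e a \<otimes> e b \<oplus> e a \<otimes> e b)"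
      using VZ by (intro D.minus_equality[symmetric]) simp_all
    have "(\<ominus> (a1 \<otimes> b1 \<oplus> a1 \<otimes> b1)) \<oslash> (c1 \<otimes> c1) =
        \<ominus> ((a1 \<oslash> c1) \<otimes> (b1 \<oslash> c1) \<oplus> (a1 \<oslash> c1) \<otimes> (b1 \<oslash> c1))"
      if [simp]: "a1 \<in> carrier D" "b1 \<in> carrier D" "c1 \<in> carrier D" and c1: "c1 \<noteq> \<zero>" for a1 b1 c1
    proof -
      have "\<ominus> (z \<otimes> w \<oplus> z \<otimes> w) \<otimes> (c1 \<otimes> c1) = \<ominus> ((z \<otimes> c1) \<otimes> (w \<otimes> c1) \<oplus> (z \<otimes> c1) \<otimes> (w \<otimes> c1))"
        if [simp]: "z \<in> carrier D" "w \<in> carrier D" for z w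
        by (reify D.polex) (simp add: D.normal_form)
      note id = this[of "a1 \<oslash> c1" "b1 \<oslash> c1", OF D.div_closed D.div_closed]
      have "(a1 \<oslash> c1) \<otimes> c1 = a1" "(b1 \<oslash> c1) \<otimes> c1 = b1" using c1 by simp_all
      with id have "\<ominus> ((a1 \<oslash> c1) \<otimes> (b1 \<oslash> c1) \<oplus> (a1 \<oslash> c1) \<otimes> (b1 \<oslash> c1)) \<otimes> (c1 \<otimes> c1) =
          \<ominus> (a1 \<otimes> b1 \<oplus> a1 \<otimes> b1)" by (simp only: that)
      from this[symmetric] show ?thesis
        by (subst D.div_eq_iff) (simp_all only: that D.div_closed D.m_closed D.a_closed D.a_inv_closed
            D.integral_iff not_False_eq_True de_Morgan_disj simp_thms)
    qed
    note id = this[of "e a" "e b" "e c"]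
    have "der D \<beta> = e W \<oslash> (e c \<otimes> e c)"
      unfolding \<beta>_def using c0 abc by (simp add: D.der_div W_def)
    also have "\<dots> = \<ominus> (\<alpha> \<otimes> \<beta> \<oplus> \<alpha> \<otimes> \<beta>)"
      unfolding eW \<alpha>_def \<beta>_def by (rule id) (simp_all add: c0)
    finally show "der D \<beta> = \<ominus> (\<alpha> \<otimes> \<beta> \<oplus> \<alpha> \<otimes> \<beta>)" .
  qed
qed

end

section \<open>Quotients by differential prime ideals\<close>

context differential_domain begin

lemma diff_quot_differential_domain:
  assumes prime: "primeideal I R" and I_der: "\<And>x. x \<in> I \<Longrightarrow> der R x \<in> I"
  shows "differential_domain (diff_quot R I)"
    and "(\<lambda>x. I +> x) \<in> diff_ring_hom R (diff_quot R I)"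
    and "carrier (diff_quot R I) = (\<lambda>x. I +> x) ` carrier R"
    and "\<And>x. x \<in> carrier R \<Longrightarrow> I +> x = \<zero>\<^bsub>diff_quot R I\<^esub> \<longleftrightarrow> x \<in> I"
proof -
  interpret I: primeideal I R by fact
  interpret Q: domain "diff_quot R I"
    unfolding diff_quot_def by (rule with_der_domain[OF I.quotient_is_domain])
  have carrier_quot: "carrier (diff_quot R I) = (\<lambda>x. I +> x) ` carrier R"
    by (auto simp: diff_quot_def FactRing_def A_RCOSETS_def')
  have mult: "(I +> x) \<otimes>\<^bsub>diff_quot R I\<^esub> (I +> y) = I +> (x \<otimes> y)"
    and add: "(I +> x) \<oplus>\<^bsub>diff_quot R I\<^esub> (I +> y) = I +> (x \<oplus> y)"
    if "x \<in> carrier R" "y \<in> carrier R" for x y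
    using that I.rcos_ring_hom by (auto simp: diff_quot_def ring_hom_def)
  have one: "\<one>\<^bsub>diff_quot R I\<^esub> = I +> \<one>" by (simp add: diff_quot_def FactRing_def)
  have zero: "\<zero>\<^bsub>diff_quot R I\<^esub> = I" by (simp add: diff_quot_def FactRing_def)
  have der_quot: "der (diff_quot R I) (I +> x) = I +> der R x" if x: "x \<in> carrier R" for x
  proof -
    have "I +> der R y = I +> der R x" if "y \<in> I +> x" for y
    proof -
      from that obtain i where i: "i \<in> I" "y = i \<oplus> x" by (auto simp: a_r_coset_def')
      hence ic: "i \<in> carrier R" using I.Icarr by blast
      have "I +> der R y = (I +> der R i) \<oplus>\<^bsub>diff_quot R I\<^esub> (I +> der R x)"
        using ic x i by (simp add: der_add add)
      also have "I +> der R i = \<zero>\<^bsub>diff_quot R I\<^esub>" unfolding zero using I_der[OF i(1)] by (rule I.a_rcos_const)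
      finally show ?thesis using x carrier_quot by simp
    qed
    hence "(\<Union>y\<in>I +> x. I +> der R y) = (\<Union>y\<in>I +> x. I +> der R x)" by (intro SUP_cong refl)
    moreover have "I +> x \<noteq> {}" using I.a_rcos_self[OF x] by blast
    ultimately have "(\<Union>y\<in>I +> x. I +> der R y) = I +> der R x" by (simp only: UN_constant if_False)
    thus ?thesis by (simp only: diff_quot_def with_der_simps)
  qed
  show "carrier (diff_quot R I) = (\<lambda>x. I +> x) ` carrier R" by (rule carrier_quot)
  show "differential_domain (diff_quot R I)"
  proof
    fix S assume "S \<in> carrier (diff_quot R I)"
    then obtain x where x: "S = I +> x" "x \<in> carrier R" using carrier_quot by auto
    show "der (diff_quot R I) S \<in> carrier (diff_quot R I)" using x by (simp add: der_quot carrier_quot)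
    fix T assume "T \<in> carrier (diff_quot R I)"
    then obtain y where y: "T = I +> y" "y \<in> carrier R" using carrier_quot by auto
    show "der (diff_quot R I) (S \<oplus>\<^bsub>diff_quot R I\<^esub> T) =
        der (diff_quot R I) S \<oplus>\<^bsub>diff_quot R I\<^esub> der (diff_quot R I) T"
      using x y by (simp add: add der_quot der_add)
    show "der (diff_quot R I) (S \<otimes>\<^bsub>diff_quot R I\<^esub> T) =
        der (diff_quot R I) S \<otimes>\<^bsub>diff_quot R I\<^esub> T \<oplus>\<^bsub>diff_quot R I\<^esub> S \<otimes>\<^bsub>diff_quot R I\<^esub> der (diff_quot R I) T"
      using x y by (simp add: add mult der_quot der_mult)
  qed
  show "(\<lambda>x. I +> x) \<in> diff_ring_hom R (diff_quot R I)"
    unfolding diff_ring_hom_def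
    by (auto intro!: ring_hom_memI simp: carrier_quot mult add one der_quot)
  show "I +> x = \<zero>\<^bsub>diff_quot R I\<^esub> \<longleftrightarrow> x \<in> I" if "x \<in> carrier R" for x
    unfolding zero using that I.a_rcos_const I.a_rcos_self by blast
qed

end

section \<open>The function field of an odd hyperelliptic curve\<close>

text \<open>Both norms are products of conjugates modulo \<open>f = \<mu>\<^sup>2 + r\<close>. The multiple of \<open>f\<close> is explicit so that
  the statement is an identity of polynomials, to be read later in \<open>K[\<lambda>, \<mu>]\<close>.\<close>

lemma (in cring) norm_product:
  assumes [simp]: "a \<in> carrier R" "b \<in> carrier R" "c \<in> carrier R" "d \<in> carrier R" "m \<in> carrier R"
    "f \<in> carrier R" "r \<in> carrier R" and m: "m \<otimes> m = f \<ominus> r"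
  shows "((a \<oplus> b \<otimes> m) \<otimes> (c \<oplus> d \<otimes> m)) \<otimes> ((a \<ominus> b \<otimes> m) \<otimes> (c \<ominus> d \<otimes> m)) \<oplus>
      (b \<otimes> b \<otimes> (c \<otimes> c \<oplus> r \<otimes> (d \<otimes> d)) \<oplus> d \<otimes> d \<otimes> (a \<otimes> a \<oplus> r \<otimes> (b \<otimes> b)) \<ominus> f \<otimes> (b \<otimes> b) \<otimes> (d \<otimes> d)) \<otimes> f =
    (a \<otimes> a \<oplus> r \<otimes> (b \<otimes> b)) \<otimes> (c \<otimes> c \<oplus> r \<otimes> (d \<otimes> d))"
proof -
  have f: "f = m \<otimes> m \<oplus> r" unfolding m by (reify polex) (simp add: normal_form)
  show ?thesis unfolding f by (reify polex) (simp add: normal_form)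
qed

locale odd_curve = K: differential_field K
  for K :: "('a, 'm) diff_ring_scheme" and r :: "nat \<Rightarrow> 'a" and s :: nat +
  assumes r_up: "r \<in> up K" and r_const: "\<And>i. der K (r i) = \<zero>\<^bsub>K\<^esub>"
    and r_deg: "K.deg_le r (2 * int s + 1)" and r_lead: "r (2 * s + 1) \<noteq> \<zero>\<^bsub>K\<^esub>"
begin

sublocale P: UP_domain K "UP K" by unfold_locales simp
sublocale A: differential_domain "diff_poly K" by (rule K.diff_poly_differential_domain)
sublocale Q: UP_domain "diff_poly K" "UP (diff_poly K)" by unfold_locales simp
sublocale B: differential_domain "bivar K"
  unfolding bivar_def by (rule A.diff_poly_differential_domain)

lemma bivar_simps [simp]:
  "carrier (bivar K) = carrier (UP (diff_poly K))"
  "monoid.mult (bivar K) = monoid.mult (UP (diff_poly K))"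
  "one (bivar K) = one (UP (diff_poly K))" "ring.zero (bivar K) = ring.zero (UP (diff_poly K))"
  "ring.add (bivar K) = ring.add (UP (diff_poly K))" "a_inv (bivar K) = a_inv (UP (diff_poly K))"
  "a_minus (bivar K) = a_minus (UP (diff_poly K))"
  by (simp_all add: bivar_def)

abbreviation Q_K where "Q_K \<equiv> UP (diff_poly K)"
abbreviation bivar_mult (infixl "*:" 70) where "p *: q \<equiv> p \<otimes>\<^bsub>Q_K\<^esub> q"
abbreviation bivar_add (infixl "+:" 65) where "p +: q \<equiv> p \<oplus>\<^bsub>Q_K\<^esub> q"
abbreviation bivar_minus (infixl "-:" 65) where "p -: q \<equiv> p \<ominus>\<^bsub>Q_K\<^esub> q"
abbreviation mu where "mu \<equiv> bivar_mu K"
abbreviation f where "f \<equiv> curve_eq K r"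
abbreviation I where "I \<equiv> curve_ideal K r"
abbreviation cls where "cls p \<equiv> I +>\<^bsub>bivar K\<^esub> p"

text \<open>The inclusion of \<open>K[\<lambda>]\<close> into \<open>K[\<lambda>, \<mu>] = K[\<lambda>][\<mu>]\<close>\<close>

definition cst :: "(nat \<Rightarrow> 'a) \<Rightarrow> nat \<Rightarrow> nat \<Rightarrow> 'a" where
  "cst p = up_ring.monom Q_K p 0"

lemma A_carrier: "carrier (diff_poly K) = up K" by (simp add: K.UP_carrier)

lemma Q_carrier: "carrier Q_K = up (diff_poly K)" by (rule A.UP_carrier)

lemma cst_closed [simp]: "p \<in> up K \<Longrightarrow> cst p \<in> carrier Q_K"
  unfolding cst_def by (rule Q.monom_closed) (simp add: K.UP_carrier)

lemma cst_apply: "p \<in> up K \<Longrightarrow> cst p i = (if i = 0 then p else \<zero>\<^bsub>UP K\<^esub>)"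
  unfolding cst_def by (simp add: A.UP_monom_apply K.UP_carrier)

lemma mu_eq: "mu = up_ring.monom Q_K \<one>\<^bsub>UP K\<^esub> 1"
proof -
  have "up_ring.monom (UP K) \<one>\<^bsub>K\<^esub> 0 = \<one>\<^bsub>UP K\<^esub>" using P.monom_one by simp
  thus ?thesis by (simp add: bivar_mu_def)
qed

lemma mu_closed [simp]: "mu \<in> carrier Q_K"
  unfolding mu_eq by (rule Q.monom_closed) simp

lemma mu_apply: "mu i = (if i = 1 then \<one>\<^bsub>UP K\<^esub> else \<zero>\<^bsub>UP K\<^esub>)"
  unfolding mu_eq using A.UP_monom_apply[of "\<one>\<^bsub>UP K\<^esub>" 1 i] by simp

lemma cst_hom: "cst \<in> diff_ring_hom (diff_poly K) (bivar K)"
proof -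
  have "cst (der (diff_poly K) p) = der (bivar K) (cst p)" if p: "p \<in> up K" for p
  proof
    fix i show "cst (der (diff_poly K) p) i = der (bivar K) (cst p) i"
      using p K.up_der[OF p] A.der_zero by (simp add: cst_apply bivar_def der_diff_poly[of "diff_poly K"])
  qed
  moreover have "cst (p \<otimes>\<^bsub>UP K\<^esub> q) = cst p *: cst q" if "p \<in> up K" "q \<in> up K" for p q
    unfolding cst_def using Q.monom_mult[of p q 0 0] that by (simp add: K.UP_carrier)
  moreover have "cst (p \<oplus>\<^bsub>UP K\<^esub> q) = cst p +: cst q" if "p \<in> up K" "q \<in> up K" for p q
    unfolding cst_def using Q.monom_add[of p q 0] that by (simp add: K.UP_carrier)
  moreover have "cst \<one>\<^bsub>UP K\<^esub> = \<one>\<^bsub>Q_K\<^esub>" unfolding cst_def using Q.monom_one by simp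
  ultimately show ?thesis
    by (auto simp: diff_ring_hom_def K.UP_carrier intro!: ring_hom_memI)
qed

lemma cst_simps:
  "\<lbrakk>p \<in> up K; q \<in> up K\<rbrakk> \<Longrightarrow> cst (p \<otimes>\<^bsub>UP K\<^esub> q) = cst p *: cst q"
  "\<lbrakk>p \<in> up K; q \<in> up K\<rbrakk> \<Longrightarrow> cst (p \<oplus>\<^bsub>UP K\<^esub> q) = cst p +: cst q"
  using cst_hom by (auto simp: diff_ring_hom_def ring_hom_def K.UP_carrier)

lemma f_eq: "f = (mu *: mu) +: cst r"
  by (simp add: curve_eq_def cst_def)

lemma f_closed [simp]: "f \<in> carrier Q_K"
  unfolding f_eq using r_up by simp

lemma mu_square: "mu *: mu = f -: cst r"
proof -
  have [simp]: "x = (x +: y) -: y" if "x \<in> carrier Q_K" "y \<in> carrier Q_K" for x y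
    using that by (simp add: a_minus_def Q.P.add.m_assoc Q.P.r_neg)
  show ?thesis unfolding f_eq using r_up by simp
qed

lemma f_apply: "f i = (if i = 0 then r else if i = 2 then \<one>\<^bsub>UP K\<^esub> else \<zero>\<^bsub>UP K\<^esub>)"
proof -
  have mm: "mu *: mu = up_ring.monom Q_K \<one>\<^bsub>UP K\<^esub> 2"
    unfolding mu_eq using Q.monom_mult[of "\<one>\<^bsub>UP K\<^esub>" "\<one>\<^bsub>UP K\<^esub>" 1 1] by (simp add: numeral_2_eq_2)
  have "f i = (mu *: mu) i \<oplus>\<^bsub>UP K\<^esub> cst r i"
    unfolding f_eq using A.UP_add_apply[of "mu *: mu" "cst r" i] r_up
      Q.m_closed[OF mu_closed mu_closed] cst_closed[OF r_up] by (simp add: Q_carrier)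
  thus ?thesis unfolding mm using A.UP_monom_apply[of "\<one>\<^bsub>UP K\<^esub>" 2 i] r_up
    by (simp add: cst_apply K.UP_carrier[symmetric])
qed

lemma f_deg: "deg (diff_poly K) f = 2"
proof (rule le_antisym)
  have c: "up_ring.coeff Q_K f i = f i" for i using f_closed by (simp add: A.UP_coeff Q_carrier)
  show "deg (diff_poly K) f \<le> 2" by (rule Q.deg_aboveI) (simp_all add: c f_apply)
  show "2 \<le> deg (diff_poly K) f" by (rule Q.deg_belowI) (simp_all add: c f_apply)
qed

lemma I_ideal: "ideal I (bivar K)"
  unfolding curve_ideal_def by (rule B.cgenideal_ideal) simp

lemma I_iff: "x \<in> I \<longleftrightarrow> (\<exists>h\<in>carrier Q_K. x = h *: f)"
  by (auto simp: curve_ideal_def cgenideal_def)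

lemma linear_apply:
  assumes ab: "a \<in> up K" "b \<in> up K"
  shows "(cst a +: cst b *: mu) i = (if i = 0 then a else if i = 1 then b else \<zero>\<^bsub>UP K\<^esub>)"
proof -
  have bm: "cst b *: mu = up_ring.monom Q_K b 1"
    unfolding cst_def mu_eq using Q.monom_mult[of b "\<one>\<^bsub>UP K\<^esub>" 0 1] ab by (simp add: K.UP_carrier[symmetric])
  have bmu: "up_ring.monom Q_K b 1 \<in> up (diff_poly K)"
    using Q.monom_closed[of b 1] ab by (simp add: Q_carrier A_carrier del: diff_poly_simps)
  have "(cst a +: cst b *: mu) i = cst a i \<oplus>\<^bsub>UP K\<^esub> up_ring.monom Q_K b 1 i"
    unfolding bm using A.UP_add_apply[of "cst a" _ i] bmu cst_closed[OF ab(1)] by (simp add: Q_carrier)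
  also have "up_ring.monom Q_K b 1 i = (if i = 1 then b else \<zero>\<^bsub>UP K\<^esub>)"
    using A.UP_monom_apply[of b 1 i] ab by (simp add: K.UP_carrier)
  finally show ?thesis unfolding cst_apply[OF ab(1)] using ab
    by (cases "i = 0"; cases "i = 1") (simp_all add: K.UP_carrier[symmetric])
qed

text \<open>Division with remainder by \<open>f\<close>, which is monic of degree \<open>2\<close> in \<open>\<mu>\<close>\<close>

lemma linear_rep:
  assumes p: "p \<in> carrier Q_K"
  obtains h a b where "h \<in> carrier Q_K" "a \<in> up K" "b \<in> up K"
    "p = h *: f +: (cst a +: cst b *: mu)"
proof -
  have f0: "f \<noteq> \<zero>\<^bsub>Q_K\<^esub>" using f_deg Q.deg_zero by auto
  have lc: "up_ring.coeff Q_K f (deg (diff_poly K) f) = \<one>\<^bsub>diff_poly K\<^esub>"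
    unfolding f_deg using A.UP_coeff[of f 2] f_closed by (simp add: Q_carrier f_apply)
  obtain q t k where q: "q \<in> carrier Q_K" "t \<in> carrier Q_K"
    and e: "(up_ring.coeff Q_K f (deg (diff_poly K) f)) [^]\<^bsub>diff_poly K\<^esub> (k::nat) \<odot>\<^bsub>Q_K\<^esub> p = f *: q +: t"
    and d: "t = \<zero>\<^bsub>Q_K\<^esub> \<or> deg (diff_poly K) t < deg (diff_poly K) f"
    using Q.long_div_theorem[OF f_closed p f0] by blast
  have p_eq: "p = q *: f +: t"
    using e p q Q.m_comm[OF f_closed q(1)] A.nat_pow_one[of k] Q.smult_one[OF p] unfolding lc by simp
  define a where "a = t 0"
  define b where "b = t 1"
  have ab: "a \<in> up K" "b \<in> up K" using q(2) by (auto simp: a_def b_def Q_carrier A_carrier[symmetric] dest: mem_upD)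
  have t: "t i = \<zero>\<^bsub>UP K\<^esub>" if "i \<ge> 2" for i
  proof (cases "t = \<zero>\<^bsub>Q_K\<^esub>")
    case True thus ?thesis using A.UP_zero_apply by simp
  next
    case False
    hence "deg (diff_poly K) t < i" using d that by (simp add: f_deg)
    thus ?thesis using Q.deg_aboveD[of t i] q(2) A.UP_coeff[of t i] by (simp add: Q_carrier)
  qed
  have "t = cst a +: cst b *: mu"
  proof
    fix i
    show "t i = (cst a +: cst b *: mu) i"
      unfolding linear_apply[OF ab] using t[of i] by (auto simp: a_def b_def)
  qed
  thus ?thesis using that[OF q(1) ab] p_eq by simp
qed

lemma linear_in_ideal:
  assumes ab: "a \<in> up K" "b \<in> up K" and mem: "cst a +: cst b *: mu \<in> I"
  shows "a = \<zero>\<^bsub>UP K\<^esub>" "b = \<zero>\<^bsub>UP K\<^esub>"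
proof -
  let ?t = "cst a +: cst b *: mu"
  have tc: "?t \<in> carrier Q_K" using ab by simp
  note t = linear_apply[OF ab]
  obtain h where h: "h \<in> carrier Q_K" "?t = h *: f" using mem I_iff by blast
  have f0: "f \<noteq> \<zero>\<^bsub>Q_K\<^esub>" using f_deg Q.deg_zero by auto
  have "h = \<zero>\<^bsub>Q_K\<^esub>"
  proof (rule ccontr)
    assume h0: "h \<noteq> \<zero>\<^bsub>Q_K\<^esub>"
    have "deg (diff_poly K) ?t = deg (diff_poly K) h + 2"
      unfolding h(2) using Q.deg_mult[OF h0 f0 h(1) f_closed] f_deg by simp
    moreover have "?t \<noteq> \<zero>\<^bsub>Q_K\<^esub>" unfolding h(2) using h0 f0 h(1) by (simp add: Q.integral_iff)
    ultimately have "?t (deg (diff_poly K) h + 2) \<noteq> \<zero>\<^bsub>UP K\<^esub>"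
      using A.lead_coeff_nonzero[of ?t] tc by (simp add: Q_carrier)
    thus False using t by simp
  qed
  hence "?t = \<zero>\<^bsub>Q_K\<^esub>" using h by simp
  hence "?t i = \<zero>\<^bsub>UP K\<^esub>" for i using A.UP_zero_apply[of i] by simp
  from this[of 0] this[of 1] show "a = \<zero>\<^bsub>UP K\<^esub>" "b = \<zero>\<^bsub>UP K\<^esub>" using t by simp_all
qed

text \<open>The norm \<open>a\<^sup>2 + r b\<^sup>2\<close> of \<open>a + b\<mu>\<close> is multiplicative modulo the equation and vanishes only for
  \<open>a = b = 0\<close>.\<close>

lemma I_prime: "primeideal I (bivar K)"
proof (rule primeidealI)
  interpret I: ideal I "bivar K" by (rule I_ideal)
  show "ideal I (bivar K)" by (rule I_ideal)
  show "cring (bivar K)" by (rule B.is_cring)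
  show "carrier (bivar K) \<noteq> I"
  proof
    assume "carrier (bivar K) = I"
    moreover have z: "\<zero>\<^bsub>UP K\<^esub> \<in> up K" "\<one>\<^bsub>UP K\<^esub> \<in> up K" by (simp_all add: K.UP_carrier[symmetric])
    moreover have "cst \<one>\<^bsub>UP K\<^esub> +: cst \<zero>\<^bsub>UP K\<^esub> *: mu \<in> carrier (bivar K)" using z by simp
    ultimately have "\<one>\<^bsub>UP K\<^esub> = \<zero>\<^bsub>UP K\<^esub>" using linear_in_ideal(1)[of "\<one>\<^bsub>UP K\<^esub>" "\<zero>\<^bsub>UP K\<^esub>"] by blast
    thus False by simp
  qed
  fix x y assume x: "x \<in> carrier (bivar K)" and y: "y \<in> carrier (bivar K)" and xy: "x \<otimes>\<^bsub>bivar K\<^esub> y \<in> I"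
  have xQ: "x \<in> carrier Q_K" "y \<in> carrier Q_K" using x y by simp_all
  obtain h a b where h: "h \<in> carrier Q_K" "a \<in> up K" "b \<in> up K"
    and x_eq: "x = h *: f +: (cst a +: cst b *: mu)" using xQ(1) by (rule linear_rep)
  obtain h' c d where h': "h' \<in> carrier Q_K" "c \<in> up K" "d \<in> up K"
    and y_eq: "y = h' *: f +: (cst c +: cst d *: mu)" using xQ(2) by (rule linear_rep)
  let ?x = "cst a +: cst b *: mu" and ?y = "cst c +: cst d *: mu"
  let ?x' = "cst a -: cst b *: mu" and ?y' = "cst c -: cst d *: mu"
  let ?n1 = "cst a *: cst a +: cst r *: (cst b *: cst b)" and ?n2 = "cst c *: cst c +: cst r *: (cst d *: cst d)"
  have [simp]: "cst a \<in> carrier Q_K" "cst b \<in> carrier Q_K" "cst c \<in> carrier Q_K" "cst d \<in> carrier Q_K"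
    "cst r \<in> carrier Q_K" "?x \<in> carrier Q_K" "?y \<in> carrier Q_K" "?x' \<in> carrier Q_K" "?y' \<in> carrier Q_K"
    "h \<in> carrier Q_K" "h' \<in> carrier Q_K"
    using h h' r_up by simp_all
  have If: "g *: f \<in> I" if "g \<in> carrier Q_K" for g using that I_iff by blast
  have Iadd: "p +: q \<in> I" if "p \<in> I" "q \<in> I" for p q using I.a_closed[OF that] by simp
  have Imul: "p *: q \<in> I" if "p \<in> I" "q \<in> carrier Q_K" for p q using I.I_r_closed[of p q] that by simp
  have "u *: v = (g *: F +: u) *: (k *: F +: v) +:
      (\<ominus>\<^bsub>Q_K\<^esub> (g *: (k *: F +: v) +: u *: k)) *: F"
    if [simp]: "u \<in> carrier Q_K" "v \<in> carrier Q_K" "g \<in> carrier Q_K" "k \<in> carrier Q_K" "F \<in> carrier Q_K"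
    for u v g k F
    by (reify Q.P.polex) (simp add: Q.P.normal_form)
  from this[of ?x ?y h h' f] have "?x *: ?y = x *: y +:
      (\<ominus>\<^bsub>Q_K\<^esub> (h *: y +: ?x *: h')) *: f" unfolding x_eq y_eq by simp
  hence "?x *: ?y \<in> I" using xy xQ by (simp add: Iadd If)
  hence "(?x *: ?y) *: (?x' *: ?y') \<in> I" by (rule Imul) simp
  note prod = this
  let ?N1 = "a \<otimes>\<^bsub>UP K\<^esub> a \<oplus>\<^bsub>UP K\<^esub> r \<otimes>\<^bsub>UP K\<^esub> (b \<otimes>\<^bsub>UP K\<^esub> b)" and ?N2 = "c \<otimes>\<^bsub>UP K\<^esub> c \<oplus>\<^bsub>UP K\<^esub> r \<otimes>\<^bsub>UP K\<^esub> (d \<otimes>\<^bsub>UP K\<^esub> d)"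
  have up: "p \<otimes>\<^bsub>UP K\<^esub> q \<in> up K" "p \<oplus>\<^bsub>UP K\<^esub> q \<in> up K" if "p \<in> up K" "q \<in> up K" for p q
    using that P.m_closed P.a_closed by (simp_all add: K.UP_carrier)
  have N: "?N1 \<in> up K" "?N2 \<in> up K" "?N1 \<otimes>\<^bsub>UP K\<^esub> ?N2 \<in> up K" using h h' r_up up by simp_all
  have "cst (?N1 \<otimes>\<^bsub>UP K\<^esub> ?N2) =
      ?n1 *:
      ?n2"
    using h h' r_up up by (simp add: cst_simps)
  moreover have np: "?n1 *:
      ?n2 \<in> I"
  proof (subst Q.norm_product[of "cst a" "cst b" "cst c" "cst d" mu f "cst r", OF _ _ _ _ _ _ _ mu_square, symmetric])
    show "(?x *: ?y) *: (?x' *: ?y') +: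
      (cst b *: cst b *: ?n2 +:
       cst d *: cst d *: ?n1 -:
       f *: (cst b *: cst b) *: (cst d *: cst d)) *: f \<in> I"
      by (rule Iadd[OF prod If]) simp
  qed simp_all
  ultimately have "cst (?N1 \<otimes>\<^bsub>UP K\<^esub> ?N2) \<in> I"
    using np by (simp only:)
  moreover have "cst \<zero>\<^bsub>UP K\<^esub> = \<zero>\<^bsub>Q_K\<^esub>" unfolding cst_def using Q.monom_zero by simp
  moreover have z: "\<zero>\<^bsub>UP K\<^esub> \<in> up K" by (simp add: K.UP_carrier[symmetric])
  ultimately have "?N1 \<otimes>\<^bsub>UP K\<^esub> ?N2 = \<zero>\<^bsub>UP K\<^esub>"
    using linear_in_ideal(1)[OF N(3) z] N(3) by simp
  hence "?N1 = \<zero>\<^bsub>UP K\<^esub> \<or> ?N2 = \<zero>\<^bsub>UP K\<^esub>" using N P.integral by (simp add: K.UP_carrier)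
  hence "(a = \<zero>\<^bsub>UP K\<^esub> \<and> b = \<zero>\<^bsub>UP K\<^esub>) \<or> (c = \<zero>\<^bsub>UP K\<^esub> \<and> d = \<zero>\<^bsub>UP K\<^esub>)"
    using K.odd_norm_nonzero[OF h(2,3) r_up r_deg r_lead] K.odd_norm_nonzero[OF h'(2,3) r_up r_deg r_lead] by blast
  hence "x = h *: f \<or> y = h' *: f"
    using \<open>cst \<zero>\<^bsub>UP K\<^esub> = \<zero>\<^bsub>Q_K\<^esub>\<close> unfolding x_eq y_eq by auto
  thus "x \<in> I \<or> y \<in> I" using If by auto
qed

lemma I_der:
  assumes "x \<in> I"
  shows "der (bivar K) x \<in> I"
proof -
  obtain h where h: "h \<in> carrier Q_K" "x = h *: f" using assms I_iff by blast
  have "der (bivar K) f = \<zero>\<^bsub>Q_K\<^esub>"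
  proof
    fix i
    have "der (diff_poly K) r = \<zero>\<^bsub>UP K\<^esub>" by (rule ext) (simp add: der_diff_poly r_const K.UP_zero_apply)
    thus "der (bivar K) f i = \<zero>\<^bsub>Q_K\<^esub> i"
      using A.der_zero A.der_one A.UP_zero_apply[of i]
      by (simp add: bivar_def der_diff_poly[of "diff_poly K"] f_apply)
  qed
  moreover have "der (bivar K) h \<in> carrier Q_K" using B.der_closed[of h] h by simp
  ultimately have "der (bivar K) x = der (bivar K) h *: f"
    unfolding h(2) using B.der_mult[of h f] h by simp
  thus ?thesis using \<open>der (bivar K) h \<in> carrier Q_K\<close> I_iff by blast
qed

sublocale C: differential_domain "curve_ring K r"
  unfolding curve_ring_def by (rule B.diff_quot_differential_domain[OF I_prime I_der])

sublocale F: differential_field "curve_field K r"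
  unfolding curve_field_def by (rule C.frac_field_differential)

abbreviation KG where "KG \<equiv> curve_field K r"

lemma diff_ring_hom_comp:
  "\<lbrakk>g \<in> diff_ring_hom R S; h \<in> diff_ring_hom S T\<rbrakk> \<Longrightarrow> (\<lambda>x. h (g x)) \<in> diff_ring_hom R T"
  unfolding diff_ring_hom_def by (auto simp: ring_hom_def Pi_def)

lemma class_hom: "cls \<in> diff_ring_hom (bivar K) (curve_ring K r)"
  unfolding curve_ring_def by (rule B.diff_quot_differential_domain[OF I_prime I_der])

lemma class_one: "cls \<one>\<^bsub>bivar K\<^esub> = \<one>\<^bsub>curve_ring K r\<^esub>"
  using class_hom by (auto simp: diff_ring_hom_def ring_hom_def)

lemma curve_of_poly_hom: "curve_of_poly K r \<in> diff_ring_hom (bivar K) KG"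
proof -
  have "(\<lambda>x. fraction (curve_ring K r) (cls x) \<one>\<^bsub>curve_ring K r\<^esub>) \<in> diff_ring_hom (bivar K) KG"
    unfolding curve_field_def by (rule diff_ring_hom_comp[OF class_hom C.fraction_one_hom])
  thus ?thesis using class_one by (simp add: curve_of_poly_def[abs_def] curve_frac_def)
qed

lemma class_zero: "p \<in> carrier Q_K \<Longrightarrow> cls p = \<zero>\<^bsub>curve_ring K r\<^esub> \<longleftrightarrow> p \<in> I"
  unfolding curve_ring_def using B.diff_quot_differential_domain(4)[OF I_prime I_der] by simp

lemma curve_carrier: "carrier (curve_ring K r) = cls ` carrier Q_K"
  unfolding curve_ring_def using B.diff_quot_differential_domain(3)[OF I_prime I_der] by simp

lemma curve_frac_closed:
  "\<lbrakk>p \<in> carrier Q_K; q \<in> carrier Q_K; q \<notin> I\<rbrakk> \<Longrightarrow> curve_frac K r p q \<in> carrier KG"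
  unfolding curve_frac_def curve_field_def using class_zero by (intro C.fraction_closed) (auto simp: curve_carrier)

lemma curve_of_poly_zero:
  assumes "p \<in> carrier Q_K"
  shows "curve_of_poly K r p = \<zero>\<^bsub>KG\<^esub> \<longleftrightarrow> p \<in> I"
proof -
  have "cls p \<in> carrier (curve_ring K r)" using assms by (simp add: curve_carrier)
  moreover have "\<one>\<^bsub>curve_ring K r\<^esub> \<in> carrier (curve_ring K r) - {\<zero>\<^bsub>curve_ring K r\<^esub>}" by simp
  ultimately show ?thesis unfolding curve_of_poly_def curve_frac_def curve_field_def
    using class_one class_zero[OF assms] C.fraction_eq_zero by metis
qed

lemma curve_fieldE:
  assumes "x \<in> carrier KG"
  obtains p q where "p \<in> carrier Q_K" "q \<in> carrier Q_K" "q \<notin> I"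
    "x \<otimes>\<^bsub>KG\<^esub> curve_of_poly K r q = curve_of_poly K r p"
proof -
  obtain S T where x: "x = fraction (curve_ring K r) S T" "S \<in> carrier (curve_ring K r)"
      "T \<in> carrier (curve_ring K r) - {\<zero>\<^bsub>curve_ring K r\<^esub>}"
    using assms unfolding curve_field_def by (rule C.frac_fieldE)
  obtain p q where pq: "p \<in> carrier Q_K" "q \<in> carrier Q_K" "S = cls p" "T = cls q"
    using x(2,3) unfolding curve_carrier by auto
  have "x \<otimes>\<^bsub>KG\<^esub> curve_of_poly K r q = curve_of_poly K r p"
    using class_one C.fraction_denominator[OF x(2,3)] unfolding x(1) pq curve_of_poly_def curve_frac_def curve_field_def by simp
  moreover have "q \<notin> I" using x(3) pq class_zero by auto
  ultimately show ?thesis using that pq by blast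
qed

end

section \<open>Extensions of the function field by an exponential solution\<close>

locale odd_curve_extension =
  odd_curve K r s + D: differential_field D
  for K :: "('a, 'm) diff_ring_scheme" and r s and D :: "('b, 'n) diff_ring_scheme" (structure) +
  fixes \<iota> :: "'a curve_fun \<Rightarrow> 'b"
  assumes iota_hom: "\<iota> \<in> diff_ring_hom KG D"
    and char_K: "n > 0 \<Longrightarrow> of_natural K n \<noteq> \<zero>\<^bsub>K\<^esub>"
    and char_D: "n > 0 \<Longrightarrow> of_natural D n \<noteq> \<zero>"
begin

sublocale \<iota>: differential_embedding KG D \<iota>
  by unfold_locales (rule iota_hom)

definition ev where "ev p = \<iota> (curve_of_poly K r p)"

lemma ev_hom: "ev \<in> diff_ring_hom (bivar K) D"
  unfolding ev_def by (rule diff_ring_hom_comp[OF curve_of_poly_hom iota_hom])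

sublocale ev: differential_embedding "bivar K" D ev
  by unfold_locales (rule ev_hom)

lemma ev_simps [simp]:
  "p \<in> carrier Q_K \<Longrightarrow> ev p \<in> carrier D"
  "\<lbrakk>p \<in> carrier Q_K; q \<in> carrier Q_K\<rbrakk> \<Longrightarrow> ev (p \<oplus>\<^bsub>Q_K\<^esub> q) = ev p \<oplus> ev q"
  "\<lbrakk>p \<in> carrier Q_K; q \<in> carrier Q_K\<rbrakk> \<Longrightarrow> ev (p \<otimes>\<^bsub>Q_K\<^esub> q) = ev p \<otimes> ev q"
  using ev.H.hom_closed[of p] ev.H.hom_add[of p q] ev.H.hom_mult[of p q] by simp_all

lemma iota_zero: "x \<in> carrier KG \<Longrightarrow> \<iota> x = \<zero> \<longleftrightarrow> x = \<zero>\<^bsub>KG\<^esub>"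
proof
  assume x: "x \<in> carrier KG" "\<iota> x = \<zero>"
  show "x = \<zero>\<^bsub>KG\<^esub>"
  proof (rule ccontr)
    assume "x \<noteq> \<zero>\<^bsub>KG\<^esub>"
    hence "inv\<^bsub>KG\<^esub> x \<in> carrier KG"
      "x \<otimes>\<^bsub>KG\<^esub> inv\<^bsub>KG\<^esub> x = \<one>\<^bsub>KG\<^esub>"
      using x(1) F.field_Units by auto
    hence "\<iota> x \<otimes> \<iota> (inv\<^bsub>KG\<^esub> x) = \<one>" "\<iota> (inv\<^bsub>KG\<^esub> x) \<in> carrier D"
      using x(1) by (metis \<iota>.H.hom_mult \<iota>.H.hom_one, simp)
    thus False using x(2) by simp
  qed
qed simp

lemma curve_of_poly_closed: "p \<in> carrier Q_K \<Longrightarrow> curve_of_poly K r p \<in> carrier KG"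
  using curve_of_poly_hom by (auto simp: diff_ring_hom_def ring_hom_def)

lemma ev_zero: "p \<in> carrier Q_K \<Longrightarrow> ev p = \<zero> \<longleftrightarrow> p \<in> I"
  unfolding ev_def using iota_zero[OF curve_of_poly_closed] curve_of_poly_zero by simp

abbreviation e where "e p \<equiv> ev (cst p)"
abbreviation m where "m \<equiv> ev mu"

lemma f_in_I: "f \<in> I"
  using I_iff[of f] Q.l_one[OF f_closed] Q.one_closed by metis

lemma der_mu: "der (bivar K) mu = \<zero>\<^bsub>Q_K\<^esub>"
proof
  fix i show "der (bivar K) mu i = \<zero>\<^bsub>Q_K\<^esub> i"
    using A.der_zero A.der_one A.UP_zero_apply[of i]
    by (simp add: bivar_def der_diff_poly[of "diff_poly K"] mu_apply)
qed

lemma ev_zero_elem: "ev \<zero>\<^bsub>Q_K\<^esub> = \<zero>" using ev.H.hom_zero by simp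

sublocale O: odd_curve_embedding K D "\<lambda>p. ev (cst p)" r "ev mu" s
proof
  show "(\<lambda>p. e p) \<in> diff_ring_hom (diff_poly K) D"
    by (rule diff_ring_hom_comp[OF cst_hom ev_hom])
  show "p = \<zero>\<^bsub>UP K\<^esub>" if p: "p \<in> up K" "e p = \<zero>" for p
  proof -
    have z: "\<zero>\<^bsub>UP K\<^esub> \<in> up K" by (simp add: K.UP_carrier[symmetric])
    have cz: "cst \<zero>\<^bsub>UP K\<^esub> = \<zero>\<^bsub>Q_K\<^esub>" unfolding cst_def using Q.monom_zero by simp
    have "cst p \<in> I" using p ev_zero[of "cst p"] by simp
    thus ?thesis using linear_in_ideal(1)[OF p(1) z] p(1) by (simp add: cz)
  qed
  show "m \<in> carrier D" by simp
  show "der D m = \<zero>" using ev.der[of mu] der_mu ev_zero_elem by simp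
  have "ev f = \<zero>" using ev_zero f_in_I by simp
  hence "m \<otimes> m \<oplus> e r = \<zero>" unfolding f_eq using r_up by simp
  thus "m \<otimes> m = \<ominus> e r" using r_up by (intro D.minus_equality[symmetric]) simp_all
qed (use r_up r_deg r_lead char_K char_D in auto)

lemma ev_linear:
  assumes "p \<in> carrier Q_K"
  obtains a b where "a \<in> up K" "b \<in> up K" "ev p = e a \<oplus> e b \<otimes> m"
proof -
  obtain h a b where h: "h \<in> carrier Q_K" "a \<in> up K" "b \<in> up K"
    "p = h \<otimes>\<^bsub>Q_K\<^esub> f \<oplus>\<^bsub>Q_K\<^esub> (cst a \<oplus>\<^bsub>Q_K\<^esub> cst b \<otimes>\<^bsub>Q_K\<^esub> mu)" using assms by (rule linear_rep)
  have "ev f = \<zero>" using ev_zero f_in_I by simp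
  hence "ev p = e a \<oplus> e b \<otimes> m" unfolding h(4) using h(1-3) by simp
  thus ?thesis using that h by blast
qed

lemma image_subfield: "subfield (\<iota> ` carrier KG) D"
proof -
  have "ring_hom_ring KG D \<iota>"
    by (rule ring_hom_ringI2[OF F.is_ring D.is_ring \<iota>.ring_hom])
  from ring_hom_ring.img_is_subfield(2)[OF this F.carrier_is_subfield D.one_not_zero]
  show ?thesis .
qed

text \<open>A denominator \<open>c + d\<mu>\<close> is made free of \<open>\<mu>\<close> by multiplying with its conjugate \<open>c - d\<mu>\<close>.\<close>

lemma image_curve_functions: "\<iota> ` carrier KG = O.curve_functions"
proof (intro equalityI subsetI)
  fix y assume "y \<in> \<iota> ` carrier KG"
  then obtain x where x: "x \<in> carrier KG" "y = \<iota> x" by blast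
  obtain p q where pq: "p \<in> carrier Q_K" "q \<in> carrier Q_K" "q \<notin> I"
    "x \<otimes>\<^bsub>KG\<^esub> curve_of_poly K r q = curve_of_poly K r p"
    using x(1) by (rule curve_fieldE)
  have rel: "y \<otimes> ev q = ev p" and y: "y \<in> carrier D"
    using x pq curve_of_poly_closed[OF pq(2)] \<iota>.H.hom_mult[of x "curve_of_poly K r q"] by (simp_all add: ev_def)
  have q0: "ev q \<noteq> \<zero>" using ev_zero pq by simp
  obtain a b where ab: "a \<in> up K" "b \<in> up K" "ev p = e a \<oplus> e b \<otimes> m" using pq(1) by (rule ev_linear)
  obtain c d where cd: "c \<in> up K" "d \<in> up K" "ev q = e c \<oplus> e d \<otimes> m" using pq(2) by (rule ev_linear)
  let ?N = "c \<otimes>\<^bsub>UP K\<^esub> c \<oplus>\<^bsub>UP K\<^esub> r \<otimes>\<^bsub>UP K\<^esub> (d \<otimes>\<^bsub>UP K\<^esub> d)"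
  let ?a = "a \<otimes>\<^bsub>UP K\<^esub> c \<oplus>\<^bsub>UP K\<^esub> r \<otimes>\<^bsub>UP K\<^esub> (b \<otimes>\<^bsub>UP K\<^esub> d)" and ?b = "b \<otimes>\<^bsub>UP K\<^esub> c \<ominus>\<^bsub>UP K\<^esub> a \<otimes>\<^bsub>UP K\<^esub> d"
  have N0: "?N \<noteq> \<zero>\<^bsub>UP K\<^esub>"
  proof
    assume "?N = \<zero>\<^bsub>UP K\<^esub>"
    hence "c = \<zero>\<^bsub>UP K\<^esub>" "d = \<zero>\<^bsub>UP K\<^esub>"
      using K.odd_norm_nonzero[OF cd(1,2) r_up r_deg r_lead] by blast+
    thus False using q0 cd(3) O.e_simps(5) by simp
  qed
  have N: "?N \<in> up K" "?a \<in> up K" "?b \<in> up K" using ab cd r_up by simp_all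
  have "(a1 \<oplus> b1 \<otimes> M) \<otimes> (c1 \<ominus> d1 \<otimes> M) = (a1 \<otimes> c1 \<oplus> r1 \<otimes> (b1 \<otimes> d1)) \<oplus> (b1 \<otimes> c1 \<ominus> a1 \<otimes> d1) \<otimes> M"
    and "(c1 \<oplus> d1 \<otimes> M) \<otimes> (c1 \<ominus> d1 \<otimes> M) = c1 \<otimes> c1 \<oplus> r1 \<otimes> (d1 \<otimes> d1)"
    if [simp]: "a1 \<in> carrier D" "b1 \<in> carrier D" "c1 \<in> carrier D" "d1 \<in> carrier D" "r1 \<in> carrier D"
      "M \<in> carrier D" and M: "M \<otimes> M = \<ominus> r1" for a1 b1 c1 d1 r1 M
  proof -
    have r1: "r1 = \<ominus> (M \<otimes> M)" using M by simp
    show "(a1 \<oplus> b1 \<otimes> M) \<otimes> (c1 \<ominus> d1 \<otimes> M) = (a1 \<otimes> c1 \<oplus> r1 \<otimes> (b1 \<otimes> d1)) \<oplus> (b1 \<otimes> c1 \<ominus> a1 \<otimes> d1) \<otimes> M"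
      "(c1 \<oplus> d1 \<otimes> M) \<otimes> (c1 \<ominus> d1 \<otimes> M) = c1 \<otimes> c1 \<oplus> r1 \<otimes> (d1 \<otimes> d1)"
      unfolding r1 by (reify D.polex, simp add: D.normal_form)+
  qed
  note id = this[of "e a" "e b" "e c" "e d" "e r" m, OF _ _ _ _ _ _ O.m_square]
  have "y \<otimes> e ?N = y \<otimes> (ev q \<otimes> (e c \<ominus> e d \<otimes> m))"
    unfolding cd(3) using id(2) ab cd r_up by simp
  also have "\<dots> = ev p \<otimes> (e c \<ominus> e d \<otimes> m)"
    unfolding rel[symmetric] using y pq cd by (subst D.m_assoc) simp_all
  also have "\<dots> = e ?a \<oplus> e ?b \<otimes> m"
    unfolding ab(3) using id(1) ab cd r_up by simp
  finally have "y = (e ?a \<oplus> e ?b \<otimes> m) \<oslash> e ?N"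
    using D.div_eq_iff[of "e ?a \<oplus> e ?b \<otimes> m" "e ?N" y] y N N0 O.e_zero_iff[OF N(1)]
    by (metis O.e_closed O.m_carrier D.a_closed D.m_closed)
  thus "y \<in> O.curve_functions" unfolding O.curve_functions_def using N N0 by blast
next
  fix y assume "y \<in> O.curve_functions"
  then obtain a b c where abc: "a \<in> up K" "b \<in> up K" "c \<in> up K"
    "y = (e a \<oplus> e b \<otimes> m) \<oslash> e c" unfolding O.curve_functions_def by blast
  have mem: "ev p \<in> \<iota> ` carrier KG" if "p \<in> carrier Q_K" for p
    unfolding ev_def using that curve_of_poly_closed by blast
  note S = subringE[OF subfieldE(1)[OF image_subfield]]
  show "y \<in> \<iota> ` carrier KG" unfolding abc(4)
    using abc by (intro D.subfield_div[OF image_subfield] S(6,7) mem) simp_all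
qed

context
  fixes u \<phi> Y
  assumes u: "u \<in> carrier K" and \<phi>: "\<phi> \<in> carrier KG"
    and Y: "Y \<in> carrier D" "Y \<noteq> \<zero>" and Y_der: "der D Y = \<iota> \<phi> \<otimes> Y"
    and schroedinger: "der D (der D Y) = e (O.potential u) \<otimes> Y"
begin

lemma riccati: "der D (\<iota> \<phi>) \<oplus> \<iota> \<phi> \<otimes> \<iota> \<phi> = e (O.potential u)"
proof -
  have [simp]: "\<iota> \<phi> \<in> carrier D" using \<phi> by simp
  have "(der D (\<iota> \<phi>) \<oplus> \<iota> \<phi> \<otimes> \<iota> \<phi>) \<otimes> Y = e (O.potential u) \<otimes> Y"
    using schroedinger Y by (simp add: Y_der D.der_mult D.l_distr D.m_assoc)
  thus ?thesis using Y u O.potential_up[OF u] by (subst (asm) D.m_rcancel) simp_all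
qed

lemma exponential: "exponential_extension D (\<iota> ` carrier KG) (\<iota> \<phi>) Y"
proof (intro exponential_extension.intro exponential_extension_axioms.intro)
  show "differential_field D" by (rule D.differential_field_axioms)
  show "subfield (\<iota> ` carrier KG) D" by (rule image_subfield)
  show "der D x \<in> \<iota> ` carrier KG" if "x \<in> \<iota> ` carrier KG" for x
    using that \<iota>.der[symmetric] by auto
  show "w = \<zero>"
    if "n > 0" "w \<in> \<iota> ` carrier KG" "der D w = of_natural D n \<otimes> \<iota> \<phi> \<otimes> w" for n w
    using O.no_log_derivative[OF _ u that(1) riccati _ that(3)] that(2) \<phi> image_curve_functions by simp
qed (use \<phi> Y Y_der in auto)

abbreviation G where "G \<equiv> diff_generate D (\<iota> ` carrier KG \<union> {Y})"

lemma G_subfield: "subfield G D"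
  using Y by (intro D.diff_generate_subfield) auto

text \<open>A constant of the extension lies in the image of \<open>K(\<Gamma>)\<close> by \<open>no_new_constants\<close>, and is the image of a
  constant because \<open>\<iota>\<close> is injective.\<close>

lemma G_constants: "constants (D\<lparr>carrier := G\<rparr>) = \<iota> ` constants KG"
proof (intro equalityI subsetI)
  fix c assume "c \<in> constants (D\<lparr>carrier := G\<rparr>)"
  hence c: "c \<in> G" "der D c = \<zero>" by (simp_all add: constants_def)
  then obtain z where z: "z \<in> carrier KG" "c = \<iota> z" using exponential_extension.no_new_constants[OF exponential] by blast
  hence "der KG z = \<zero>\<^bsub>KG\<^esub>"
    using c(2) \<iota>.der[OF z(1)] iota_zero F.der_closed by simp
  thus "c \<in> \<iota> ` constants KG" using z by (auto simp: constants_def)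
next
  fix c assume "c \<in> \<iota> ` constants KG"
  then obtain z where z: "z \<in> carrier KG" "der KG z = \<zero>\<^bsub>KG\<^esub>" "c = \<iota> z"
    by (auto simp: constants_def)
  thus "c \<in> constants (D\<lparr>carrier := G\<rparr>)"
    using \<iota>.der[OF z(1)] D.diff_generate_incl[of "\<iota> ` carrier KG \<union> {Y}"]
    by (auto simp: constants_def)
qed

lemma second_solution:
  obtains y where "y \<in> G" "der D (der D y) = e (O.potential u) \<otimes> y"
    "\<And>k1 k2. \<lbrakk>k1 \<in> constants D; k2 \<in> constants D; k1 \<otimes> Y \<oplus> k2 \<otimes> y = \<zero>\<rbrakk>
       \<Longrightarrow> k1 = \<zero> \<and> k2 = \<zero>"
proof -
  have "\<iota> \<phi> \<in> O.curve_functions" using \<phi> image_curve_functions by blast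
  then obtain \<alpha> \<beta> where ab: "\<alpha> \<in> carrier D" "\<beta> \<in> O.curve_functions" "\<beta> \<in> carrier D" "\<beta> \<noteq> \<zero>"
    "\<iota> \<phi> = \<alpha> \<oplus> \<beta> \<otimes> m" "der D \<beta> = \<ominus> (\<alpha> \<otimes> \<beta> \<oplus> \<alpha> \<otimes> \<beta>)"
    by (rule O.riccati_split[OF _ u riccati])
  note sol = D.conjugate_solution[OF ab(1,3) O.m_carrier Y(1) ab(4) Y(2) O.m_der
      Y_der[unfolded ab(5)] ab(6)]
  have m0: "m \<noteq> \<zero>"
  proof
    assume "m = \<zero>"
    hence neg: "\<ominus> e r = \<zero>" using O.m_square by simp
    have "e r = \<ominus> (\<ominus> e r)" by (rule D.minus_minus[OF O.r_carrier, symmetric])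
    also have "\<dots> = \<zero>" unfolding neg by simp
    finally have "r = \<zero>\<^bsub>UP K\<^esub>" using O.e_inj r_up by blast
    thus False using r_lead by (simp add: K.UP_zero_apply)
  qed
  have two: "\<one> \<oplus> \<one> \<noteq> \<zero>" using char_D[of "Suc (Suc 0)"] by simp
  note S = subringE[OF subfieldE(1)[OF G_subfield]]
  have "\<beta> \<in> G" "Y \<in> G" using ab(2) image_curve_functions D.diff_generate_incl by blast+
  hence "\<one> \<oslash> (\<beta> \<otimes> Y) \<in> G" by (intro D.subfield_div[OF G_subfield] S)
  thus ?thesis by (rule that[OF _ sol(2)[folded ab(5), unfolded riccati] sol(3)[OF m0 two]])
qed

end

end

section \<open>The spectral Picard-Vessiot field\<close>

lemma (in differential_domain) schroedinger_apply:
  assumes "v \<in> carrier R" "y \<in> carrier R"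
    and P: "P 0 = v" "P 2 = \<ominus> \<one>" "\<And>i. i \<noteq> 0 \<Longrightarrow> i \<noteq> 2 \<Longrightarrow> P i = \<zero>"
  shows "op_apply R P y = v \<otimes> y \<ominus> der R (der R y)"
proof -
  have c: "P i \<in> carrier R" for i using assms by (cases "i = 0 \<or> i = 2") auto
  have "op_apply R P y = (\<Oplus>i\<in>{..2}. P i \<otimes> (der R ^^ i) y)"
    using c assms by (intro op_apply_upto) auto
  also have "\<dots> = v \<otimes> y \<ominus> der R (der R y)"
    using P c assms(1,2) by (simp add: numeral_2_eq_2 P(3)[of "Suc 0"] a_minus_def l_minus a_comm)
  finally show ?thesis .
qed

lemma (in differential_domain) first_order_apply:
  assumes "p \<in> carrier R" "y \<in> carrier R"
  shows "op_apply R (first_order_op R p) y = der R y \<ominus> p \<otimes> y"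
proof -
  have "op_apply R (first_order_op R p) y = (\<Oplus>i\<in>{..1}. first_order_op R p i \<otimes> (der R ^^ i) y)"
    using assms by (intro op_apply_upto) (auto simp: first_order_op_def)
  also have "\<dots> = der R y \<ominus> p \<otimes> y"
    using assms by (simp add: first_order_op_def a_minus_def l_minus)
  finally show ?thesis .
qed

lemma (in ring) of_natural_add_pow: "add_pow R n \<one> = of_natural R n"
proof (induct n)
  case (Suc n)
  have c: "of_natural R n \<in> carrier R" by (induct n) (simp_all add: of_natural_def)
  have "add_pow R (Suc n) \<one> = add_pow R n \<one> \<oplus> \<one>" by (simp add: add_pow_def nat_pow_def)
  also have "\<dots> = \<one> \<oplus> of_natural R n" unfolding Suc using c by (simp add: a_comm)
  finally show ?case by (simp add: of_natural_def)
qed (simp add: add_pow_def nat_pow_def of_natural_def)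

lemma of_natural_carrier_update: "of_natural (R\<lparr>carrier := S\<rparr>) n = of_natural R n"
  by (induct n) (simp_all add: of_natural_def)

theorem theoremD:
  fixes Sig :: "'a diff_ring" and K :: "'a diff_ring" and D :: "'d diff_ring"
    and L A r :: "nat \<Rightarrow> 'a" and u :: 'a and s :: nat
    and \<phi> :: "'a curve_fun"
    and \<chi>1 \<chi>2 :: "((nat \<Rightarrow> 'a) \<times> (nat \<Rightarrow> 'a)) set"
    and \<rho> :: "'a curve_fun \<Rightarrow> ((nat \<Rightarrow> 'a) \<times> (nat \<Rightarrow> 'a)) set"
    and j :: "((nat \<Rightarrow> 'a) \<times> (nat \<Rightarrow> 'a)) set \<Rightarrow> 'd" and \<Upsilon> :: 'd
  assumes "differential_field Sig" and "char_zero Sig"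
    and "algebraically_closed (Sig\<lparr>carrier := constants Sig\<rparr>)"
    and "u \<in> carrier Sig - constants Sig"
    and "L = schroedinger_op Sig u"
    and "algebro_geometric Sig L"
    and "partner Sig L s A r"
    and "K = Sig\<lparr>carrier := diff_generate Sig (insert u (constants Sig))\<rparr>"
    and "A \<in> carrier (diff_ops K)"
    and "\<phi> \<in> carrier (curve_field K r)"
    and "monic_gcrd (curve_field K r)
           (shifted_op K r L (bivar_lambda K)) (shifted_op K r A (bivar_mu K))
           (first_order_op (curve_field K r) \<phi>)"
    and "\<chi>1 \<in> rat_const_field K" and "\<chi>2 \<in> rat_const_field K"
    and "\<rho> \<in> diff_ring_iso (curve_field K r) (rat_field K)"
    and "\<And>a. a \<in> carrier K \<Longrightarrow> \<rho> (curve_of_poly K r (bivar_const K a)) = rat_const K a"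
    and "\<rho> (curve_of_poly K r (bivar_lambda K)) = \<chi>1"
    and "\<rho> (curve_of_poly K r (bivar_mu K)) = \<chi>2"
    and "\<rho> ` curve_const_field K r = rat_const_field K"
    and "differential_closure (rat_field K) D j"
    and "\<Upsilon> \<in> carrier D - {\<zero>\<^bsub>D\<^esub>}"
    and "op_apply D (first_order_op D (j (\<rho> \<phi>))) \<Upsilon> = \<zero>\<^bsub>D\<^esub>"
  shows "\<exists>(E :: 'd diff_ring) \<iota> \<Phi>. spectral_PV_field K r L E \<iota> \<and>
           \<Phi> \<in> diff_ring_iso
             (D\<lparr>carrier := diff_generate D (j ` carrier (rat_field K) \<union> {\<Upsilon>})\<rparr>) E"
proof -
  interpret Sig: differential_field Sig by fact
  have C_Sig: "insert u (constants Sig) \<subseteq> carrier Sig" using assms(4) by (auto simp: constants_def)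
  note K_def = assms(8)
  interpret K: differential_field K unfolding K_def
    by (rule Sig.differential_subfield[OF Sig.diff_generate_subfield[OF C_Sig] Sig.diff_generate_der])
  have K_simps: "\<zero>\<^bsub>K\<^esub> = \<zero>\<^bsub>Sig\<^esub>" "\<one>\<^bsub>K\<^esub> = \<one>\<^bsub>Sig\<^esub>" "der K = der Sig" "x \<oplus>\<^bsub>K\<^esub> y = x \<oplus>\<^bsub>Sig\<^esub> y" for x y
    by (simp_all add: K_def)
  have C_K: "constants Sig \<subseteq> carrier K" and u: "u \<in> carrier K"
    using Sig.diff_generate_incl[of "insert u (constants Sig)"] by (auto simp: K_def)
  have r: "r \<in> up Sig" "\<And>i. r i \<in> constants Sig" "deg Sig r = 2 * s + 1"
    using assms(7) by (auto simp: partner_def)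
  have r_up: "r \<in> up K"
    using r(1,2) C_K Sig.bound_upD[OF r(1)] by (intro mem_upI) (auto simp: K_simps)
  interpret PS: UP_domain Sig "UP Sig" by unfold_locales simp
  have r0: "r \<noteq> \<zero>\<^bsub>UP Sig\<^esub>" using r(3) PS.deg_zero by auto
  interpret odd_curve K r s
  proof
    show "der K (r i) = \<zero>\<^bsub>K\<^esub>" for i using r(2)[of i] by (simp add: K_simps constants_def)
    show "K.deg_le r (2 * int s + 1)"
      using Sig.deg_le_deg[OF r(1)] r(3) by (simp add: K.deg_le_def Sig.deg_le_def K_simps)
    show "r (2 * s + 1) \<noteq> \<zero>\<^bsub>K\<^esub>" using Sig.lead_coeff_nonzero[OF r(1) r0] r(3) by (simp add: K_simps)
  qed (rule r_up)
  have D: "differential_field D" "differential_field (rat_field K)" "j \<in> diff_ring_hom (rat_field K) D" "char_zero D"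
    using assms(19) by (auto simp: differential_closure_def diff_field_extension_def differentially_closed_def)
  interpret D: differential_field D by (rule D)
  interpret T: differential_field "rat_field K" by (rule D)
  let ?F = "curve_field K r"
  have \<rho>: "\<rho> \<in> diff_ring_hom ?F (rat_field K)" "bij_betw \<rho> (carrier ?F) (carrier (rat_field K))"
    using assms(14) by (auto simp: diff_ring_iso_def diff_ring_hom_def ring_iso_def)
  define \<iota> where "\<iota> = (\<lambda>x. j (\<rho> x))"
  have \<iota>_hom: "\<iota> \<in> diff_ring_hom ?F D"
    unfolding \<iota>_def by (rule diff_ring_hom_comp[OF \<rho>(1) D(3)])
  interpret odd_curve_extension K r s D \<iota>
  proof
    show "\<iota> \<in> diff_ring_hom ?F D" by (rule \<iota>_hom)
    show "of_natural K n \<noteq> \<zero>\<^bsub>K\<^esub>" if "n > 0" for n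
    proof -
      have "of_natural K n = of_natural Sig n" unfolding K_def by (rule of_natural_carrier_update)
      moreover have "of_natural Sig n \<noteq> \<zero>\<^bsub>Sig\<^esub>"
        unfolding Sig.of_natural_add_pow[symmetric] using assms(2) that by (simp add: char_zero_def)
      ultimately show ?thesis by (simp only: K_simps not_False_eq_True)
    qed
    show "of_natural D n \<noteq> \<zero>\<^bsub>D\<^esub>" if "n > 0" for n
      unfolding D.of_natural_add_pow[symmetric] using D(4) that by (simp add: char_zero_def)
  qed
  have image: "j ` carrier (rat_field K) = \<iota> ` carrier ?F"
    unfolding bij_betw_imp_surj_on[OF \<rho>(2), symmetric] \<iota>_def by (simp only: image_image)
  have \<phi>: "\<phi> \<in> carrier ?F" by fact
  have \<Upsilon>: "\<Upsilon> \<in> carrier D" "\<Upsilon> \<noteq> \<zero>\<^bsub>D\<^esub>" using assms(20) by auto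
  have \<iota>\<phi>: "\<iota> \<phi> \<in> carrier D" using \<phi> by simp
  have "der D \<Upsilon> \<ominus>\<^bsub>D\<^esub> \<iota> \<phi> \<otimes>\<^bsub>D\<^esub> \<Upsilon> = \<zero>\<^bsub>D\<^esub>"
    using assms(21) D.first_order_apply[OF \<iota>\<phi> \<Upsilon>(1)] by (simp add: \<iota>_def)
  hence \<Upsilon>_der: "der D \<Upsilon> = \<iota> \<phi> \<otimes>\<^bsub>D\<^esub> \<Upsilon>"
    by (rule D.eq_by_difference) (use \<iota>\<phi> \<Upsilon> in simp_all)
  define P where "P = (\<lambda>i. \<iota> (shifted_op K r L (bivar_lambda K) i))"
  have cop: "curve_of_poly K r (bivar_const K a) \<in> carrier ?F" "ev (bivar_const K a) = e (up_ring.monom (UP K) a 0)"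
    if "a \<in> carrier K" for a
  proof -
    have "up_ring.monom (UP K) a 0 \<in> up K" using P.monom_closed[OF that, of 0] by (simp add: K.UP_carrier)
    moreover have "bivar_const K a = cst (up_ring.monom (UP K) a 0)" by (simp add: bivar_const_def cst_def)
    ultimately show "curve_of_poly K r (bivar_const K a) \<in> carrier ?F" "ev (bivar_const K a) = e (up_ring.monom (UP K) a 0)"
      using curve_of_poly_closed by simp_all
  qed
  have lam: "bivar_lambda K = cst (up_ring.monom (UP K) \<one>\<^bsub>K\<^esub> 1)" by (simp add: bivar_lambda_def cst_def)
  have monom_up: "up_ring.monom (UP K) a n \<in> up K" if "a \<in> carrier K" for a n
    using P.monom_closed[OF that] by (simp add: K.UP_carrier)
  have lamc: "curve_of_poly K r (bivar_lambda K) \<in> carrier ?F"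
    unfolding lam by (rule curve_of_poly_closed) (simp add: monom_up)
  have neg_one: "\<ominus>\<^bsub>Sig\<^esub> \<one>\<^bsub>Sig\<^esub> = \<ominus>\<^bsub>K\<^esub> \<one>\<^bsub>K\<^esub>"
  proof (rule Sig.minus_equality)
    have "\<ominus>\<^bsub>K\<^esub> \<one>\<^bsub>K\<^esub> \<oplus>\<^bsub>K\<^esub> \<one>\<^bsub>K\<^esub> = \<zero>\<^bsub>K\<^esub>" by (rule K.l_neg) simp
    thus "\<ominus>\<^bsub>K\<^esub> \<one>\<^bsub>K\<^esub> \<oplus>\<^bsub>Sig\<^esub> \<one>\<^bsub>Sig\<^esub> = \<zero>\<^bsub>Sig\<^esub>" by (simp add: K_simps)
    have "carrier K \<subseteq> carrier Sig" using subfieldE(3)[OF Sig.diff_generate_subfield[OF C_Sig]] by (simp add: K_def)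
    thus "\<ominus>\<^bsub>K\<^esub> \<one>\<^bsub>K\<^esub> \<in> carrier Sig" by auto
  qed simp
  have L: "L i = (if i = 0 then u else if i = 2 then \<ominus>\<^bsub>K\<^esub> \<one>\<^bsub>K\<^esub> else \<zero>\<^bsub>K\<^esub>)" for i
    unfolding assms(5) schroedinger_op_def neg_one by (simp add: K_simps)
  have L_K: "L i \<in> carrier K" for i using u by (simp add: L)
  have op_const: "op_const ?F (curve_of_poly K r (bivar_lambda K)) \<in> up ?F"
    using lamc by (intro mem_upI) (auto simp: op_const_def bound_def)
  have "P i = \<iota> (curve_of_poly K r (bivar_const K (L i)) \<ominus>\<^bsub>?F\<^esub> op_const ?F (curve_of_poly K r (bivar_lambda K)) i)" for i
    unfolding P_def shifted_op_def by (simp add: F.diff_ops_minus[OF op_const])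
  hence P_eq: "P i = e (up_ring.monom (UP K) (L i) 0) \<ominus>\<^bsub>D\<^esub> (if i = 0 then ev (bivar_lambda K) else \<zero>\<^bsub>D\<^esub>)" for i
    using cop[OF L_K[of i]] lamc by (simp add: \<iota>.hom_minus op_const_def ev_def)
  have P: "P 0 = e (O.potential u)" "P 2 = \<ominus>\<^bsub>D\<^esub> \<one>\<^bsub>D\<^esub>" "\<And>i. i \<noteq> 0 \<Longrightarrow> i \<noteq> 2 \<Longrightarrow> P i = \<zero>\<^bsub>D\<^esub>"
  proof -
    show "P 0 = e (O.potential u)"
      unfolding P_eq O.potential_def using u monom_up[of u 0] monom_up[of "\<one>\<^bsub>K\<^esub>" 1]
      by (simp add: L lam)
    have "up_ring.monom (UP K) (\<ominus>\<^bsub>K\<^esub> \<one>\<^bsub>K\<^esub>) 0 = \<ominus>\<^bsub>UP K\<^esub> \<one>\<^bsub>UP K\<^esub>"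
      using P.monom_a_inv[of "\<one>\<^bsub>K\<^esub>" 0] P.monom_one by simp
    moreover have "e (\<ominus>\<^bsub>UP K\<^esub> \<one>\<^bsub>UP K\<^esub>) = \<ominus>\<^bsub>D\<^esub> \<one>\<^bsub>D\<^esub>"
      using O.E.H.hom_a_inv[of "\<one>\<^bsub>UP K\<^esub>"] O.e_simps(6) by simp
    ultimately show "P 2 = \<ominus>\<^bsub>D\<^esub> \<one>\<^bsub>D\<^esub>" unfolding P_eq by (simp add: L)
    show "P i = \<zero>\<^bsub>D\<^esub>" if "i \<noteq> 0" "i \<noteq> 2" for i
      unfolding P_eq using that P.monom_zero[of 0] O.e_simps(5) by (simp add: L)
  qed
  \<comment> \<open>The right factor \<open>\<partial> - \<phi>\<close> annihilates \<open>\<Upsilon>\<close>, hence so does \<open>L - \<lambda>\<close>.\<close>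
  have G_up: "first_order_op ?F \<phi> \<in> up ?F"
    using \<phi> by (intro mem_upI exI[of _ 1]) (auto simp: first_order_op_def bound_def)
  have "right_divides ?F (first_order_op ?F \<phi>) (shifted_op K r L (bivar_lambda K))"
    using assms(11) by (simp add: monic_gcrd_def)
  then obtain Q' where Q': "Q' \<in> up ?F" "shifted_op K r L (bivar_lambda K) = Q' \<otimes>\<^bsub>diff_ops ?F\<^esub> first_order_op ?F \<phi>"
    by (auto simp: right_divides_def)
  have "(\<lambda>i. \<iota> (first_order_op ?F \<phi> i)) = first_order_op D (j (\<rho> \<phi>))"
    using \<phi> by (intro ext) (simp add: first_order_op_def \<iota>_def[symmetric] \<iota>.H.hom_a_inv, simp add: \<iota>_def)
  hence "op_apply D (\<lambda>i. \<iota> (first_order_op ?F \<phi> i)) \<Upsilon> = \<zero>\<^bsub>D\<^esub>" using assms(21) by simp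
  hence "op_apply D P \<Upsilon> = \<zero>\<^bsub>D\<^esub>"
    unfolding P_def Q'(2) by (rule \<iota>.op_apply_right_factor[OF Q'(1) G_up \<Upsilon>(1)])
  hence schroedinger: "der D (der D \<Upsilon>) = e (O.potential u) \<otimes>\<^bsub>D\<^esub> \<Upsilon>"
    using D.schroedinger_apply[OF _ \<Upsilon>(1) P] \<Upsilon>(1) O.potential_up[OF u] by simp
  note ctx = u \<phi> \<Upsilon> \<Upsilon>_der schroedinger
  let ?G = "diff_generate D (\<iota> ` carrier ?F \<union> {\<Upsilon>})"
  define E where "E = D\<lparr>carrier := ?G\<rparr>"
  have G: "subfield ?G D" by (rule G_subfield[OF ctx])
  have G_D: "?G \<subseteq> carrier D" by (rule subfieldE(3)[OF G])
  have incl: "\<iota> ` carrier ?F \<subseteq> ?G" "\<Upsilon> \<in> ?G"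
    using D.diff_generate_incl[of "\<iota> ` carrier ?F \<union> {\<Upsilon>}"] by simp_all
  interpret E: differential_field E unfolding E_def
    by (rule D.differential_subfield[OF G D.diff_generate_der])
  have E_simps: "carrier E = ?G" "\<zero>\<^bsub>E\<^esub> = \<zero>\<^bsub>D\<^esub>" "\<one>\<^bsub>E\<^esub> = \<one>\<^bsub>D\<^esub>" "der E = der D"
    "x \<oplus>\<^bsub>E\<^esub> y = x \<oplus>\<^bsub>D\<^esub> y" "x \<otimes>\<^bsub>E\<^esub> y = x \<otimes>\<^bsub>D\<^esub> y" for x y by (simp_all add: E_def)
  obtain y where y: "y \<in> ?G" "der D (der D y) = e (O.potential u) \<otimes>\<^bsub>D\<^esub> y"
    "\<And>k1 k2. \<lbrakk>k1 \<in> constants D; k2 \<in> constants D; k1 \<otimes>\<^bsub>D\<^esub> \<Upsilon> \<oplus>\<^bsub>D\<^esub> k2 \<otimes>\<^bsub>D\<^esub> y = \<zero>\<^bsub>D\<^esub>\<rbrakk>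
       \<Longrightarrow> k1 = \<zero>\<^bsub>D\<^esub> \<and> k2 = \<zero>\<^bsub>D\<^esub>"
    using second_solution[OF ctx] by blast
  have neg_E: "\<ominus>\<^bsub>E\<^esub> \<one>\<^bsub>E\<^esub> = \<ominus>\<^bsub>D\<^esub> \<one>\<^bsub>D\<^esub>"
  proof (rule D.minus_equality[symmetric])
    show "\<ominus>\<^bsub>E\<^esub> \<one>\<^bsub>E\<^esub> \<oplus>\<^bsub>D\<^esub> \<one>\<^bsub>D\<^esub> = \<zero>\<^bsub>D\<^esub>" using E.l_neg[OF E.one_closed] by (simp add: E_simps)
    show "\<ominus>\<^bsub>E\<^esub> \<one>\<^bsub>E\<^esub> \<in> carrier D" using E.a_inv_closed[OF E.one_closed] G_D by (auto simp: E_simps)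
  qed simp
  have pot_G: "e (O.potential u) \<in> ?G"
    using incl(1) curve_of_poly_closed[of "cst (O.potential u)"] u by (auto simp: ev_def)
  have solution: "op_apply E P z = \<zero>\<^bsub>E\<^esub>"
    if z: "z \<in> ?G" "der D (der D z) = e (O.potential u) \<otimes>\<^bsub>D\<^esub> z" for z
  proof -
    have "op_apply E P z = e (O.potential u) \<otimes>\<^bsub>E\<^esub> z \<ominus>\<^bsub>E\<^esub> der E (der E z)"
      by (rule E.schroedinger_apply) (use z pot_G P neg_E in \<open>simp_all add: E_simps\<close>)
    also have "der E (der E z) = e (O.potential u) \<otimes>\<^bsub>E\<^esub> z" using z by (simp add: E_simps)
    also have "e (O.potential u) \<otimes>\<^bsub>E\<^esub> z \<ominus>\<^bsub>E\<^esub> (e (O.potential u) \<otimes>\<^bsub>E\<^esub> z) = \<zero>\<^bsub>E\<^esub>"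
      using z pot_G E.m_closed[of "e (O.potential u)" z] by (simp add: E_simps(1))
    finally show ?thesis .
  qed
  \<comment> \<open>\<open>\<rho>\<close> matches \<open>C(\<Gamma>)\<close> with \<open>C(\<tau>)\<close>, which are all constants of \<open>K(\<tau>)\<close>.\<close>
  have constants_F: "constants ?F = curve_const_field K r"
  proof -
    have ccf: "curve_const_field K r \<subseteq> carrier ?F"
      unfolding curve_const_field_def using curve_frac_closed by auto
    have cF: "x \<in> constants ?F \<longleftrightarrow> x \<in> carrier ?F \<and> \<rho> x \<in> constants (rat_field K)" for x
    proof -
      interpret \<rho>: differential_embedding ?F "rat_field K" \<rho> by unfold_locales (rule \<rho>(1))
      have "der ?F x = \<zero>\<^bsub>?F\<^esub> \<longleftrightarrow> \<rho> (der ?F x) = \<rho> \<zero>\<^bsub>?F\<^esub>" if "x \<in> carrier ?F"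
        by (rule inj_on_eq_iff[OF bij_betw_imp_inj_on[OF \<rho>(2)] F.der_closed[OF that] F.zero_closed,
              symmetric])
      thus ?thesis by (auto simp: constants_def \<rho>.der)
    qed
    have "constants (rat_field K) = \<rho> ` curve_const_field K r"
      using K.constants_rat_field assms(18) by simp
    hence "x \<in> constants ?F \<longleftrightarrow> x \<in> carrier ?F \<and> \<rho> x \<in> \<rho> ` curve_const_field K r" for x using cF by simp
    moreover have "x \<in> curve_const_field K r" if "x \<in> carrier ?F" "\<rho> x \<in> \<rho> ` curve_const_field K r" for x
      using that ccf bij_betw_imp_inj_on[OF \<rho>(2)] by (meson inj_on_image_mem_iff)
    ultimately show ?thesis using ccf by blast
  qed
  have "diff_field_extension ?F E \<iota>"
    unfolding diff_field_extension_def
  proof (intro conjI)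
    show "differential_field ?F" by (rule F.differential_field_axioms)
    show "differential_field E" by (rule E.differential_field_axioms)
    show "\<iota> \<in> diff_ring_hom ?F E"
      using \<iota>_hom incl(1) by (auto simp: diff_ring_hom_def ring_hom_def E_simps)
  qed
  moreover have "fundamental_pair E P \<Upsilon> y"
    unfolding fundamental_pair_def
  proof (intro conjI ballI impI)
    show "\<Upsilon> \<in> carrier E" "y \<in> carrier E" using incl y by (simp_all add: E_simps)
    show "op_apply E P \<Upsilon> = \<zero>\<^bsub>E\<^esub>" "op_apply E P y = \<zero>\<^bsub>E\<^esub>" using solution incl y schroedinger by simp_all
    fix c1 c2 assume c: "c1 \<in> constants E" "c2 \<in> constants E" "c1 \<otimes>\<^bsub>E\<^esub> \<Upsilon> \<oplus>\<^bsub>E\<^esub> c2 \<otimes>\<^bsub>E\<^esub> y = \<zero>\<^bsub>E\<^esub>"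
    have "c1 \<in> constants D" "c2 \<in> constants D" using c(1,2) G_D by (auto simp: constants_def E_simps)
    from y(3)[OF this] c(3) show "c1 = \<zero>\<^bsub>E\<^esub>" "c2 = \<zero>\<^bsub>E\<^esub>" by (simp_all add: E_simps)
  qed
  moreover have "carrier E = diff_generate E (\<iota> ` carrier ?F \<union> {\<Upsilon>, y})"
  proof (rule antisym)
    show "diff_generate E (\<iota> ` carrier ?F \<union> {\<Upsilon>, y}) \<subseteq> carrier E"
      by (rule E.diff_generate_least[OF E.carrier_is_subfield]) (use incl y in \<open>auto simp: E_simps D.diff_generate_der\<close>)
    have gen: "?G \<subseteq> S" if S: "subfield S E" "der E ` S \<subseteq> S" "\<iota> ` carrier ?F \<union> {\<Upsilon>, y} \<subseteq> S" for S
    proof (rule D.diff_generate_least)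
      have "S \<subseteq> ?G" using subfieldE(3)[OF S(1)] by (simp add: E_simps)
      moreover have "field (E\<lparr>carrier := S\<rparr>)" by (rule E.subfield_iff(2)[OF S(1)])
      ultimately show "subfield S D" using G_D by (intro D.subfield_iff(1)) (auto simp: E_def)
    qed (use S in \<open>auto simp: E_simps\<close>)
    show "carrier E \<subseteq> diff_generate E (\<iota> ` carrier ?F \<union> {\<Upsilon>, y})"
      unfolding diff_generate_def[of E] E_simps(1) using gen by blast
  qed
  moreover have "constants E = \<iota> ` curve_const_field K r"
    unfolding E_def constants_F[symmetric] by (rule G_constants[OF ctx])
  ultimately have "spectral_PV_field K r L E \<iota>"
    unfolding spectral_PV_field_def P_def[symmetric] using constants_F by blast
  moreover have "id \<in> diff_ring_iso (D\<lparr>carrier := diff_generate D (j ` carrier (rat_field K) \<union> {\<Upsilon>})\<rparr>) E"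
    unfolding image E_def[symmetric] by (auto simp: diff_ring_iso_def ring_iso_def ring_hom_def)
  ultimately show ?thesis by blast
qed

end
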